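(* There exist absolute constants $C,c>0$ such that the following holds. Let $n\in\mathbb{N}$ be even and let $M_n$ be a uniformly random element of $\mathcal{M}^{\pm}_{n,n/2}$ with rows $R_1,\dots,R_n$. For each $j\in[n]$, let $H_j:=\mathrm{span}\{R_i: i\in[n],\, i\ne j\}$, and let $v_j$ be a random unit vector in $\mathbb{R}^n$ that is orthogonal to $H_j$ and measurable with respect to the $\sigma$-field generated by $H_j$. Then for all $j\in[n]$ and all $\varepsilon\ge 0$, $$\mathcal{L}(\langle R_j,v_j\rangle,\varepsilon)\le C\varepsilon+2e^{-cn}.$$ In particular, for all $j\in[n]$ and all $\varepsilon\ge0$, $$\mathbf{P}\left(\operatorname{dist}(R_j,H_j)\le\varepsilon\right)\le C\varepsilon+2e^{-cn}.$$
   Context: For even $n$, $\mathcal{M}^{\pm}_{n,n/2}$ denotes the set of all $n\times n$ matrices $Q$ with entries in $\{-1,0,1\}$ satisfying $\sum_{j=1}^n|Q(i,j)|=n/2$ for every $i\in[n]=\{1,\dots,n\}$. Equivalently, the rows of $M_n$ are independent and each is uniformly distributed over the vectors in $\{-1,0,1\}^n$ with exactly $n/2$ zero coordinates. The Lévy concentration function of a real-valued random variable $X$ at scale $\varepsilon\ge0$ is $\mathcal{L}(X,\varepsilon):=\sup_{\lambda\in\mathbb{R}}\mathbf{P}(|X-\lambda|\le\varepsilon)$. $\operatorname{dist}$ is the Euclidean distance. *)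

theory Defs
  imports "HOL-Probability.Probability" "Jordan_Normal_Form.VS_Connect"
begin

no_notation Inner_Product.real_inner_class.inner (infix "\<bullet>" 70)
no_notation Finite_Cartesian_Product.vec.vec_nth (infixl "$" 90)
hide_const (open) Finite_Cartesian_Product.vec Finite_Cartesian_Product.row
  Finite_Cartesian_Product.mat Finite_Cartesian_Product.rows

text \<open>
  The dimension is quantified inside the scope of the absolute constants, so vectors and matrices
  carry their dimension explicitly. The index set \<open>{1,\<dots>,n}\<close> is rendered as \<open>{0,\<dots>,n - 1}\<close>.
\<close>

text \<open>
  The equation on row sums lives in the reals; it can hold only for even \<open>n\<close>.
\<close>

definition sparse_sign_mats :: "nat \<Rightarrow> real mat set" where
  "sparse_sign_mats n =
     {Q \<in> carrier_mat n n.
        (\<forall>i<n. \<forall>j<n. Q $$ (i, j) \<in> {-1, 0, 1}) \<and>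
        (\<forall>i<n. (\<Sum>j<n. \<bar>Q $$ (i, j)\<bar>) = real n / 2)}"

text \<open>
  The sample space is the set of matrices itself, so that the random matrix is the identity and
  random variables are functions of the matrix.
\<close>

definition sparse_sign_measure :: "nat \<Rightarrow> real mat measure" where
  "sparse_sign_measure n = uniform_count_measure (sparse_sign_mats n)"

definition other_rows_span :: "nat \<Rightarrow> nat \<Rightarrow> real mat \<Rightarrow> real vec set" where
  "other_rows_span n j Q =
     LinearCombinations.module.span class_ring (module_vec TYPE(real) n)
       {row Q i | i. i < n \<and> i \<noteq> j}"

text \<open>
  The random subspace takes only finitely many values; its target carries the discrete
  \<open>\<sigma>\<close>-algebra.
\<close>

definition sigma_other_rows :: "nat \<Rightarrow> nat \<Rightarrow> real mat measure" where
  "sigma_other_rows n j =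
     vimage_algebra (space (sparse_sign_measure n)) (other_rows_span n j) (count_space UNIV)"

definition eucl_norm :: "real vec \<Rightarrow> real" where
  "eucl_norm x = sqrt (x \<bullet> x)"

definition eucl_dist_set :: "real vec \<Rightarrow> real vec set \<Rightarrow> real" where
  "eucl_dist_set x H = (INF y\<in>H. eucl_norm (x - y))"

text \<open>
  Every matrix in the sample space has positive probability, so almost sure properties of \<open>v\<close> hold
  everywhere on it. Measurability of the random vector is stated coordinatewise.
\<close>

definition random_unit_normal :: "nat \<Rightarrow> nat \<Rightarrow> (real mat \<Rightarrow> real vec) \<Rightarrow> bool" where
  "random_unit_normal n j v \<longleftrightarrow>
     (\<forall>k<n. (\<lambda>Q. v Q $ k) \<in> borel_measurable (sigma_other_rows n j)) \<and>
     (\<forall>Q \<in> space (sparse_sign_measure n).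
        v Q \<in> carrier_vec n \<and> eucl_norm (v Q) = 1 \<and>
        (\<forall>y \<in> other_rows_span n j Q. v Q \<bullet> y = 0))"

definition levy_concentration :: "'a measure \<Rightarrow> ('a \<Rightarrow> real) \<Rightarrow> real \<Rightarrow> real" where
  "levy_concentration M X \<epsilon> = (SUP t. measure M {\<omega> \<in> space M. \<bar>X \<omega> - t\<bar> \<le> \<epsilon>})"

lemma finite_sparse_sign_mats: "finite (sparse_sign_mats n)"
proof -
  let ?g = "\<lambda>f. mat n n (\<lambda>(i, j). f (i, j)) :: real mat"
  let ?F = "({0..<n} \<times> {0..<n}) \<rightarrow>\<^sub>E {-1, 0, 1::real}"
  have "Q \<in> ?g ` ?F" if "Q \<in> sparse_sign_mats n" for Q
  proof (rule image_eqI)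
    show "Q = ?g (restrict (\<lambda>p. Q $$ p) ({0..<n} \<times> {0..<n}))"
      using that by (intro eq_matI) (auto simp: sparse_sign_mats_def)
    have "Q $$ p \<in> {-1, 0, 1}" if "p \<in> {0..<n} \<times> {0..<n}" for p
    proof -
      obtain a b where "p = (a, b)" "a < n" "b < n" using \<open>p \<in> _\<close> by auto
      then show ?thesis using \<open>Q \<in> _\<close> unfolding sparse_sign_mats_def by blast
    qed
    then show "restrict (\<lambda>p. Q $$ p) ({0..<n} \<times> {0..<n}) \<in> ?F"
      unfolding restrict_PiE_iff by blast
  qed
  then have "sparse_sign_mats n \<subseteq> ?g ` ?F" by blast
  moreover have "finite ?F" by (intro finite_PiE) auto
  ultimately show ?thesis by (meson finite_imageI finite_subset)
qed

lemma sparse_sign_mats_nonempty: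
  assumes "even n"
  shows "sparse_sign_mats n \<noteq> {}"
proof -
  obtain m where n: "n = 2 * m" using assms by blast
  have "(\<Sum>j<n. if j < m then 1 else 0 :: real) = real n / 2"
  proof -
    have "(\<Sum>j<n. if j < m then 1 else 0 :: real) = (\<Sum>j\<in>{j \<in> {..<n}. j < m}. 1)"
      by (rule sum.inter_filter[symmetric]) simp
    also have "{j \<in> {..<n}. j < m} = {..<m}" using n by auto
    finally show ?thesis using n by simp
  qed
  then have "mat n n (\<lambda>(i, j). if j < m then 1 else 0) \<in> sparse_sign_mats n"
    by (auto simp: sparse_sign_mats_def if_distrib cong: if_cong)
  then show ?thesis by blast
qed

lemma prob_space_sparse_sign_measure:
  "even n \<Longrightarrow> prob_space (sparse_sign_measure n)"
  unfolding sparse_sign_measure_def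
  by (intro prob_space_uniform_count_measure finite_sparse_sign_mats sparse_sign_mats_nonempty)

end

theory Submission
  imports Defs
begin

text \<open>
  A row \<open>R\<close> is a uniform half-size subset of the coordinates with independent signs, so the
  characteristic function of \<open>\<langle>R, x\<rangle>\<close> is the average over half-size sets \<open>S\<close> of the products of
  \<open>cos (u * x i)\<close> over \<open>i \<in> S\<close>. It decays like a Gaussian for \<open>u\<close> up to a constant times \<open>sqrt n\<close> if \<open>x\<close>
  has many coordinates of order \<open>1 / sqrt n\<close>, and beyond that it is exponentially small unless \<open>u * x\<close>
  is within Euclidean distance \<open>\<kappa> * sqrt n\<close> of the lattice \<open>\<pi> \<int>\<^sup>n\<close>. Gaussian smoothing turns this into a
  small ball bound at every scale above an exponentially small one, provided no \<open>u\<close> in a range of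
  exponential length brings \<open>u * x\<close> near the lattice.

  A unit vector normal to \<open>n - 1\<close> rows violates these conditions only with exponentially small
  probability. Almost sparse vectors are rounded to sparse lattice vectors, of which there are few.
  Classify any other violating vector by the first scale \<open>D\<close> at which it comes near the lattice
  and round it to the lattice \<open>(\<kappa> / D) \<int>\<^sup>n\<close>; a randomised rounding needs only the
  Hilbert--Schmidt norm of the matrix, which is deterministically at most \<open>n\<close>. There are at most
  \<open>(C * D / sqrt n)^n\<close> rounded vectors, with \<open>C\<close> not depending on \<open>\<kappa>\<close>, while each is almost annihilated by \<open>n - 1\<close>
  rows with probability at most \<open>(C * \<kappa> * sqrt n / D)^(n - 1)\<close>, so a small constant \<open>\<kappa>\<close> lets the union
  bound win.
\<close>

section \<open>Rows and random signs\<close>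

text \<open>Why the number of rounded vectors is free of \<open>\<kappa>\<close>: a plain net of
  mesh \<open>\<kappa> / D\<close> costs a factor \<open>1 / \<kappa>\<close> per coordinate, just
  what the small ball bound at scale \<open>\<kappa> * sqrt n / D\<close> gains. But if
  \<open>D * v\<close> is within order \<open>\<kappa> * sqrt n\<close> of \<open>pi * y\<close>
  with \<open>y\<close> integral, then the rounded vector \<open>(\<kappa> / D) * z\<close> has
  \<open>z\<close> within order \<open>sqrt n\<close> of \<open>pi * y / \<kappa>\<close>. So each
  \<open>y\<close> admits at most \<open>C^n\<close> vectors \<open>z\<close>, and the
  \<open>y\<close> are integer points of a ball of radius of order \<open>D\<close>. This permits
  fixing the constants in the order: spread parameters, small ball constant, counting constant,
  \<open>\<kappa>\<close>, exponential rate. Only \<open>n - 1\<close> rows face an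
  \<open>n\<close>-dimensional net, so one factor \<open>D / sqrt n\<close> survives at each scale,
  and the number of scales is another exponential factor; a net gain of \<open>exp (- 1)\<close> per
  row beats both when the rate is small. Dependent rows have many unit normals, so all unit normals
  are controlled at once. Measurability of \<open>v\<close> makes it a function of the other rows,
  which is how independence from row \<open>j\<close> is used.\<close>

definition signed_sum :: "'a set \<Rightarrow> 'a set \<Rightarrow> ('a \<Rightarrow> real) \<Rightarrow> real" where
  "signed_sum S T x = (\<Sum>i\<in>S. if i \<in> T then - x i else x i)"

lemma sum_Pow_insert:
  assumes "finite S" "a \<notin> S"
  shows "(\<Sum>T\<in>Pow (insert a S). F T) = (\<Sum>T\<in>Pow S. F T + (F (insert a T) :: real))"
proof -
  have inj: "inj_on (insert a) (Pow S)"
    using assms(2) by (auto simp: inj_on_def)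
  have "(\<Sum>T\<in>Pow (insert a S). F T) = (\<Sum>T\<in>Pow S. F T) + (\<Sum>T\<in>insert a ` Pow S. F T)"
    unfolding Pow_insert using assms by (intro sum.union_disjoint) auto
  also have "(\<Sum>T\<in>insert a ` Pow S. F T) = (\<Sum>T\<in>Pow S. F (insert a T))"
    by (simp add: sum.reindex[OF inj])
  finally show ?thesis by (simp add: sum.distrib)
qed

lemma sum_signed_sum_insert:
  assumes "finite S" "a \<notin> S"
  shows "(\<Sum>T\<in>Pow (insert a S). F (signed_sum (insert a S) T x)) =
         (\<Sum>T\<in>Pow S. F (x a + signed_sum S T x) + (F (signed_sum S T x - x a) :: real))"
proof -
  have "signed_sum (insert a S) T x = x a + signed_sum S T x"
       "signed_sum (insert a S) (insert a T) x = signed_sum S T x - x a" if "T \<in> Pow S" for T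
  proof -
    have "a \<notin> T" using that assms(2) by auto
    then show "signed_sum (insert a S) T x = x a + signed_sum S T x"
      using assms by (simp add: signed_sum_def)
    have "(\<Sum>i\<in>S. if i \<in> insert a T then - x i else x i) = (\<Sum>i\<in>S. if i \<in> T then - x i else x i)"
      using assms(2) by (intro sum.cong) auto
    then show "signed_sum (insert a S) (insert a T) x = signed_sum S T x - x a"
      using assms by (simp add: signed_sum_def)
  qed
  then show ?thesis
    by (simp add: sum_Pow_insert[OF assms])
qed

text \<open>Summing over the sign of one coordinate applies
  \<open>cos (u + w) + cos (w - u) = 2 * cos u * cos w\<close>, so coordinates factor out one at a
  time; the shift \<open>b\<close> is left over at the empty set.\<close>

lemma sum_cos_signed_sum:
  assumes "finite S"
  shows "(\<Sum>T\<in>Pow S. cos (signed_sum S T x - b)) = 2 ^ card S * cos b * (\<Prod>i\<in>S. cos (x i))"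
  using assms
proof (induction S)
  case empty
  then show ?case by (simp add: signed_sum_def)
next
  case (insert a S)
  have *: "cos (x a + y - b) + cos (y - x a - b) = 2 * cos (x a) * cos (y - b)" for y
  proof -
    have "cos (x a + (y - b)) + cos ((y - b) - x a) = 2 * cos (x a) * cos (y - b)"
      by (simp add: cos_add cos_diff)
    moreover have "x a + y - b = x a + (y - b)" "y - x a - b = (y - b) - x a" by auto
    ultimately show ?thesis by (simp only:)
  qed
  have "(\<Sum>T\<in>Pow (insert a S). cos (signed_sum (insert a S) T x - b)) =
        (\<Sum>T\<in>Pow S. 2 * cos (x a) * cos (signed_sum S T x - b))"
    by (subst sum_signed_sum_insert[OF insert.hyps, where F = "\<lambda>y. cos (y - b)"]) (simp only: *)
  also have "\<dots> = 2 * cos (x a) * (2 ^ card S * cos b * (\<Prod>i\<in>S. cos (x i)))"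
    by (simp add: sum_distrib_left[symmetric] insert.IH)
  also have "\<dots> = 2 ^ card (insert a S) * cos b * (\<Prod>i\<in>insert a S. cos (x i))"
    using insert.hyps by simp
  finally show ?case .
qed

lemma sum_signed_sum_sq:
  assumes "finite S"
  shows "(\<Sum>T\<in>Pow S. (signed_sum S T x)\<^sup>2) = 2 ^ card S * (\<Sum>i\<in>S. (x i)\<^sup>2)"
  using assms
proof (induction S)
  case empty
  then show ?case by (simp add: signed_sum_def)
next
  case (insert a S)
  have *: "(x a + y)\<^sup>2 + (y - x a)\<^sup>2 = 2 * y\<^sup>2 + 2 * (x a)\<^sup>2" for y
    by (simp add: power2_eq_square algebra_simps)
  have "(\<Sum>T\<in>Pow (insert a S). (signed_sum (insert a S) T x)\<^sup>2) =
        (\<Sum>T\<in>Pow S. 2 * (signed_sum S T x)\<^sup>2 + 2 * (x a)\<^sup>2)"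
    by (subst sum_signed_sum_insert[OF insert.hyps, where F = "\<lambda>y. y\<^sup>2"]) (simp only: *)
  then show ?case
    using insert by (simp add: sum.distrib sum_distrib_left[symmetric] card_Pow algebra_simps)
qed

text \<open>Khinchine's inequality for the fourth moment, with the Gaussian constant 3.\<close>

lemma sum_signed_sum_pow4_le:
  assumes "finite S"
  shows "(\<Sum>T\<in>Pow S. (signed_sum S T x) ^ 4) \<le> 2 ^ card S * (3 * (\<Sum>i\<in>S. (x i)\<^sup>2)\<^sup>2)"
  using assms
proof (induction S)
  case empty
  then show ?case by (simp add: signed_sum_def)
next
  case (insert a S)
  have *: "(x a + y) ^ 4 + (y - x a) ^ 4 = 2 * y ^ 4 + 12 * (x a)\<^sup>2 * y\<^sup>2 + 2 * (x a) ^ 4" for y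
    by (simp add: power2_eq_square power4_eq_xxxx algebra_simps)
  let ?w = "\<Sum>i\<in>S. (x i)\<^sup>2"
  have "(\<Sum>T\<in>Pow (insert a S). (signed_sum (insert a S) T x) ^ 4) =
        2 * (\<Sum>T\<in>Pow S. (signed_sum S T x) ^ 4) + 12 * (x a)\<^sup>2 * (2 ^ card S * ?w)
          + 2 ^ card S * (2 * (x a) ^ 4)"
    by (subst sum_signed_sum_insert[OF insert.hyps, where F = "\<lambda>y. y ^ 4"])
       (simp add: * sum.distrib sum_distrib_left[symmetric] sum_signed_sum_sq insert card_Pow)
  \<comment> \<open>Raising \<open>2 * (x a) ^ 4\<close> to \<open>6 * (x a) ^ 4\<close> completes
    the square \<open>6 * ((x a)\<^sup>2 + ?w)\<^sup>2\<close>.\<close>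
  also have "\<dots> \<le> 2 * (2 ^ card S * (3 * ?w\<^sup>2)) + 12 * (x a)\<^sup>2 * (2 ^ card S * ?w)
          + 2 ^ card S * (6 * (x a) ^ 4)"
  proof -
    have "(0::real) \<le> (x a) ^ 4" by simp
    then show ?thesis using insert.IH by (intro add_mono mult_left_mono) auto
  qed
  also have "\<dots> = 2 ^ card (insert a S) * (3 * ((x a)\<^sup>2 + ?w)\<^sup>2)"
    using insert.hyps by (simp add: power2_eq_square power4_eq_xxxx algebra_simps)
  finally show ?case using insert.hyps by simp
qed

section \<open>Half-size supports and the rows they carry\<close>

definition half_sets :: "nat \<Rightarrow> nat set set" where
  "half_sets n = {S. S \<subseteq> {..<n} \<and> card S = n div 2}"

text \<open>Rows are extensional functions, so that families of rows form a \<open>PiE\<close> and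
  sums of products over families factor.\<close>

definition sign_rows :: "nat \<Rightarrow> (nat \<Rightarrow> real) set" where
  "sign_rows n = {r \<in> {..<n} \<rightarrow>\<^sub>E {-1, 0, 1}. (\<Sum>i<n. \<bar>r i\<bar>) = real n / 2}"

definition dotp :: "nat \<Rightarrow> (nat \<Rightarrow> real) \<Rightarrow> (nat \<Rightarrow> real) \<Rightarrow> real" where
  "dotp n r x = (\<Sum>i<n. r i * x i)"

definition sign_row :: "nat \<Rightarrow> nat set \<Rightarrow> nat set \<Rightarrow> nat \<Rightarrow> real" where
  "sign_row n S T = (\<lambda>i\<in>{..<n}. if i \<in> T then -1 else if i \<in> S then 1 else 0)"

lemma finite_half_sets: "finite (half_sets n)"
  unfolding half_sets_def by (rule finite_subset[of _ "Pow {..<n}"]) auto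

lemma half_setsD: "S \<in> half_sets n \<Longrightarrow> S \<subseteq> {..<n} \<and> card S = n div 2 \<and> finite S"
  unfolding half_sets_def using finite_subset by auto

lemma card_half_sets: "card (half_sets n) = n choose (n div 2)"
  unfolding half_sets_def using n_subsets[of "{..<n}" "n div 2"] by simp

lemma dotp_sign_row:
  assumes "S \<subseteq> {..<n}" "T \<subseteq> S"
  shows "dotp n (sign_row n S T) x = signed_sum S T x"
proof -
  have "dotp n (sign_row n S T) x = (\<Sum>i<n. if i \<in> S then (if i \<in> T then - x i else x i) else 0)"
    unfolding dotp_def using assms by (intro sum.cong) (auto simp: sign_row_def)
  also have "\<dots> = (\<Sum>i\<in>{..<n} \<inter> S. if i \<in> T then - x i else x i)"
    by (simp add: sum.inter_restrict)
  also have "{..<n} \<inter> S = S" using assms by auto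
  finally show ?thesis by (simp add: signed_sum_def)
qed

lemma bij_betw_sign_row:
  assumes "even n"
  shows "bij_betw (\<lambda>(S, T). sign_row n S T) (SIGMA S:half_sets n. Pow S) (sign_rows n)"
proof (rule bij_betw_byWitness[where f' = "\<lambda>r. ({i\<in>{..<n}. r i \<noteq> 0}, {i\<in>{..<n}. r i = -1})"])
  show "\<forall>p\<in>SIGMA S:half_sets n. Pow S.
       (\<lambda>r. ({i\<in>{..<n}. r i \<noteq> 0}, {i\<in>{..<n}. r i = -1})) ((\<lambda>(S, T). sign_row n S T) p) = p"
    by (auto simp: sign_row_def half_sets_def)
  have ext: "r i = undefined" if "r \<in> sign_rows n" "\<not> i < n" for r i
    using that by (auto simp: sign_rows_def PiE_def extensional_def)
  have val: "r i = -1 \<or> r i = 0 \<or> r i = 1" if "r \<in> sign_rows n" "i < n" for r i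
    using that by (fastforce simp: sign_rows_def PiE_def Pi_def)
  show "\<forall>r\<in>sign_rows n. (\<lambda>(S, T). sign_row n S T) ({i\<in>{..<n}. r i \<noteq> 0}, {i\<in>{..<n}. r i = -1}) = r"
    using ext val by (fastforce simp: sign_row_def fun_eq_iff)
  show "(\<lambda>(S, T). sign_row n S T) ` (SIGMA S:half_sets n. Pow S) \<subseteq> sign_rows n"
  proof clarify
    fix S T assume S: "S \<in> half_sets n" and T: "T \<subseteq> S"
    have "(\<Sum>i<n. \<bar>sign_row n S T i\<bar>) = (\<Sum>i<n. if i \<in> S then 1 else 0)"
      using T by (intro sum.cong) (auto simp: sign_row_def)
    also have "\<dots> = real (card ({..<n} \<inter> S))" by (simp add: sum.inter_restrict[symmetric])
    also have "{..<n} \<inter> S = S" using half_setsD[OF S] by auto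
    also have "real (card S) = real n / 2" using half_setsD[OF S] assms by auto
    finally show "sign_row n S T \<in> sign_rows n"
      by (auto simp: sign_rows_def sign_row_def)
  qed
  show "(\<lambda>r. ({i\<in>{..<n}. r i \<noteq> 0}, {i\<in>{..<n}. r i = -1})) ` sign_rows n \<subseteq> (SIGMA S:half_sets n. Pow S)"
  proof (rule image_subsetI)
    fix r assume r: "r \<in> sign_rows n"
    have "real (card {i\<in>{..<n}. r i \<noteq> 0}) = (\<Sum>i\<in>{i\<in>{..<n}. r i \<noteq> 0}. 1)" by simp
    also have "\<dots> = (\<Sum>i<n. if r i \<noteq> 0 then 1 else 0)" by (rule sum.inter_filter) simp
    also have "\<dots> = (\<Sum>i<n. \<bar>r i\<bar>)" using val[OF r] by (intro sum.cong) fastforce+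
    also have "\<dots> = real n / 2" using r by (simp add: sign_rows_def)
    finally have "card {i\<in>{..<n}. r i \<noteq> 0} = n div 2" using assms by auto
    then show "({i\<in>{..<n}. r i \<noteq> 0}, {i\<in>{..<n}. r i = -1}) \<in> (SIGMA S:half_sets n. Pow S)"
      by (auto simp: half_sets_def)
  qed
qed

lemma sum_sign_rows:
  assumes "even n"
  shows "(\<Sum>r\<in>sign_rows n. f (dotp n r x)) =
         (\<Sum>S\<in>half_sets n. \<Sum>T\<in>Pow S. f (signed_sum S T x) :: real)"
proof -
  have "(\<Sum>r\<in>sign_rows n. f (dotp n r x)) =
        (\<Sum>p\<in>(SIGMA S:half_sets n. Pow S). f (dotp n ((\<lambda>(S, T). sign_row n S T) p) x))"
    by (rule sum.reindex_bij_betw[OF bij_betw_sign_row[OF assms], symmetric])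
  also have "\<dots> = (\<Sum>(S, T)\<in>(SIGMA S:half_sets n. Pow S). f (signed_sum S T x))"
    by (intro sum.cong) (auto simp: dotp_sign_row half_sets_def subset_iff)
  also have "\<dots> = (\<Sum>S\<in>half_sets n. \<Sum>T\<in>Pow S. f (signed_sum S T x))"
    by (rule sum.Sigma[symmetric]) (auto simp: finite_half_sets dest: half_setsD)
  finally show ?thesis .
qed

lemma card_sign_rows:
  assumes "even n"
  shows "real (card (sign_rows n)) = 2 ^ (n div 2) * real (n choose (n div 2))"
proof -
  have "real (card (sign_rows n)) = (\<Sum>r\<in>sign_rows n. 1)" by simp
  also have "\<dots> = (\<Sum>S\<in>half_sets n. \<Sum>T\<in>Pow S. 1)" by (rule sum_sign_rows[OF assms])
  also have "\<dots> = (\<Sum>S\<in>half_sets n. 2 ^ (n div 2))"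
    by (intro sum.cong) (auto simp: card_Pow dest: half_setsD)
  also have "\<dots> = 2 ^ (n div 2) * real (n choose (n div 2))" by (simp add: card_half_sets)
  finally show ?thesis .
qed

lemma card_sign_rows_pos: "even n \<Longrightarrow> 0 < real (card (sign_rows n))"
  by (simp add: card_sign_rows)

lemma finite_sign_rows: "finite (sign_rows n)"
  unfolding sign_rows_def by (rule finite_subset[of _ "{..<n} \<rightarrow>\<^sub>E {-1, 0, 1}"]) (auto intro!: finite_PiE)

lemma sign_rows_sq_le:
  assumes "r \<in> sign_rows n" "k < n"
  shows "(r k)\<^sup>2 \<le> 1"
proof -
  have "r k = -1 \<or> r k = 0 \<or> r k = 1" using assms by (fastforce simp: sign_rows_def PiE_def Pi_def)
  then show ?thesis by auto
qed

section \<open>Averages over a random row and its characteristic function\<close>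

definition row_avg :: "nat \<Rightarrow> (real \<Rightarrow> real) \<Rightarrow> (nat \<Rightarrow> real) \<Rightarrow> real" where
  "row_avg n f x = (\<Sum>r\<in>sign_rows n. f (dotp n r x)) / real (card (sign_rows n))"

text \<open>Majorant of the characteristic function of \<open>dotp n r x\<close> at frequency 1;
  other frequencies enter by scaling \<open>x\<close>. The absolute values are inside the product,
  so that only the distances of the \<open>x i\<close> to the multiples of \<open>pi\<close>
  matter.\<close>

definition charfn_bd :: "nat \<Rightarrow> (nat \<Rightarrow> real) \<Rightarrow> real" where
  "charfn_bd n x = (\<Sum>S\<in>half_sets n. \<Prod>i\<in>S. \<bar>cos (x i)\<bar>) / real (n choose (n div 2))"

lemma dotp_scale: "dotp n r (\<lambda>i. u * x i) = u * dotp n r x"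
  by (simp add: dotp_def sum_distrib_left algebra_simps)

lemma row_avg_cos_le:
  assumes "even n"
  shows "\<bar>row_avg n (\<lambda>y. cos (y - b)) x\<bar> \<le> charfn_bd n x"
proof -
  have "(\<Sum>r\<in>sign_rows n. cos (dotp n r x - b)) =
        (\<Sum>S\<in>half_sets n. 2 ^ (n div 2) * cos b * (\<Prod>i\<in>S. cos (x i)))"
    by (subst sum_sign_rows[OF assms, where f = "\<lambda>y. cos (y - b)"], intro sum.cong)
       (auto simp: sum_cos_signed_sum dest: half_setsD)
  then have "row_avg n (\<lambda>y. cos (y - b)) x =
      2 ^ (n div 2) * cos b * (\<Sum>S\<in>half_sets n. \<Prod>i\<in>S. cos (x i)) / (2 ^ (n div 2) * real (n choose (n div 2)))"
    by (simp add: row_avg_def card_sign_rows[OF assms] sum_distrib_left)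
  also have "\<dots> = cos b * (\<Sum>S\<in>half_sets n. \<Prod>i\<in>S. cos (x i)) / real (n choose (n div 2))" by simp
  finally have "\<bar>row_avg n (\<lambda>y. cos (y - b)) x\<bar> =
      \<bar>cos b\<bar> * \<bar>\<Sum>S\<in>half_sets n. \<Prod>i\<in>S. cos (x i)\<bar> / real (n choose (n div 2))"
    by (simp add: abs_mult)
  also have "\<dots> \<le> 1 * (\<Sum>S\<in>half_sets n. \<Prod>i\<in>S. \<bar>cos (x i)\<bar>) / real (n choose (n div 2))"
    by (intro divide_right_mono mult_mono)
       (auto intro!: sum_abs[THEN order_trans] sum_mono simp: abs_prod)
  finally show ?thesis by (simp add: charfn_bd_def)
qed

text \<open>Dropping the size constraint on \<open>S\<close> makes the sum over sets factor into
  coordinates. The price is the ratio of \<open>2 ^ n\<close> to the central binomial coefficient,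
  at most \<open>n\<close>.\<close>

lemma half_sets_avg_le:
  assumes "even n" "n > 0" and "\<And>i. i < n \<Longrightarrow> 0 \<le> a i"
  shows "(\<Sum>S\<in>half_sets n. \<Prod>i\<in>S. a i) / real (n choose (n div 2)) \<le> real n * (\<Prod>i<n. (1 + a i) / 2)"
proof -
  obtain m where m: "n = 2 * m" using assms(1) by auto
  have c: "2 ^ n / real n \<le> real (n choose (n div 2))"
    using central_binomial_lower_bound[of m] assms(2) by (simp add: m power_mult)
  have "(\<Sum>S\<in>half_sets n. \<Prod>i\<in>S. a i) \<le> (\<Sum>S\<in>Pow {..<n}. \<Prod>i\<in>S. a i)"
    using assms(3) by (intro sum_mono2 prod_nonneg) (auto simp: half_sets_def subset_iff)
  also have "\<dots> = (\<Prod>i<n. 1 + a i)"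
    by (subst add.commute, subst prod_add) auto
  also have "\<dots> = 2 ^ n * (\<Prod>i<n. (1 + a i) / 2)" by (simp add: prod_dividef)
  finally have *: "(\<Sum>S\<in>half_sets n. \<Prod>i\<in>S. a i) \<le> 2 ^ n * (\<Prod>i<n. (1 + a i) / 2)" .
  have pos: "0 \<le> (\<Prod>i<n. (1 + a i) / 2)" using assms(3) by (intro prod_nonneg) (auto intro: add_nonneg_nonneg)
  have "2 ^ n * (\<Prod>i<n. (1 + a i) / 2) \<le> real n * (\<Prod>i<n. (1 + a i) / 2) * real (n choose (n div 2))"
    using mult_right_mono[OF c pos] assms(2) by (simp add: field_simps)
  with * have "(\<Sum>S\<in>half_sets n. \<Prod>i\<in>S. a i) \<le> real n * (\<Prod>i<n. (1 + a i) / 2) * real (n choose (n div 2))"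
    by linarith
  then show ?thesis by (simp add: pos_divide_le_eq)
qed

section \<open>The characteristic function of a row\<close>

text \<open>Distance to the lattice of multiples of \<open>pi\<close>, the periods of the absolute
  value of \<open>cos\<close>.\<close>

definition pidist :: "real \<Rightarrow> real" where
  "pidist \<theta> = \<bar>\<theta> - pi * of_int (round (\<theta> / pi))\<bar>"

lemma pidist_nonneg: "0 \<le> pidist \<theta>"
  by (simp add: pidist_def)

lemma pidist_eq: "pidist \<theta> = pi * \<bar>\<theta> / pi - of_int (round (\<theta> / pi))\<bar>"
proof -
  have "pi * \<bar>\<theta> / pi - of_int (round (\<theta> / pi))\<bar> = \<bar>pi * (\<theta> / pi - of_int (round (\<theta> / pi)))\<bar>"
    by (simp add: abs_mult)
  also have "pi * (\<theta> / pi - of_int (round (\<theta> / pi))) = \<theta> - pi * of_int (round (\<theta> / pi))"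
    by (simp add: right_diff_distrib)
  finally show ?thesis by (simp add: pidist_def)
qed

lemma pidist_le_half_pi: "pidist \<theta> \<le> pi / 2"
proof -
  have "\<bar>\<theta> / pi - of_int (round (\<theta> / pi))\<bar> \<le> 1 / 2"
    using of_int_round_abs_le[of "\<theta> / pi"] by (simp add: abs_minus_commute)
  from mult_left_mono[OF this, of pi] show ?thesis unfolding pidist_eq by simp
qed

lemma pidist_le: "pidist \<theta> \<le> \<bar>\<theta> - pi * of_int k\<bar>"
proof -
  have "\<bar>\<theta> / pi - of_int (round (\<theta> / pi))\<bar> \<le> \<bar>\<theta> / pi - of_int k\<bar>"
    by (rule round_diff_minimal)
  from mult_left_mono[OF this, of pi] have "pidist \<theta> \<le> pi * \<bar>\<theta> / pi - of_int k\<bar>"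
    unfolding pidist_eq by simp
  also have "\<dots> = \<bar>pi * (\<theta> / pi - of_int k)\<bar>" by (simp add: abs_mult)
  also have "pi * (\<theta> / pi - of_int k) = \<theta> - pi * of_int k" by (simp add: right_diff_distrib)
  finally show ?thesis .
qed

lemma pidist_lipschitz: "pidist a \<le> pidist b + \<bar>a - b\<bar>"
proof -
  have "pidist a \<le> \<bar>a - pi * of_int (round (b / pi))\<bar>" by (rule pidist_le)
  also have "\<dots> \<le> pidist b + \<bar>a - b\<bar>" unfolding pidist_def by linarith
  finally show ?thesis .
qed

lemma pidist_sq_le: "(pidist a)\<^sup>2 \<le> 2 * (pidist b)\<^sup>2 + 2 * (a - b)\<^sup>2"
proof -
  have "(pidist a)\<^sup>2 \<le> (pidist b + \<bar>a - b\<bar>)\<^sup>2"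
    using pidist_lipschitz pidist_nonneg by (intro power_mono)
  also have "\<dots> \<le> 2 * (pidist b)\<^sup>2 + 2 * \<bar>a - b\<bar>\<^sup>2"
    using zero_le_power2[of "pidist b - \<bar>a - b\<bar>"] by (simp add: power2_sum power2_diff)
  finally show ?thesis by simp
qed

lemma pidist_small: "\<bar>\<theta>\<bar> \<le> 1 \<Longrightarrow> pidist \<theta> = \<bar>\<theta>\<bar>"
proof -
  assume a: "\<bar>\<theta>\<bar> \<le> 1"
  have "\<bar>\<theta> / pi\<bar> < 1 / 2" using a pi_gt3 by (simp add: abs_divide field_simps)
  then have "round (\<theta> / pi) = 0" by (intro round_unique') auto
  then show ?thesis by (simp add: pidist_def)
qed

lemma abs_cos_pidist: "\<bar>cos \<theta>\<bar> = cos (pidist \<theta>)"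
proof -
  let ?k = "round (\<theta> / pi)"
  have "sin (pi * of_int ?k) = 0" "\<bar>cos (pi * of_int ?k)\<bar> = 1"
    using sin_npi_int[of ?k] cos_npi_int[of ?k] by (auto simp: mult.commute)
  then have "\<bar>cos (\<theta> - pi * of_int ?k)\<bar> = \<bar>cos \<theta>\<bar>"
    by (simp add: cos_diff abs_mult)
  moreover have "cos (pidist \<theta>) = cos (\<theta> - pi * of_int ?k)"
    by (simp add: pidist_def)
  moreover have "0 \<le> cos (pidist \<theta>)"
    using pidist_le_half_pi[of \<theta>] pidist_nonneg[of \<theta>] by (intro cos_ge_zero) auto
  ultimately show ?thesis by simp
qed

text \<open>\<open>pi / 3\<close> is where the derivative \<open>cos x - 1 / 2\<close> of the
  difference first vanishes.\<close>

lemma sin_ge_half: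
  assumes "0 \<le> y" "y \<le> pi / 3"
  shows "y / 2 \<le> sin (y::real)"
proof -
  have "(\<lambda>y. sin y - y / 2) 0 \<le> (\<lambda>y. sin y - y / 2) y"
  proof (rule DERIV_nonneg_imp_nondecreasing[OF assms(1)])
    fix x assume x: "0 \<le> x" "x \<le> y"
    have "1 / 2 \<le> cos x"
      using cos_monotone_0_pi_le[of x "pi / 3"] x assms by (simp add: cos_60)
    moreover have "((\<lambda>y. sin y - y / 2) has_real_derivative (cos x - 1 / 2)) (at x)"
      by (auto intro!: derivative_eq_intros)
    ultimately show "\<exists>z. ((\<lambda>y. sin y - y / 2) has_real_derivative z) (at x) \<and> 0 \<le> z" by force
  qed
  then show ?thesis by simp
qed

text \<open>Half-angle formula: \<open>pidist \<theta> / 2\<close> is at most \<open>pi / 4\<close>,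
  inside the range of \<open>sin_ge_half\<close>.\<close>

lemma abs_cos_le: "\<bar>cos \<theta>\<bar> \<le> 1 - (pidist \<theta>)\<^sup>2 / 8"
proof -
  let ?y = "pidist \<theta> / 2"
  have "?y / 2 \<le> sin ?y"
    using pidist_le_half_pi[of \<theta>] pidist_nonneg[of \<theta>] by (intro sin_ge_half) auto
  then have "(?y / 2)\<^sup>2 \<le> (sin ?y)\<^sup>2" using pidist_nonneg[of \<theta>] by (intro power_mono) auto
  moreover have "cos (2 * ?y) = 1 - 2 * (sin ?y)\<^sup>2" by (rule cos_double_sin)
  ultimately show ?thesis by (simp add: abs_cos_pidist power_divide)
qed

lemma abs_cos_le_exp: "\<bar>cos \<theta>\<bar> \<le> exp (- (pidist \<theta>)\<^sup>2 / 8)"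
  using abs_cos_le[of \<theta>] exp_ge_add_one_self[of "- (pidist \<theta>)\<^sup>2 / 8"] by simp

lemma charfn_bd_dist:
  assumes "even n" "n > 0"
  shows "charfn_bd n y \<le> real n * exp (- (\<Sum>i<n. (pidist (y i))\<^sup>2) / 16)"
proof -
  have "charfn_bd n y \<le> real n * (\<Prod>i<n. (1 + \<bar>cos (y i)\<bar>) / 2)"
    unfolding charfn_bd_def by (rule half_sets_avg_le[OF assms]) simp
  also have "(\<Prod>i<n. (1 + \<bar>cos (y i)\<bar>) / 2) \<le> (\<Prod>i<n. exp (- (pidist (y i))\<^sup>2 / 16))"
  proof (rule prod_mono, rule conjI)
    fix i
    show "(1 + \<bar>cos (y i)\<bar>) / 2 \<le> exp (- (pidist (y i))\<^sup>2 / 16)"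
      using abs_cos_le[of "y i"] exp_ge_add_one_self[of "- (pidist (y i))\<^sup>2 / 16"] by simp
  qed auto
  also have "\<dots> = exp (- (\<Sum>i<n. (pidist (y i))\<^sup>2) / 16)"
    by (simp add: exp_sum[symmetric] sum_negf sum_divide_distrib)
  finally show ?thesis by (simp add: mult_left_mono)
qed

lemma charfn_bd_le_1: "charfn_bd n y \<le> 1"
proof -
  have "(\<Sum>S\<in>half_sets n. \<Prod>i\<in>S. \<bar>cos (y i)\<bar>) \<le> (\<Sum>S\<in>half_sets n. 1)"
    by (intro sum_mono prod_le_1) auto
  then show ?thesis by (simp add: charfn_bd_def card_half_sets)
qed

text \<open>The Gaussian term carries no factor \<open>n\<close>, unlike in
  \<open>charfn_bd_dist\<close>; otherwise smoothing at scale \<open>s\<close> would only give order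
  \<open>n * s\<close>. Sets \<open>S\<close> that contain at least a quarter of
  \<open>\<sigma>\<close> yield the Gaussian decay directly. The others are rare: for them
  \<open>2 powr (card \<sigma> / 4)\<close> times a factor \<open>1 / 2\<close> per element of
  \<open>S \<inter> \<sigma>\<close> is at least 1, and averaging this weight with
  \<open>half_sets_avg_le\<close> costs the factor \<open>n\<close> only on an exponentially small
  term.\<close>

lemma charfn_bd_small:
  assumes n: "even n" "n > 0" and \<sigma>: "\<sigma> \<subseteq> {..<n}" and a: "0 \<le> a"
    and y: "\<And>i. i \<in> \<sigma> \<Longrightarrow> a \<le> \<bar>y i\<bar> \<and> \<bar>y i\<bar> \<le> 1"
  shows "charfn_bd n y \<le> exp (- (a\<^sup>2 * real (card \<sigma>)) / 32) + real n * (2 / 3) powr (real (card \<sigma>) / 4)"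
proof -
  let ?q = "2 powr (real (card \<sigma>) / 4)"
  let ?e = "exp (- (a\<^sup>2 * real (card \<sigma>)) / 32)"
  let ?h = "\<lambda>i. if i \<in> \<sigma> then 1 / 2 else (1::real)"
  have fin: "finite \<sigma>" using \<sigma> finite_subset by blast
  have *: "(\<Prod>i\<in>S. \<bar>cos (y i)\<bar>) \<le> ?e + ?q * (\<Prod>i\<in>S. ?h i)" if S: "S \<in> half_sets n" for S
  proof (cases "real (card \<sigma>) / 4 \<le> real (card (S \<inter> \<sigma>))")
    case True
    have fS: "finite S" using half_setsD[OF S] by auto
    have "(\<Prod>i\<in>S. \<bar>cos (y i)\<bar>) \<le> (\<Prod>i\<in>S. if i \<in> \<sigma> then exp (- a\<^sup>2 / 8) else 1)"
    proof (rule prod_mono, rule conjI)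
      fix i assume "i \<in> S"
      have "\<bar>cos (y i)\<bar> \<le> exp (- a\<^sup>2 / 8)" if "i \<in> \<sigma>"
      proof -
        have "a \<le> pidist (y i)" using y[OF that] by (simp add: pidist_small)
        then have "a\<^sup>2 \<le> (pidist (y i))\<^sup>2" using a by (intro power_mono)
        then show ?thesis by (intro order_trans[OF abs_cos_le_exp]) auto
      qed
      then show "\<bar>cos (y i)\<bar> \<le> (if i \<in> \<sigma> then exp (- a\<^sup>2 / 8) else 1)" by simp
    qed simp
    also have "\<dots> = exp (- a\<^sup>2 / 8) ^ card (S \<inter> \<sigma>)"
      by (simp add: prod.inter_restrict[OF fS, symmetric])
    also have "\<dots> = exp (- (a\<^sup>2 * real (card (S \<inter> \<sigma>))) / 8)"
      by (simp add: exp_of_nat_mult[symmetric] mult.commute)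
    also have "\<dots> \<le> ?e"
    proof -
      have "a\<^sup>2 * (real (card \<sigma>) / 4) \<le> a\<^sup>2 * real (card (S \<inter> \<sigma>))"
        using True by (intro mult_left_mono) auto
      then show ?thesis by (simp add: mult.commute)
    qed
    also have "\<dots> \<le> ?e + ?q * (\<Prod>i\<in>S. ?h i)"
      using mult_nonneg_nonneg[OF _ prod_nonneg, of ?q S ?h] by simp
    finally show ?thesis .
  next
    case False
    have fS: "finite S" using half_setsD[OF S] by auto
    have "(\<Prod>i\<in>S. \<bar>cos (y i)\<bar>) \<le> 1" by (intro prod_le_1) auto
    also have "1 = 2 powr (real (card (S \<inter> \<sigma>))) * (1 / 2) ^ card (S \<inter> \<sigma>)"
      by (simp add: powr_realpow power_divide)
    also have "\<dots> \<le> ?q * (1 / 2) ^ card (S \<inter> \<sigma>)"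
      using False by (intro mult_right_mono powr_mono) auto
    also have "(1 / 2) ^ card (S \<inter> \<sigma>) = (\<Prod>i\<in>S. ?h i)"
      by (simp add: prod.inter_restrict[OF fS, symmetric])
    finally show ?thesis using exp_ge_zero[of "- (a\<^sup>2 * real (card \<sigma>)) / 32"] by linarith
  qed
  have "charfn_bd n y \<le> (\<Sum>S\<in>half_sets n. ?e + ?q * (\<Prod>i\<in>S. ?h i)) / real (n choose (n div 2))"
    unfolding charfn_bd_def using * by (intro divide_right_mono sum_mono) auto
  also have "\<dots> = ?e + ?q * ((\<Sum>S\<in>half_sets n. \<Prod>i\<in>S. ?h i) / real (n choose (n div 2)))"
    by (simp add: sum.distrib card_half_sets sum_distrib_left[symmetric] add_divide_distrib)
  also have "\<dots> \<le> ?e + ?q * (real n * (\<Prod>i<n. (1 + ?h i) / 2))"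
    by (intro add_left_mono mult_left_mono half_sets_avg_le[OF n]) auto
  also have "(\<Prod>i<n. (1 + ?h i) / 2) = (\<Prod>i<n. if i \<in> \<sigma> then 3 / 4 else 1)"
    by (intro prod.cong) auto
  also have "\<dots> = (3 / 4) ^ card ({..<n} \<inter> \<sigma>)"
    by (simp add: prod.inter_restrict[symmetric])
  also have "{..<n} \<inter> \<sigma> = \<sigma>" using \<sigma> by auto
  \<comment> \<open>As a power with exponent \<open>card \<sigma> / 4\<close> this combines with
    \<open>?q\<close> to base \<open>2 * 81 / 256 = 81 / 128\<close>, which is below
    \<open>2 / 3\<close>.\<close>
  also have "(3 / 4 :: real) ^ card \<sigma> = (81 / 256) powr (real (card \<sigma>) / 4)"
  proof -
    have "(81 / 256 :: real) = (3 / 4) powr 4" by (simp add: power_divide)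
    then have "(81 / 256 :: real) powr (real (card \<sigma>) / 4) = (3 / 4) powr (4 * (real (card \<sigma>) / 4))"
      by (simp only: powr_powr)
    then show ?thesis by (simp add: powr_realpow)
  qed
  also have "?q * (real n * (81 / 256) powr (real (card \<sigma>) / 4)) =
      real n * (81 / 128) powr (real (card \<sigma>) / 4)"
    using powr_mult[of 2 "81/256" "real (card \<sigma>) / 4"] by simp
  also have "\<dots> \<le> real n * (2 / 3) powr (real (card \<sigma>) / 4)"
    by (intro mult_left_mono powr_mono2) auto
  finally show ?thesis by simp
qed

section \<open>Gaussian smoothing\<close>

lemma
  fixes a :: real
  assumes a: "- 1 / 2 < a"
  shows integrable_std_normal_exp: "integrable std_normal_distribution (\<lambda>t. exp (- (a * t\<^sup>2)))" (is ?A)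
    and integral_std_normal_exp:
      "(\<integral>t. exp (- (a * t\<^sup>2)) \<partial>std_normal_distribution) = 1 / sqrt (1 + 2 * a)" (is ?B)
proof -
  \<comment> \<open>The standard normal density times the exponential is \<open>s\<close> times the
    centred normal density of standard deviation \<open>s\<close>. Negative \<open>a\<close> is
    wanted too: the growing weight with \<open>a = - 1 / 4\<close> bounds the large frequencies
    below.\<close>
  define s where "s = 1 / sqrt (1 + 2 * a)"
  have s: "s > 0" "s\<^sup>2 = 1 / (1 + 2 * a)" using a by (auto simp: s_def power_divide)
  have eq: "std_normal_density t * exp (- (a * t\<^sup>2)) = s * normal_density 0 s t" for t
  proof -
    have "- t\<^sup>2 / 2 - a * t\<^sup>2 = - t\<^sup>2 / (2 * s\<^sup>2)" using a by (simp add: s(2) field_simps)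
    moreover have "sqrt (2 * pi * s\<^sup>2) = sqrt (2 * pi) * s" using s(1) by (simp add: real_sqrt_mult)
    ultimately show ?thesis
      using s(1) by (simp add: normal_density_def exp_diff[symmetric] exp_add[symmetric])
  qed
  have "integrable lborel (\<lambda>t. std_normal_density t * exp (- (a * t\<^sup>2)))"
    unfolding eq using s(1) by (intro integrable_mult_right integrable_normal_density)
  then show ?A
    by (subst integrable_density) auto
  have "(\<integral>t. exp (- (a * t\<^sup>2)) \<partial>std_normal_distribution) =
        (\<integral>t. std_normal_density t * exp (- (a * t\<^sup>2)) \<partial>lborel)"
    by (subst integral_density) auto
  also have "\<dots> = s" unfolding eq using s(1) by simp
  finally show ?B by (simp add: s_def)
qed

lemma exp_eq_integral_cos:
  "exp (- (w\<^sup>2) / 2) = (\<integral>t. cos (w * t) \<partial>std_normal_distribution)"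
proof -
  interpret real_distribution std_normal_distribution by (rule real_dist_normal_dist)
  have "complex_of_real (exp (- (w\<^sup>2) / 2)) = (\<integral>t. iexp (w * t) \<partial>std_normal_distribution)"
    using fun_cong[OF char_std_normal_distribution, of w] by (simp add: char_def)
  then have "Re (complex_of_real (exp (- (w\<^sup>2) / 2))) = Re (\<integral>t. iexp (w * t) \<partial>std_normal_distribution)"
    by simp
  also have "\<dots> = (\<integral>t. Re (iexp (w * t)) \<partial>std_normal_distribution)"
    by (intro integral_Re[symmetric] integrable_iexp) auto
  finally show ?thesis by (simp add: Re_exp)
qed

text \<open>The Gaussian weight is itself a standard normal average of
  \<open>cos (t * (y - b) / s)\<close>, so exchanging two averages replaces Fourier inversion. The
  shift \<open>b\<close> only changes phases, hence the bound is uniform in it.\<close>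

lemma row_avg_exp_le:
  assumes n: "even n" and s: "s > 0" and G: "integrable std_normal_distribution G"
    and le: "\<And>t. charfn_bd n (\<lambda>i. t / s * x i) \<le> G t"
  shows "row_avg n (\<lambda>y. exp (- ((y - b)\<^sup>2 / (2 * s\<^sup>2)))) x \<le> (\<integral>t. G t \<partial>std_normal_distribution)"
proof -
  interpret real_distribution std_normal_distribution by (rule real_dist_normal_dist)
  have int: "integrable std_normal_distribution (\<lambda>t. cos (w * t))" for w :: real
    by (rule integrable_const_bound[of _ 1]) auto
  have "row_avg n (\<lambda>y. exp (- ((y - b)\<^sup>2 / (2 * s\<^sup>2)))) x =
     (\<Sum>r\<in>sign_rows n. \<integral>t. cos (((dotp n r x - b) / s) * t) \<partial>std_normal_distribution) / real (card (sign_rows n))"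
    unfolding row_avg_def exp_eq_integral_cos[symmetric] by (simp add: power_divide mult.commute)
  also have "\<dots> = (\<integral>t. (\<Sum>r\<in>sign_rows n. cos (((dotp n r x - b) / s) * t)) / real (card (sign_rows n)) \<partial>std_normal_distribution)"
    unfolding integral_divide_zero by (subst Bochner_Integration.integral_sum) (auto simp only: int)
  also have "\<dots> \<le> (\<integral>t. G t \<partial>std_normal_distribution)"
  proof (rule integral_mono[OF _ G])
    show "integrable std_normal_distribution
      (\<lambda>t. (\<Sum>r\<in>sign_rows n. cos (((dotp n r x - b) / s) * t)) / real (card (sign_rows n)))"
      by (intro integrable_divide_zero Bochner_Integration.integrable_sum int)
    fix t
    have "(\<Sum>r\<in>sign_rows n. cos (((dotp n r x - b) / s) * t)) / real (card (sign_rows n)) =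
        row_avg n (\<lambda>y. cos (y - t / s * b)) (\<lambda>i. t / s * x i)"
      unfolding row_avg_def dotp_scale
      by (intro arg_cong2[where f = "(/)"] sum.cong refl arg_cong[where f = cos])
         (simp add: field_simps diff_divide_distrib)
    also have "\<dots> \<le> charfn_bd n (\<lambda>i. t / s * x i)"
      using row_avg_cos_le[OF n] abs_le_D1 by blast
    also have "\<dots> \<le> G t" by (rule le)
    finally show "(\<Sum>r\<in>sign_rows n. cos (((dotp n r x - b) / s) * t)) / real (card (sign_rows n)) \<le> G t" .
  qed
  finally show ?thesis .
qed

lemma charfn_bd_abs: "charfn_bd n (\<lambda>i. \<bar>u\<bar> * x i) = charfn_bd n (\<lambda>i. u * x i)"
  by (cases "u \<ge> 0") (auto simp: charfn_bd_def)

lemma row_avg_gauss_le: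
  assumes n: "even n" "n > 0" and \<sigma>: "\<sigma> \<subseteq> {..<n}" "\<eta> * real n \<le> real (card \<sigma>)"
    and x: "\<And>i. i \<in> \<sigma> \<Longrightarrow> \<rho> / sqrt n \<le> \<bar>x i\<bar> \<and> \<bar>x i\<bar> \<le> K / sqrt n"
    and pos: "\<eta> > 0" "\<rho> > 0" "K > 0" "s > 0" "D > 0"
    and good: "\<And>u. sqrt n / K \<le> u \<Longrightarrow> u < D \<Longrightarrow> \<kappa>\<^sup>2 * n \<le> (\<Sum>i<n. (pidist (u * x i))\<^sup>2)"
  shows "row_avg n (\<lambda>y. exp (- ((y - b)\<^sup>2 / (2 * s\<^sup>2)))) x
     \<le> s / sqrt (\<rho>\<^sup>2 * \<eta> / 16) + real n * (2 / 3) powr (\<eta> * n / 4)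
         + real n * exp (- (\<kappa>\<^sup>2 * n / 16)) + 2 * exp (- ((D * s)\<^sup>2 / 4))"
proof -
  define \<beta> where "\<beta> = \<rho>\<^sup>2 * \<eta> / 32"
  have \<beta>: "\<beta> > 0" using pos by (simp add: \<beta>_def)
  define a where "a = \<beta> / s\<^sup>2"
  have a: "a > 0" using \<beta> pos by (simp add: a_def)
  let ?E1 = "real n * (2 / 3) powr (\<eta> * n / 4)"
  let ?E2 = "real n * exp (- (\<kappa>\<^sup>2 * n / 16))"
  let ?E3 = "exp (- ((D * s)\<^sup>2 / 4))"
  \<comment> \<open>One majorant for three ranges of the frequency
    \<open>u = \<bar>t / s\<bar>\<close>: below \<open>sqrt n / K\<close> the spread coordinates
    give Gaussian decay, up to \<open>D\<close> the distance to the lattice does, and beyond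
    \<open>D\<close> the trivial bound 1 is at most the last summand because
    \<open>(D * s)\<^sup>2 \<le> t\<^sup>2\<close>. Adding the three bounds instead of splitting the
    integral makes every integral explicit.\<close>
  define G where "G t = exp (- (a * t\<^sup>2)) + (?E1 + ?E2) + ?E3 * exp (- ((- 1 / 4) * t\<^sup>2))" for t
  interpret real_distribution std_normal_distribution by (rule real_dist_normal_dist)
  have i1: "integrable std_normal_distribution (\<lambda>t. exp (- (a * t\<^sup>2)))"
    using a by (intro integrable_std_normal_exp) auto
  have i2: "integrable std_normal_distribution (\<lambda>t. exp (- ((- 1 / 4) * t\<^sup>2)))"
    by (intro integrable_std_normal_exp) auto
  have iG: "integrable std_normal_distribution G"
    unfolding G_def using i1 i2 by (intro Bochner_Integration.integrable_add integrable_mult_right) auto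
  have bd: "charfn_bd n (\<lambda>i. t / s * x i) \<le> G t" for t
  proof -
    define u where "u = \<bar>t / s\<bar>"
    have u0: "u \<ge> 0" by (simp add: u_def)
    have us: "u\<^sup>2 * s\<^sup>2 = t\<^sup>2" using pos by (simp add: u_def power_divide)
    have nn: "0 \<le> exp (- (a * t\<^sup>2))" "0 \<le> ?E1" "0 \<le> ?E2" "0 \<le> ?E3 * exp (- ((- 1 / 4) * t\<^sup>2))"
      by auto
    have sn: "sqrt n > 0" using n by simp
    have "charfn_bd n (\<lambda>i. u * x i) \<le> G t"
    proof -
      consider "u \<le> sqrt n / K" | "sqrt n / K \<le> u" "u < D" | "D \<le> u" by linarith
      then show ?thesis
      proof cases
        case 1
        have "charfn_bd n (\<lambda>i. u * x i) \<le>
          exp (- ((u * (\<rho> / sqrt n))\<^sup>2 * real (card \<sigma>)) / 32) + real n * (2 / 3) powr (real (card \<sigma>) / 4)"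
        proof (rule charfn_bd_small[OF n \<sigma>(1)])
          show "0 \<le> u * (\<rho> / sqrt n)" using u0 pos by simp
          fix i assume i: "i \<in> \<sigma>"
          have "u * \<bar>x i\<bar> \<le> sqrt n / K * (K / sqrt n)"
            using 1 x[OF i] u0 pos by (intro mult_mono) auto
          also have "\<dots> = 1" using sn pos by simp
          finally show "u * (\<rho> / sqrt n) \<le> \<bar>u * x i\<bar> \<and> \<bar>u * x i\<bar> \<le> 1"
            using x[OF i] u0 mult_left_mono[of "\<rho> / sqrt n" "\<bar>x i\<bar>" u] by (simp add: abs_mult)
        qed
        also have "exp (- ((u * (\<rho> / sqrt n))\<^sup>2 * real (card \<sigma>)) / 32) \<le> exp (- (a * t\<^sup>2))"
        proof -
          have "(u * (\<rho> / sqrt n))\<^sup>2 * (\<eta> * real n) \<le> (u * (\<rho> / sqrt n))\<^sup>2 * real (card \<sigma>)"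
            using \<sigma>(2) by (intro mult_left_mono) auto
          moreover have "(u * (\<rho> / sqrt n))\<^sup>2 * (\<eta> * real n) = 32 * (a * t\<^sup>2)"
            using n pos unfolding a_def \<beta>_def us[symmetric] by (simp add: power_mult_distrib power_divide)
          ultimately show ?thesis by simp
        qed
        also have "real n * (2 / 3) powr (real (card \<sigma>) / 4) \<le> ?E1"
          using \<sigma>(2) by (intro mult_left_mono powr_mono') auto
        finally show ?thesis unfolding G_def using nn by linarith
      next
        case 2
        have "charfn_bd n (\<lambda>i. u * x i) \<le> real n * exp (- (\<Sum>i<n. (pidist (u * x i))\<^sup>2) / 16)"
          by (rule charfn_bd_dist[OF n])
        also have "\<dots> \<le> ?E2" using good[OF 2] by (intro mult_left_mono) auto
        finally show ?thesis unfolding G_def using nn by linarith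
      next
        case 3
        have "charfn_bd n (\<lambda>i. u * x i) \<le> 1" by (rule charfn_bd_le_1)
        also have "1 \<le> ?E3 * exp (- ((- 1 / 4) * t\<^sup>2))"
        proof -
          have "D\<^sup>2 \<le> u\<^sup>2" using 3 pos by (intro power_mono) auto
          then have "D\<^sup>2 * s\<^sup>2 \<le> t\<^sup>2" unfolding us[symmetric] by (intro mult_right_mono) auto
          then show ?thesis by (simp add: exp_add[symmetric] power_mult_distrib)
        qed
        finally show ?thesis unfolding G_def using nn by linarith
      qed
    qed
    then show ?thesis unfolding u_def charfn_bd_abs .
  qed
  have "row_avg n (\<lambda>y. exp (- ((y - b)\<^sup>2 / (2 * s\<^sup>2)))) x \<le> (\<integral>t. G t \<partial>std_normal_distribution)"
    by (rule row_avg_exp_le[OF n(1) pos(4) iG bd])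
  also have "\<dots> = 1 / sqrt (1 + 2 * a) + (?E1 + ?E2) + ?E3 * sqrt 2"
  proof -
    have "(\<integral>t. G t \<partial>std_normal_distribution) = (\<integral>t. exp (- (a * t\<^sup>2)) \<partial>std_normal_distribution)
        + (\<integral>t. ?E1 + ?E2 \<partial>std_normal_distribution) + (\<integral>t. ?E3 * exp (- ((- 1 / 4) * t\<^sup>2)) \<partial>std_normal_distribution)"
      unfolding G_def using i1 i2
      by (subst Bochner_Integration.integral_add, auto)+
    also have "(\<integral>t. ?E3 * exp (- ((- 1 / 4) * t\<^sup>2)) \<partial>std_normal_distribution) = ?E3 * (1 / sqrt (1 + 2 * (- 1 / 4)))"
      by (subst integral_mult_right_zero, subst integral_std_normal_exp) auto
    also have "1 / sqrt (1 + 2 * (- 1 / 4 :: real)) = sqrt 2" by (simp add: real_sqrt_divide)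
    also have "(\<integral>t. exp (- (a * t\<^sup>2)) \<partial>std_normal_distribution) = 1 / sqrt (1 + 2 * a)"
      using a by (intro integral_std_normal_exp) auto
    finally show ?thesis using prob_space by simp
  qed
  also have "1 / sqrt (1 + 2 * a) \<le> s / sqrt (\<rho>\<^sup>2 * \<eta> / 16)"
  proof -
    have "1 / sqrt (1 + 2 * a) \<le> 1 / sqrt (2 * a)"
      using a by (intro divide_left_mono) auto
    also have "sqrt (2 * a) = sqrt ((\<rho>\<^sup>2 * \<eta> / 16) / s\<^sup>2)" by (simp add: a_def \<beta>_def)
    also have "1 / sqrt (\<rho>\<^sup>2 * \<eta> / 16 / s\<^sup>2) = s / sqrt (\<rho>\<^sup>2 * \<eta> / 16)"
      using pos by (simp add: real_sqrt_divide real_sqrt_mult)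
    finally show ?thesis .
  qed
  also have "?E3 * sqrt 2 \<le> 2 * ?E3" using sqrt2_less_2 by simp
  finally show ?thesis by simp
qed

section \<open>Tensorization, lattice points and rounding\<close>

text \<open>Exponential Markov inequality on a product set, in counting form. It serves both for
  tensorizing small ball bounds over the rows and for counting lattice points.\<close>

lemma card_le_prod_sum:
  fixes w :: "'i \<Rightarrow> 'b \<Rightarrow> real"
  assumes "finite I" "\<And>i. i \<in> I \<Longrightarrow> finite (F i)" "Z \<subseteq> PiE I F" "0 \<le> M"
    and "\<And>i y. i \<in> I \<Longrightarrow> y \<in> F i \<Longrightarrow> 0 \<le> w i y"
    and "\<And>z. z \<in> Z \<Longrightarrow> 1 \<le> M * (\<Prod>i\<in>I. w i (z i))"
  shows "real (card Z) \<le> M * (\<Prod>i\<in>I. \<Sum>y\<in>F i. w i y)"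
proof -
  have fin: "finite (PiE I F)" using assms by (intro finite_PiE)
  have "real (card Z) = (\<Sum>z\<in>Z. 1)" by simp
  also have "\<dots> \<le> (\<Sum>z\<in>Z. M * (\<Prod>i\<in>I. w i (z i)))" using assms(6) by (intro sum_mono)
  also have "\<dots> \<le> (\<Sum>z\<in>PiE I F. M * (\<Prod>i\<in>I. w i (z i)))"
    using assms(3) by (intro sum_mono2 fin mult_nonneg_nonneg prod_nonneg assms(4,5)) auto
  also have "\<dots> = M * (\<Prod>i\<in>I. \<Sum>y\<in>F i. w i y)"
    by (simp add: sum_distrib_left[symmetric] prod_sum_PiE assms)
  finally show ?thesis .
qed

definition row_families :: "'i set \<Rightarrow> nat \<Rightarrow> ('i \<Rightarrow> nat \<Rightarrow> real) set" where
  "row_families I n = PiE I (\<lambda>_. sign_rows n)"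

lemma finite_row_families: "finite I \<Longrightarrow> finite (row_families I n)"
  unfolding row_families_def by (intro finite_PiE finite_sign_rows)

text \<open>On the event the product of the Gaussian weights of the rows is at least
  \<open>exp (- \<tau>)\<close>, while its average is a power of the average for one row.\<close>

lemma card_small_image:
  assumes "even n" "finite I" "s > 0"
  shows "real (card {q \<in> row_families I n. (\<Sum>i\<in>I. (dotp n (q i) x)\<^sup>2) \<le> 2 * \<tau> * s\<^sup>2}) \<le>
    exp \<tau> * row_avg n (\<lambda>y. exp (- (y\<^sup>2 / (2 * s\<^sup>2)))) x ^ card I * real (card (row_families I n))"
proof -
  let ?w = "\<lambda>r. exp (- ((dotp n r x)\<^sup>2 / (2 * s\<^sup>2)))"
  have "real (card {q \<in> row_families I n. (\<Sum>i\<in>I. (dotp n (q i) x)\<^sup>2) \<le> 2 * \<tau> * s\<^sup>2}) \<le>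
      exp \<tau> * (\<Prod>i\<in>I. \<Sum>r\<in>sign_rows n. ?w r)"
  proof (rule card_le_prod_sum[OF assms(2)])
    fix q assume "q \<in> {q \<in> row_families I n. (\<Sum>i\<in>I. (dotp n (q i) x)\<^sup>2) \<le> 2 * \<tau> * s\<^sup>2}"
    then have "(\<Sum>i\<in>I. (dotp n (q i) x)\<^sup>2) / (2 * s\<^sup>2) \<le> \<tau>"
      using assms(3) by (simp add: field_simps)
    then have "0 \<le> \<tau> + (\<Sum>i\<in>I. - ((dotp n (q i) x)\<^sup>2 / (2 * s\<^sup>2)))"
      by (simp add: sum_negf sum_divide_distrib)
    then have "1 \<le> exp (\<tau> + (\<Sum>i\<in>I. - ((dotp n (q i) x)\<^sup>2 / (2 * s\<^sup>2))))" by simp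
    then show "1 \<le> exp \<tau> * (\<Prod>i\<in>I. ?w (q i))"
      using assms(2) by (simp add: exp_add exp_sum)
  qed (auto simp: finite_sign_rows row_families_def)
  also have "\<dots> = exp \<tau> * row_avg n (\<lambda>y. exp (- (y\<^sup>2 / (2 * s\<^sup>2)))) x ^ card I * real (card (row_families I n))"
    using card_sign_rows_pos[OF assms(1)] assms(2)
    by (simp add: row_families_def card_PiE row_avg_def power_divide)
  finally show ?thesis .
qed

section \<open>Integer points near a given vector\<close>

lemma sum_geometric_le:
  fixes q :: real
  assumes "0 \<le> q" "q < 1"
  shows "(\<Sum>j\<le>L. q ^ j) \<le> 1 / (1 - q)"
proof -
  have "(1 - q) * (\<Sum>j\<le>L. q ^ j) \<le> 1" using assms by (simp add: sum_gp_basic)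
  then show ?thesis using assms by (simp add: field_simps)
qed

text \<open>By \<open>a * t\<^sup>2 + 1 \<ge> 2 * sqrt a * t\<close> the Gaussian is dominated by a
  geometric sequence on each side of \<open>b\<close>; the 6 is two sides times the bound 3 for
  \<open>exp 1\<close>. The bound is uniform in \<open>b\<close> and in the window
  \<open>L\<close>.\<close>

lemma sum_int_exp_sq_le:
  fixes a b :: real and L :: nat
  assumes a: "a > 0"
  shows "(\<Sum>z\<in>{\<lfloor>b\<rfloor> - int L..\<lfloor>b\<rfloor> + int L}. exp (- (a * (of_int z - b)\<^sup>2))) \<le> 6 * (1 + 1 / sqrt a)"
proof -
  define y where "y = 2 * sqrt a"
  define q where "q = exp (- y)"
  have y: "y > 0" using a by (simp add: y_def)
  have q: "0 \<le> q" "q < 1" using y by (auto simp: q_def)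
  let ?f = "\<lambda>z::int. exp (- (a * (of_int z - b)\<^sup>2))"
  let ?k = "\<lfloor>b\<rfloor>"
  have ptw: "?f z \<le> 3 * q ^ j" if "real j \<le> \<bar>of_int z - b\<bar>" for z j
  proof -
    have "y * real j \<le> y * \<bar>of_int z - b\<bar>" using that y by (intro mult_left_mono) auto
    also have "\<dots> \<le> a * (of_int z - b)\<^sup>2 + 1"
    proof -
      have "0 \<le> (sqrt a * \<bar>of_int z - b\<bar> - 1)\<^sup>2" by simp
      also have "\<dots> = a * (of_int z - b)\<^sup>2 + 1 - y * \<bar>of_int z - b\<bar>"
        using a by (simp add: power2_diff power_mult_distrib y_def)
      finally show ?thesis by simp
    qed
    finally have "?f z \<le> exp (1 + - (y * real j))" by simp
    also have "\<dots> = exp 1 * q ^ j" unfolding exp_add by (simp add: q_def exp_of_nat_mult[symmetric] mult.commute)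
    also have "\<dots> \<le> 3 * q ^ j" using q exp_le by (intro mult_right_mono) auto
    finally show ?thesis .
  qed
  \<comment> \<open>The \<open>j\<close>-th point on either side of \<open>b\<close> is at distance
    at least \<open>j\<close>; on the right this is why counting starts at
    \<open>?k + 1\<close>.\<close>
  let ?A = "(\<lambda>j. ?k - int j) ` {..L}" and ?B = "(\<lambda>j. ?k + 1 + int j) ` {..L}"
  have sub: "{?k - int L..?k + int L} \<subseteq> ?A \<union> ?B"
  proof
    fix z assume z: "z \<in> {?k - int L..?k + int L}"
    show "z \<in> ?A \<union> ?B"
    proof (cases "z \<le> ?k")
      case True
      then have "z = ?k - int (nat (?k - z))" "nat (?k - z) \<le> L" using z by auto
      then show ?thesis by blast
    next
      case False
      then have "z = ?k + 1 + int (nat (z - ?k - 1))" "nat (z - ?k - 1) \<le> L" using z by auto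
      then show ?thesis by blast
    qed
  qed
  have "sum ?f {?k - int L..?k + int L} \<le> sum ?f (?A \<union> ?B)"
    using sub by (intro sum_mono2) auto
  also have "\<dots> \<le> sum ?f ?A + sum ?f ?B"
    by (subst sum_Un) (auto intro!: sum_nonneg)
  also have "sum ?f ?A = (\<Sum>j\<le>L. ?f (?k - int j))" by (subst sum.reindex) (auto simp: inj_on_def)
  also have "sum ?f ?B = (\<Sum>j\<le>L. ?f (?k + 1 + int j))" by (subst sum.reindex) (auto simp: inj_on_def)
  also have "(\<Sum>j\<le>L. ?f (?k - int j)) + (\<Sum>j\<le>L. ?f (?k + 1 + int j)) \<le>
      (\<Sum>j\<le>L. 3 * q ^ j) + (\<Sum>j\<le>L. 3 * q ^ j)"
  proof (intro add_mono sum_mono ptw)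
    fix j
    show "real j \<le> \<bar>of_int (?k - int j) - b\<bar>" by (simp, linarith)
    show "real j \<le> \<bar>of_int (?k + 1 + int j) - b\<bar>" by (simp, linarith)
  qed
  also have "\<dots> = 6 * (\<Sum>j\<le>L. q ^ j)" by (simp add: sum_distrib_left[symmetric])
  also have "\<dots> \<le> 6 * (1 / (1 - q))" using sum_geometric_le[OF q, of L] by simp
  also have "1 / (1 - q) \<le> 1 + 1 / y"
  proof -
    have "1 + y \<le> exp y" by simp
    then have "q \<le> 1 / (1 + y)" using y unfolding q_def exp_minus by (simp add: field_simps)
    then have "y / (1 + y) \<le> 1 - q" using y by (simp add: field_simps)
    then have "1 / (1 - q) \<le> 1 / (y / (1 + y))" using y q by (intro divide_left_mono) auto
    then show ?thesis using y by (simp add: field_simps)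
  qed
  also have "1 / y \<le> 1 / sqrt a" using a by (simp add: y_def field_simps)
  finally show ?thesis by simp
qed

text \<open>A crude window is enough: its width disappears from every count, since
  \<open>sum_int_exp_sq_le\<close> is uniform in \<open>L\<close>.\<close>

lemma int_near_mem:
  fixes b :: real
  assumes "(of_int z - b)\<^sup>2 \<le> W"
  shows "z \<in> {\<lfloor>b\<rfloor> - int (nat \<lceil>W\<rceil> + 1)..\<lfloor>b\<rfloor> + int (nat \<lceil>W\<rceil> + 1)}"
proof -
  have "\<bar>of_int z - b\<bar> \<le> W + 1"
  proof (rule ccontr)
    assume "\<not> \<bar>of_int z - b\<bar> \<le> W + 1"
    moreover have "0 \<le> W" using assms zero_le_power2 order_trans by blast
    moreover define t where "t = \<bar>of_int z - b\<bar>"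
    ultimately have "W + 1 < t" "1 \<le> t" by auto
    then have "W < t * t"
      using mult_left_mono[of 1 t t] by linarith
    then show False using assms by (simp add: power2_eq_square abs_mult_self_eq t_def)
  qed
  then show ?thesis by (simp add: abs_le_iff) linarith
qed

definition int_vecs :: "nat \<Rightarrow> (nat \<Rightarrow> int) set" where
  "int_vecs n = PiE {..<n} (\<lambda>_. UNIV)"

lemma int_vecs_near_subset:
  "{z \<in> int_vecs n. (\<Sum>i<n. (of_int (z i) - b i)\<^sup>2) \<le> (W::real)} \<subseteq>
    PiE {..<n} (\<lambda>i. {\<lfloor>b i\<rfloor> - int (nat \<lceil>W\<rceil> + 1)..\<lfloor>b i\<rfloor> + int (nat \<lceil>W\<rceil> + 1)})"
proof
  fix z assume z: "z \<in> {z \<in> int_vecs n. (\<Sum>i<n. (of_int (z i) - b i)\<^sup>2) \<le> (W::real)}"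
  show "z \<in> PiE {..<n} (\<lambda>i. {\<lfloor>b i\<rfloor> - int (nat \<lceil>W\<rceil> + 1)..\<lfloor>b i\<rfloor> + int (nat \<lceil>W\<rceil> + 1)})"
  proof (rule PiE_I)
    fix i assume i: "i \<in> {..<n}"
    have "(of_int (z i) - b i)\<^sup>2 \<le> (\<Sum>i<n. (of_int (z i) - b i)\<^sup>2)"
      using i by (intro member_le_sum) auto
    then show "z i \<in> {\<lfloor>b i\<rfloor> - int (nat \<lceil>W\<rceil> + 1)..\<lfloor>b i\<rfloor> + int (nat \<lceil>W\<rceil> + 1)}"
      using z by (intro int_near_mem) auto
  next
    fix i assume "i \<notin> {..<n}"
    then show "z i = undefined" using z by (auto simp: int_vecs_def PiE_def extensional_def)
  qed
qed

lemma finite_int_vecs_near: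
  "finite {z \<in> int_vecs n. (\<Sum>i<n. (of_int (z i) - b i)\<^sup>2) \<le> (W::real)}"
  by (rule finite_subset[OF int_vecs_near_subset]) (auto intro: finite_PiE)

text \<open>The free \<open>a\<close> is tuned to the radius: \<open>a * W\<close> of order
  \<open>n\<close> makes the count exponential with base of order
  \<open>1 + sqrt (W / n)\<close>.\<close>

lemma card_int_vecs_near:
  assumes a: "a > 0"
  shows "real (card {z \<in> int_vecs n. (\<Sum>i<n. (of_int (z i) - b i)\<^sup>2) \<le> W})
     \<le> exp (a * W) * (6 * (1 + 1 / sqrt a)) ^ n"
proof -
  let ?w = "\<lambda>i (y::int). exp (- (a * (of_int y - b i)\<^sup>2))"
  let ?F = "\<lambda>i. {\<lfloor>b i\<rfloor> - int (nat \<lceil>W\<rceil> + 1)..\<lfloor>b i\<rfloor> + int (nat \<lceil>W\<rceil> + 1)}"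
  have "real (card {z \<in> int_vecs n. (\<Sum>i<n. (of_int (z i) - b i)\<^sup>2) \<le> W})
     \<le> exp (a * W) * (\<Prod>i<n. \<Sum>y\<in>?F i. ?w i y)"
  proof (rule card_le_prod_sum[OF _ _ int_vecs_near_subset])
    fix z assume "z \<in> {z \<in> int_vecs n. (\<Sum>i<n. (of_int (z i) - b i)\<^sup>2) \<le> W}"
    then have "a * (\<Sum>i<n. (of_int (z i) - b i)\<^sup>2) \<le> a * W" using a by (intro mult_left_mono) auto
    then have "1 \<le> exp (a * W + (\<Sum>i<n. - (a * (of_int (z i) - b i)\<^sup>2)))"
      by (simp add: sum_negf sum_distrib_left)
    then show "1 \<le> exp (a * W) * (\<Prod>i<n. ?w i (z i))"
      by (simp add: exp_add exp_sum)
  qed auto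
  also have "(\<Prod>i<n. \<Sum>y\<in>?F i. ?w i y) \<le> (\<Prod>i<n. 6 * (1 + 1 / sqrt a))"
    by (intro prod_mono conjI sum_nonneg sum_int_exp_sq_le[OF a]) auto
  also have "\<dots> = (6 * (1 + 1 / sqrt a)) ^ n" by simp
  finally show ?thesis by simp
qed

text \<open>Each nonzero coordinate gets an extra weight \<open>1 / B\<close>. The sum for one
  coordinate is then close to 1 rather than a constant, at the cost \<open>B powr k\<close>; with
  \<open>k\<close> a small multiple of \<open>n\<close> the total has an arbitrarily small
  exponential rate. No choice of the support is counted separately.\<close>

lemma card_sparse_int_vecs:
  assumes a: "a > 0" and B: "B \<ge> 1"
  shows "real (card {z \<in> int_vecs n. (\<Sum>i<n. (of_int (z i))\<^sup>2) \<le> W \<and> real (card {i. i < n \<and> z i \<noteq> 0}) \<le> k})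
     \<le> exp (a * W) * B powr k * (1 + 6 * (1 + 1 / sqrt a) / B) ^ n"
proof -
  let ?w = "\<lambda>(i::nat) (y::int). exp (- (a * (of_int y)\<^sup>2)) * (if y = 0 then 1 else 1 / B)"
  define L where "L = nat \<lceil>W\<rceil> + 1"
  have "{z \<in> int_vecs n. (\<Sum>i<n. (of_int (z i))\<^sup>2) \<le> W \<and> real (card {i. i < n \<and> z i \<noteq> 0}) \<le> k}
    \<subseteq> PiE {..<n} (\<lambda>i. {\<lfloor>0::real\<rfloor> - int L..\<lfloor>0::real\<rfloor> + int L})"
    unfolding L_def by (rule subset_trans[OF _ int_vecs_near_subset[of n "\<lambda>_. 0" W]]) auto
  then have "real (card {z \<in> int_vecs n. (\<Sum>i<n. (of_int (z i))\<^sup>2) \<le> W \<and> real (card {i. i < n \<and> z i \<noteq> 0}) \<le> k})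
     \<le> (exp (a * W) * B powr k) * (\<Prod>i<n. \<Sum>y\<in>{\<lfloor>0::real\<rfloor> - int L..\<lfloor>0::real\<rfloor> + int L}. ?w i y)"
  proof (rule card_le_prod_sum[rotated 2])
    fix z assume z: "z \<in> {z \<in> int_vecs n. (\<Sum>i<n. (of_int (z i))\<^sup>2) \<le> W \<and> real (card {i. i < n \<and> z i \<noteq> 0}) \<le> k}"
    then have "a * (\<Sum>i<n. (of_int (z i))\<^sup>2) \<le> a * W" using a by (intro mult_left_mono) auto
    then have 1: "1 \<le> exp (a * W) * (\<Prod>i<n. exp (- (a * (of_int (z i))\<^sup>2)))"
      by (simp add: exp_add[symmetric] exp_sum[symmetric] sum_negf sum_distrib_left)
    have "1 = B powr (card {i. i < n \<and> z i \<noteq> 0}) * (1 / B) ^ (card {i. i < n \<and> z i \<noteq> 0})"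
      using B by (simp add: powr_realpow power_divide)
    also have "\<dots> \<le> B powr k * (1 / B) ^ (card {i. i < n \<and> z i \<noteq> 0})"
      using z B by (intro mult_right_mono powr_mono) auto
    also have "{i. i < n \<and> z i \<noteq> 0} = {..<n} \<inter> {i. z i \<noteq> 0}" by auto
    also have "(1 / B) ^ card ({..<n} \<inter> {i. z i \<noteq> 0}) = (\<Prod>i\<in>{..<n} \<inter> {i. z i \<noteq> 0}. 1 / B)" by simp
    also have "\<dots> = (\<Prod>i<n. if z i = 0 then 1 else 1 / B)"
      by (subst prod.inter_restrict) (auto intro: prod.cong)
    finally have 2: "1 \<le> B powr k * (\<Prod>i<n. if z i = 0 then 1 else 1 / B)" .
    have "1 * 1 \<le> (exp (a * W) * (\<Prod>i<n. exp (- (a * (of_int (z i))\<^sup>2)))) * (B powr k * (\<Prod>i<n. if z i = 0 then 1 else 1 / B))"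
      using 1 2 by (intro mult_mono) auto
    then show "1 \<le> (exp (a * W) * B powr k) * (\<Prod>i<n. ?w i (z i))"
      by (simp add: prod.distrib mult_ac)
  qed (use B in auto)
  also have "(\<Prod>i<n. \<Sum>y\<in>{\<lfloor>0::real\<rfloor> - int L..\<lfloor>0::real\<rfloor> + int L}. ?w i y) \<le> (\<Prod>i<n. 1 + 6 * (1 + 1 / sqrt a) / B)"
  proof (intro prod_mono conjI)
    fix i :: nat
    show "0 \<le> (\<Sum>y\<in>{\<lfloor>0::real\<rfloor> - int L..\<lfloor>0::real\<rfloor> + int L}. ?w i y)" using B by (intro sum_nonneg) auto
    have "(\<Sum>y\<in>{\<lfloor>0::real\<rfloor> - int L..\<lfloor>0::real\<rfloor> + int L}. ?w i y) \<le>
      (\<Sum>y\<in>{\<lfloor>0::real\<rfloor> - int L..\<lfloor>0::real\<rfloor> + int L}. (if y = 0 then 1 else 0) + exp (- (a * (of_int y)\<^sup>2)) / B)"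
      using B by (intro sum_mono) auto
    also have "\<dots> = 1 + (\<Sum>y\<in>{\<lfloor>0::real\<rfloor> - int L..\<lfloor>0::real\<rfloor> + int L}. exp (- (a * (of_int y)\<^sup>2))) / B"
      by (simp add: sum.distrib sum_divide_distrib)
    also have "\<dots> \<le> 1 + 6 * (1 + 1 / sqrt a) / B"
      using sum_int_exp_sq_le[OF a, of 0 L] B by (intro add_left_mono divide_right_mono) auto
    finally show "(\<Sum>y\<in>{\<lfloor>0::real\<rfloor> - int L..\<lfloor>0::real\<rfloor> + int L}. ?w i y) \<le> 1 + 6 * (1 + 1 / sqrt a) / B" .
  qed
  also have "\<dots> = (1 + 6 * (1 + 1 / sqrt a) / B) ^ n" by simp
  finally show ?thesis by (simp add: mult_left_mono)
qed

text \<open>Randomised rounding, derandomised by conditional expectations: each coordinate is rounded up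
  or down with mean \<open>v k\<close>, so on average only the diagonal terms survive in the square. This
  replaces an operator norm bound by a Hilbert--Schmidt one.\<close>

lemma exists_rounding:
  fixes A :: "'i \<Rightarrow> nat \<Rightarrow> real" and g :: "nat \<Rightarrow> int \<Rightarrow> real"
  assumes \<delta>: "\<delta> > 0"
    and g: "\<And>k. k < n \<Longrightarrow> (1 - frac (v k / \<delta>)) * g k \<lfloor>v k / \<delta>\<rfloor> + frac (v k / \<delta>) * g k (\<lfloor>v k / \<delta>\<rfloor> + 1) \<le> e k"
  shows "\<exists>z. (\<forall>k<n. z k = \<lfloor>v k / \<delta>\<rfloor> \<or> z k = \<lfloor>v k / \<delta>\<rfloor> + 1) \<and>
    (\<Sum>i\<in>I. (\<Sum>k<n. A i k * (v k - \<delta> * of_int (z k)))\<^sup>2) + (\<Sum>k<n. g k (z k)) \<le>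
    (\<Sum>k<n. \<delta>\<^sup>2 * (\<Sum>i\<in>I. (A i k)\<^sup>2) + e k)"
  using g
proof (induction n)
  case 0
  then show ?case by simp
next
  case (Suc n)
  have "\<exists>z. (\<forall>k<n. z k = \<lfloor>v k / \<delta>\<rfloor> \<or> z k = \<lfloor>v k / \<delta>\<rfloor> + 1) \<and>
    (\<Sum>i\<in>I. (\<Sum>k<n. A i k * (v k - \<delta> * of_int (z k)))\<^sup>2) + (\<Sum>k<n. g k (z k)) \<le>
    (\<Sum>k<n. \<delta>\<^sup>2 * (\<Sum>i\<in>I. (A i k)\<^sup>2) + e k)"
    by (rule Suc.IH) (rule Suc.prems, simp)
  then obtain z where z: "\<And>k. k < n \<Longrightarrow> z k = \<lfloor>v k / \<delta>\<rfloor> \<or> z k = \<lfloor>v k / \<delta>\<rfloor> + 1"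
    "(\<Sum>i\<in>I. (\<Sum>k<n. A i k * (v k - \<delta> * of_int (z k)))\<^sup>2) + (\<Sum>k<n. g k (z k)) \<le>
      (\<Sum>k<n. \<delta>\<^sup>2 * (\<Sum>i\<in>I. (A i k)\<^sup>2) + e k)"
    by blast
  define w where "w i = (\<Sum>k<n. A i k * (v k - \<delta> * of_int (z k)))" for i
  define p where "p = frac (v n / \<delta>)"
  define f where "f = \<lfloor>v n / \<delta>\<rfloor>"
  define V where "V = (\<Sum>i\<in>I. (A i n)\<^sup>2)"
  define Y where "Y = (\<Sum>i\<in>I. w i * A i n)"
  define Q where "Q d = (\<Sum>i\<in>I. (w i + A i n * d)\<^sup>2)" for d
  have Q: "Q d = (\<Sum>i\<in>I. (w i)\<^sup>2) + 2 * d * Y + d\<^sup>2 * V" for d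
    unfolding Q_def Y_def V_def
    by (simp add: power2_sum power_mult_distrib sum.distrib sum_distrib_left mult_ac)
  have p: "0 \<le> p" "p \<le> 1" using frac_lt_1[of "v n / \<delta>"] by (auto simp: p_def)
  have "v n / \<delta> = of_int f + p" by (simp add: p_def f_def frac_def)
  then have "v n = \<delta> * of_int f + \<delta> * p" using \<delta> by (simp add: field_simps)
  then have d: "v n - \<delta> * of_int f = \<delta> * p" "v n - \<delta> * of_int (f + 1) = \<delta> * (p - 1)"
    by (auto simp: algebra_simps)
  \<comment> \<open>The increments \<open>\<delta> * p\<close> and \<open>\<delta> * (p - 1)\<close>
    have mean zero under the weights \<open>1 - p\<close> and \<open>p\<close>, so the cross term
    with \<open>Y\<close> cancels and only the variance
    \<open>\<delta>\<^sup>2 * p * (1 - p) * V\<close> remains. Some choice does no worse than the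
    mean.\<close>
  have avg: "(1 - p) * (Q (\<delta> * p) + g n f) + p * (Q (\<delta> * (p - 1)) + g n (f + 1)) \<le>
     (\<Sum>i\<in>I. (w i)\<^sup>2) + (\<delta>\<^sup>2 * V + e n)"
  proof -
    have "(1 - p) * Q (\<delta> * p) + p * Q (\<delta> * (p - 1)) = (\<Sum>i\<in>I. (w i)\<^sup>2) + (p * (1 - p)) * (\<delta>\<^sup>2 * V)"
      unfolding Q by (simp add: power2_eq_square algebra_simps)
    moreover have "(p * (1 - p)) * (\<delta>\<^sup>2 * V) \<le> 1 * (\<delta>\<^sup>2 * V)"
      using p by (intro mult_right_mono mult_le_one) (auto simp: V_def intro!: sum_nonneg mult_nonneg_nonneg)
    moreover have "(1 - p) * g n f + p * g n (f + 1) \<le> e n"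
      using Suc.prems[of n] by (simp add: p_def f_def)
    ultimately show ?thesis by (simp add: algebra_simps)
  qed
  have "\<exists>y. (y = f \<or> y = f + 1) \<and> Q (v n - \<delta> * of_int y) + g n y \<le> (\<Sum>i\<in>I. (w i)\<^sup>2) + (\<delta>\<^sup>2 * V + e n)"
  proof (rule ccontr)
    assume neg: "\<not> ?thesis"
    let ?R = "(\<Sum>i\<in>I. (w i)\<^sup>2) + (\<delta>\<^sup>2 * V + e n)"
    have 0: "?R < Q (\<delta> * p) + g n f" using neg[simplified, rule_format, of f] d(1) by auto
    have 1: "?R < Q (\<delta> * (p - 1)) + g n (f + 1)" using neg d(2) by force
    have "?R = (1 - p) * ?R + p * ?R" by (simp add: algebra_simps)
    also have "\<dots> < (1 - p) * (Q (\<delta> * p) + g n f) + p * (Q (\<delta> * (p - 1)) + g n (f + 1))"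
    proof (cases "p = 0")
      case True then show ?thesis using 0 by simp
    next
      case False
      have "(1 - p) * ?R \<le> (1 - p) * (Q (\<delta> * p) + g n f)"
        by (rule mult_left_mono[OF less_imp_le[OF 0]]) (use p in simp)
      moreover have "p * ?R < p * (Q (\<delta> * (p - 1)) + g n (f + 1))"
        by (rule mult_strict_left_mono[OF 1]) (use p False in simp)
      ultimately show ?thesis by (rule add_le_less_mono)
    qed
    finally show False using avg by linarith
  qed
  then obtain y where y: "y = f \<or> y = f + 1"
    "Q (v n - \<delta> * of_int y) + g n y \<le> (\<Sum>i\<in>I. (w i)\<^sup>2) + (\<delta>\<^sup>2 * V + e n)" by blast
  let ?z = "z(n := y)"
  have "(\<Sum>i\<in>I. (\<Sum>k<Suc n. A i k * (v k - \<delta> * of_int (?z k)))\<^sup>2) = Q (v n - \<delta> * of_int y)"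
    by (simp add: Q_def w_def)
  moreover have "(\<Sum>k<Suc n. g k (?z k)) = (\<Sum>k<n. g k (z k)) + g n y" by simp
  moreover have "\<forall>k<Suc n. ?z k = \<lfloor>v k / \<delta>\<rfloor> \<or> ?z k = \<lfloor>v k / \<delta>\<rfloor> + 1"
    using z(1) y(1) by (auto simp: f_def less_Suc_eq)
  moreover have "(\<Sum>k<Suc n. \<delta>\<^sup>2 * (\<Sum>i\<in>I. (A i k)\<^sup>2) + e k) =
     (\<Sum>k<n. \<delta>\<^sup>2 * (\<Sum>i\<in>I. (A i k)\<^sup>2) + e k) + (\<delta>\<^sup>2 * V + e n)" by (simp add: V_def)
  ultimately show ?case using y(2) z(2) unfolding w_def[symmetric]
    by - (rule exI[of _ ?z], intro conjI; (assumption | linarith))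
qed

section \<open>A moment bound for vectors of norm of order one\<close>

lemma exp_minus_le_quadratic:
  fixes y :: real
  assumes "0 \<le> y"
  shows "exp (- y) \<le> 1 - y + y\<^sup>2"
proof -
  have "1 + y \<le> exp y" by simp
  then have "exp (- y) \<le> 1 / (1 + y)" using assms unfolding exp_minus by (simp add: field_simps)
  also have "\<dots> \<le> 1 - y + y\<^sup>2"
  proof -
    have "(1 - y + y\<^sup>2) * (1 + y) = 1 + y ^ 3" by (simp add: power2_eq_square power3_eq_cube algebra_simps)
    then show ?thesis using assms by (simp add: pos_divide_le_eq)
  qed
  finally show ?thesis .
qed

lemma sum_half_sets_compl:
  assumes "even n"
  shows "(\<Sum>S\<in>half_sets n. F ({..<n} - S)) = (\<Sum>S\<in>half_sets n. F S)"
proof (rule sum.reindex_bij_betw)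
  have *: "{..<n} - S \<in> half_sets n" if "S \<in> half_sets n" for S
    using half_setsD[OF that] assms by (auto simp: half_sets_def card_Diff_subset)
  show "bij_betw (\<lambda>S. {..<n} - S) (half_sets n) (half_sets n)"
    by (rule bij_betw_byWitness[where f' = "\<lambda>S. {..<n} - S"]) (use * in \<open>auto simp: half_sets_def\<close>)
qed

text \<open>Pairing each half set with its complement counts every coordinate exactly once per
  pair.\<close>

lemma sum_half_sets_weight:
  fixes w :: "nat \<Rightarrow> real"
  assumes "even n"
  shows "(\<Sum>S\<in>half_sets n. \<Sum>i\<in>S. w i) = real (n choose (n div 2)) * (\<Sum>i<n. w i) / 2"
proof -
  have "2 * (\<Sum>S\<in>half_sets n. \<Sum>i\<in>S. w i) =
        (\<Sum>S\<in>half_sets n. \<Sum>i\<in>S. w i) + (\<Sum>S\<in>half_sets n. \<Sum>i\<in>{..<n} - S. w i)"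
    using sum_half_sets_compl[OF assms, of "\<lambda>S. \<Sum>i\<in>S. w i"] by simp
  also have "\<dots> = (\<Sum>S\<in>half_sets n. \<Sum>i<n. w i)"
    unfolding sum.distrib[symmetric]
  proof (rule sum.cong[OF refl])
    fix S assume "S \<in> half_sets n"
    then have "S \<subseteq> {..<n}" by (simp add: half_sets_def)
    from sum.subset_diff[OF this, of w] show "(\<Sum>i\<in>S. w i) + (\<Sum>i\<in>{..<n} - S. w i) = (\<Sum>i<n. w i)"
      by simp
  qed
  also have "\<dots> = real (n choose (n div 2)) * (\<Sum>i<n. w i)" by (simp add: card_half_sets)
  finally show ?thesis by simp
qed

text \<open>A constant gain for every vector of norm of order one, spread or not. Second and fourth
  moments \<open>N / 2\<close> and at most \<open>3 * N\<^sup>2\<close> give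
  \<open>1 - N / 96 + N\<^sup>2 / 768\<close>, which is at most \<open>1 - N / 192\<close> for
  \<open>N \<le> 4\<close> and so at most \<open>1 - 1 / 768\<close> for
  \<open>N \<ge> 1 / 4\<close>.\<close>

lemma row_avg_exp_sq_le:
  assumes n: "even n" and N: "1 / 4 \<le> (\<Sum>i<n. (x i)\<^sup>2)" "(\<Sum>i<n. (x i)\<^sup>2) \<le> 4"
  shows "row_avg n (\<lambda>y. exp (- (y\<^sup>2 / 48))) x \<le> 1 - 1 / 768"
proof -
  define N where "N = (\<Sum>i<n. (x i)\<^sup>2)"
  define c where "c = 2 ^ (n div 2) * real (n choose (n div 2))"
  have c: "c > 0" by (simp add: c_def)
  have "(\<Sum>r\<in>sign_rows n. exp (- ((dotp n r x)\<^sup>2 / 48))) \<le>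
     (\<Sum>r\<in>sign_rows n. 1 - (dotp n r x)\<^sup>2 / 48 + ((dotp n r x)\<^sup>2 / 48)\<^sup>2)"
    by (intro sum_mono exp_minus_le_quadratic) simp
  also have "\<dots> = c - (\<Sum>r\<in>sign_rows n. (dotp n r x)\<^sup>2) / 48 + (\<Sum>r\<in>sign_rows n. (dotp n r x) ^ 4) / 2304"
    by (simp add: sum.distrib sum_subtractf sum_divide_distrib power_divide c_def card_sign_rows[OF n])
  also have "(\<Sum>r\<in>sign_rows n. (dotp n r x)\<^sup>2) = c * N / 2"
  proof -
    have "(\<Sum>r\<in>sign_rows n. (dotp n r x)\<^sup>2) = (\<Sum>S\<in>half_sets n. 2 ^ (n div 2) * (\<Sum>i\<in>S. (x i)\<^sup>2))"
      by (subst sum_sign_rows[OF n, where f = "\<lambda>y. y\<^sup>2"], intro sum.cong)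
         (auto simp: sum_signed_sum_sq dest: half_setsD)
    also have "\<dots> = c * N / 2"
      by (simp add: sum_distrib_left[symmetric] sum_half_sets_weight[OF n] c_def N_def)
    finally show ?thesis .
  qed
  also have "(\<Sum>r\<in>sign_rows n. (dotp n r x) ^ 4) \<le> c * (3 * N\<^sup>2)"
  proof -
    have "(\<Sum>r\<in>sign_rows n. (dotp n r x) ^ 4) = (\<Sum>S\<in>half_sets n. \<Sum>T\<in>Pow S. (signed_sum S T x) ^ 4)"
      by (rule sum_sign_rows[OF n, where f = "\<lambda>y. y ^ 4"])
    also have "\<dots> \<le> (\<Sum>S\<in>half_sets n. 2 ^ (n div 2) * (3 * N\<^sup>2))"
    proof (rule sum_mono)
      fix S assume S: "S \<in> half_sets n"
      have "(\<Sum>T\<in>Pow S. (signed_sum S T x) ^ 4) \<le> 2 ^ card S * (3 * (\<Sum>i\<in>S. (x i)\<^sup>2)\<^sup>2)"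
        using half_setsD[OF S] by (intro sum_signed_sum_pow4_le) auto
      also have "\<dots> \<le> 2 ^ card S * (3 * N\<^sup>2)"
        unfolding N_def using half_setsD[OF S]
        by (intro mult_left_mono power_mono sum_mono2 sum_nonneg) auto
      finally show "(\<Sum>T\<in>Pow S. (signed_sum S T x) ^ 4) \<le> 2 ^ (n div 2) * (3 * N\<^sup>2)"
        using half_setsD[OF S] by simp
    qed
    also have "\<dots> = c * (3 * N\<^sup>2)" by (simp add: card_half_sets c_def)
    finally show ?thesis .
  qed
  also have "c - c * N / 2 / 48 + c * (3 * N\<^sup>2) / 2304 = c * (1 - N / 96 + N\<^sup>2 / 768)"
    by (simp add: algebra_simps)
  also have "\<dots> \<le> c * (1 - 1 / 768)"
  proof (rule mult_left_mono)
    have "N * N \<le> 4 * N" using N by (intro mult_right_mono) (auto simp: N_def)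
    then show "1 - N / 96 + N\<^sup>2 / 768 \<le> 1 - 1 / 768"
      using N[folded N_def] unfolding power2_eq_square by linarith
  qed (use c in simp)
  finally show ?thesis
    using c unfolding row_avg_def card_sign_rows[OF n] c_def[symmetric] by (simp add: field_simps)
qed

section \<open>Union bound and rounding of normal vectors\<close>

lemma card_union_bound:
  assumes n: "even n" "finite I" "s > 0" and Z: "finite Z" and p: "0 \<le> p"
    and avg: "\<And>z. z \<in> Z \<Longrightarrow> row_avg n (\<lambda>y. exp (- (y\<^sup>2 / (2 * s\<^sup>2)))) (X z) \<le> p"
    and B: "B \<subseteq> row_families I n"
      "\<And>q. q \<in> B \<Longrightarrow> \<exists>z\<in>Z. (\<Sum>i\<in>I. (dotp n (q i) (X z))\<^sup>2) \<le> 2 * \<tau> * s\<^sup>2"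
  shows "real (card B) \<le> real (card Z) * (exp \<tau> * p ^ card I) * real (card (row_families I n))"
proof -
  let ?E = "\<lambda>z. {q \<in> row_families I n. (\<Sum>i\<in>I. (dotp n (q i) (X z))\<^sup>2) \<le> 2 * \<tau> * s\<^sup>2}"
  have "B \<subseteq> (\<Union>z\<in>Z. ?E z)" using B by blast
  then have "card B \<le> card (\<Union>z\<in>Z. ?E z)"
    using Z finite_row_families[OF n(2)] by (intro card_mono) auto
  also have "\<dots> \<le> (\<Sum>z\<in>Z. card (?E z))" by (rule card_UN_le[OF Z])
  finally have "real (card B) \<le> (\<Sum>z\<in>Z. real (card (?E z)))"
    using of_nat_mono[of "card B"] by fastforce
  also have "\<dots> \<le> (\<Sum>z\<in>Z. exp \<tau> * p ^ card I * real (card (row_families I n)))"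
  proof (rule sum_mono)
    fix z assume z: "z \<in> Z"
    have "real (card (?E z)) \<le> exp \<tau> * row_avg n (\<lambda>y. exp (- (y\<^sup>2 / (2 * s\<^sup>2)))) (X z) ^ card I * real (card (row_families I n))"
      by (rule card_small_image[OF n])
    also have "\<dots> \<le> exp \<tau> * p ^ card I * real (card (row_families I n))"
      using avg[OF z] by (intro mult_right_mono mult_left_mono power_mono) (auto simp: row_avg_def sum_nonneg)
    finally show "real (card (?E z)) \<le> exp \<tau> * p ^ card I * real (card (row_families I n))" .
  qed
  finally show ?thesis by simp
qed

text \<open>As \<open>v\<close> is annihilated by the rows, the rounding error in each row is up to
  sign the product of that row with the rounded vector. At most \<open>n\<close> rows with entries
  of modulus at most 1 have squared Hilbert--Schmidt norm at most \<open>n\<^sup>2\<close>. The cost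
  \<open>g\<close> lets a caller control a second quantity along with the error.\<close>

lemma exists_rounding_rows:
  assumes I: "finite I" "card I \<le> n" and q: "q \<in> row_families I n"
    and v: "\<And>i. i \<in> I \<Longrightarrow> dotp n (q i) v = 0" and \<delta>: "\<delta> > 0"
    and g: "\<And>k. k < n \<Longrightarrow> (1 - frac (v k / \<delta>)) * g k \<lfloor>v k / \<delta>\<rfloor> + frac (v k / \<delta>) * g k (\<lfloor>v k / \<delta>\<rfloor> + 1) \<le> e k"
  shows "\<exists>z\<in>int_vecs n. (\<forall>k<n. \<bar>v k - \<delta> * of_int (z k)\<bar> \<le> \<delta>) \<and>
    (\<Sum>i\<in>I. (dotp n (q i) (\<lambda>k. \<delta> * of_int (z k)))\<^sup>2) + (\<Sum>k<n. g k (z k)) \<le>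
      \<delta>\<^sup>2 * (real n)\<^sup>2 + (\<Sum>k<n. e k)"
proof -
  obtain z where z: "\<And>k. k < n \<Longrightarrow> z k = \<lfloor>v k / \<delta>\<rfloor> \<or> z k = \<lfloor>v k / \<delta>\<rfloor> + 1"
    "(\<Sum>i\<in>I. (\<Sum>k<n. q i k * (v k - \<delta> * of_int (z k)))\<^sup>2) + (\<Sum>k<n. g k (z k)) \<le>
     (\<Sum>k<n. \<delta>\<^sup>2 * (\<Sum>i\<in>I. (q i k)\<^sup>2) + e k)"
    using exists_rounding[OF \<delta>, where n = n and v = v and g = g and e = e and A = q and I = I] g by blast
  define z' where "z' = restrict z {..<n}"
  have "(\<Sum>i\<in>I. (\<Sum>k<n. q i k * (v k - \<delta> * of_int (z k)))\<^sup>2) =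
        (\<Sum>i\<in>I. (dotp n (q i) (\<lambda>k. \<delta> * of_int (z' k)))\<^sup>2)"
  proof (rule sum.cong[OF refl])
    fix i assume "i \<in> I"
    have "(\<Sum>k<n. q i k * (v k - \<delta> * of_int (z k))) = dotp n (q i) v - dotp n (q i) (\<lambda>k. \<delta> * of_int (z' k))"
      unfolding dotp_def sum_subtractf[symmetric] by (intro sum.cong) (auto simp: z'_def algebra_simps)
    then show "(\<Sum>k<n. q i k * (v k - \<delta> * of_int (z k)))\<^sup>2 = (dotp n (q i) (\<lambda>k. \<delta> * of_int (z' k)))\<^sup>2"
      using v[OF \<open>i \<in> I\<close>] by simp
  qed
  moreover have "(\<Sum>k<n. g k (z k)) = (\<Sum>k<n. g k (z' k))" by (simp add: z'_def)
  moreover have "(\<Sum>k<n. \<delta>\<^sup>2 * (\<Sum>i\<in>I. (q i k)\<^sup>2) + e k) \<le> \<delta>\<^sup>2 * (real n)\<^sup>2 + (\<Sum>k<n. e k)"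
  proof -
    have "(\<Sum>i\<in>I. (q i k)\<^sup>2) \<le> real n" if "k < n" for k
    proof -
      have "(\<Sum>i\<in>I. (q i k)\<^sup>2) \<le> (\<Sum>i\<in>I. 1)"
        using q that by (intro sum_mono sign_rows_sq_le[of _ n]) (auto simp: row_families_def)
      then show ?thesis using I(2) by simp
    qed
    then have "(\<Sum>k<n. \<delta>\<^sup>2 * (\<Sum>i\<in>I. (q i k)\<^sup>2)) \<le> (\<Sum>k<n. \<delta>\<^sup>2 * real n)"
      by (intro sum_mono mult_left_mono) auto
    then show ?thesis by (simp add: sum.distrib power2_eq_square algebra_simps)
  qed
  moreover have "z' \<in> int_vecs n" by (auto simp: z'_def int_vecs_def)
  moreover have "\<bar>v k - \<delta> * of_int (z' k)\<bar> \<le> \<delta>" if "k < n" for k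
  proof -
    have "\<bar>v k / \<delta> - of_int (z k)\<bar> \<le> 1" using z(1)[OF that] by (auto; linarith)
    from mult_left_mono[OF this, of \<delta>] have "\<bar>\<delta> * (v k / \<delta> - of_int (z k))\<bar> \<le> \<delta>"
      using \<delta> by (simp add: abs_mult)
    then show ?thesis using \<delta> that by (simp add: right_diff_distrib z'_def)
  qed
  ultimately show ?thesis using z(2) by (intro bexI[of _ z']) auto
qed

lemma sum_sq_perturb:
  fixes x v :: "nat \<Rightarrow> real"
  assumes "(\<Sum>k<n. (v k)\<^sup>2) = 1" "\<And>k. k < n \<Longrightarrow> \<bar>v k - x k\<bar> \<le> \<delta>" "\<delta>\<^sup>2 * real n \<le> 1 / 4"
  shows "1 / 4 \<le> (\<Sum>k<n. (x k)\<^sup>2)" "(\<Sum>k<n. (x k)\<^sup>2) \<le> 4"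
proof -
  have "(\<Sum>k<n. (v k - x k)\<^sup>2) \<le> (\<Sum>k<n. \<delta>\<^sup>2)"
  proof (rule sum_mono)
    fix k assume "k \<in> {..<n}"
    then show "(v k - x k)\<^sup>2 \<le> \<delta>\<^sup>2" using power_mono[OF assms(2)[of k], of 2] by simp
  qed
  then have d: "(\<Sum>k<n. (v k - x k)\<^sup>2) \<le> 1 / 4" using assms(3) by (simp add: mult.commute)
  have "(\<Sum>k<n. (v k)\<^sup>2) \<le> (\<Sum>k<n. 2 * (x k)\<^sup>2 + 2 * (v k - x k)\<^sup>2)"
  proof (rule sum_mono)
    fix k show "(v k)\<^sup>2 \<le> 2 * (x k)\<^sup>2 + 2 * (v k - x k)\<^sup>2"
      using zero_le_power2[of "2 * x k - v k"] by (simp add: power2_eq_square algebra_simps)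
  qed
  then show "1 / 4 \<le> (\<Sum>k<n. (x k)\<^sup>2)"
    using d assms(1) by (simp add: sum.distrib sum_distrib_left[symmetric])
  have "(\<Sum>k<n. (x k)\<^sup>2) \<le> (\<Sum>k<n. 2 * (v k)\<^sup>2 + 2 * (v k - x k)\<^sup>2)"
  proof (rule sum_mono)
    fix k show "(x k)\<^sup>2 \<le> 2 * (v k)\<^sup>2 + 2 * (v k - x k)\<^sup>2"
      using zero_le_power2[of "2 * v k - x k"] by (simp add: power2_eq_square algebra_simps)
  qed
  then show "(\<Sum>k<n. (x k)\<^sup>2) \<le> 4"
    using d assms(1) by (simp add: sum.distrib sum_distrib_left[symmetric])
qed

section \<open>Compressible normal vectors\<close>

definition big_coords :: "nat \<Rightarrow> real \<Rightarrow> (nat \<Rightarrow> real) \<Rightarrow> nat set" where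
  "big_coords n \<rho> v = {i. i < n \<and> \<rho> / sqrt n \<le> \<bar>v i\<bar>}"

definition unit_normal :: "'i set \<Rightarrow> nat \<Rightarrow> ('i \<Rightarrow> nat \<Rightarrow> real) \<Rightarrow> (nat \<Rightarrow> real) \<Rightarrow> bool" where
  "unit_normal I n q v \<longleftrightarrow> (\<Sum>k<n. (v k)\<^sup>2) = 1 \<and> (\<forall>i\<in>I. dotp n (q i) v = 0)"

lemma one_minus_power_le:
  fixes \<gamma> :: real
  assumes "\<gamma> \<le> 1" "0 < n"
  shows "(1 - \<gamma>) ^ (n - 1) \<le> exp (\<gamma> - \<gamma> * real n)"
proof -
  have "(1 - \<gamma>) ^ (n - 1) \<le> exp (- \<gamma>) ^ (n - 1)"
    using assms exp_ge_add_one_self[of "- \<gamma>"] by (intro power_mono) auto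
  also have "\<dots> = exp (\<gamma> - \<gamma> * real n)"
    using assms(2) by (simp add: exp_of_nat_mult[symmetric] of_nat_diff algebra_simps)
  finally show ?thesis .
qed

text \<open>The rounding penalises every small coordinate that is not rounded to \<open>0\<close>, so that an almost
  sparse vector is rounded to a sparse lattice vector.\<close>

lemma sparse_rounding:
  assumes n: "n > 0" and I: "finite I" "card I \<le> n" and q: "q \<in> row_families I n"
    and v: "unit_normal I n q v" and r: "0 < r" "r \<le> 1 / 2" and \<rho>: "0 < \<rho>" "\<rho> < r"
  defines "\<delta> \<equiv> r / sqrt n"
  shows "\<exists>z\<in>int_vecs n. 1 / 4 \<le> (\<Sum>k<n. (\<delta> * of_int (z k))\<^sup>2) \<and> (\<Sum>k<n. (\<delta> * of_int (z k))\<^sup>2) \<le> 4 \<and>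
    real (card {k. k < n \<and> z k \<noteq> 0}) \<le> real (card (big_coords n \<rho> v)) + 2 * \<rho> / r * n \<and>
    (\<Sum>i\<in>I. (dotp n (q i) (\<lambda>k. \<delta> * of_int (z k)))\<^sup>2) \<le> 2 * r\<^sup>2 * n"
proof -
  \<comment> \<open>A small coordinate has
    \<open>\<bar>v k / \<delta>\<bar> \<le> \<rho> / r\<close>, and this modulus is its weight for
    being rounded away from 0. With this \<open>P\<close> its mean penalty is at most
    \<open>r\<^sup>2\<close>, the same as the rounding budget \<open>\<delta>\<^sup>2 * n\<close>
    per coordinate.\<close>
  define P where "P = r ^ 3 / \<rho>"
  have P: "P > 0" using r \<rho> by (simp add: P_def)
  have \<delta>: "\<delta> > 0" using r n by (simp add: \<delta>_def)
  have \<delta>n: "\<delta>\<^sup>2 * real n = r\<^sup>2" using n by (simp add: \<delta>_def power_divide)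
  define g where "g k z = (if \<bar>v k\<bar> < \<rho> / sqrt n \<and> z \<noteq> 0 then P else 0)" for k and z :: int
  have g: "(1 - frac (v k / \<delta>)) * g k \<lfloor>v k / \<delta>\<rfloor> + frac (v k / \<delta>) * g k (\<lfloor>v k / \<delta>\<rfloor> + 1) \<le> r\<^sup>2"
    for k
  proof (cases "\<bar>v k\<bar> < \<rho> / sqrt n")
    case True
    define t where "t = v k / \<delta>"
    have "\<bar>t\<bar> = \<bar>v k\<bar> * sqrt n / r" using r n by (simp add: t_def \<delta>_def abs_mult abs_divide)
    also have "\<dots> \<le> \<rho> / sqrt n * sqrt n / r"
      using True r by (intro divide_right_mono mult_right_mono) auto
    also have "\<dots> = \<rho> / r" using n by simp
    finally have t: "\<bar>t\<bar> \<le> \<rho> / r" .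
    have t1: "\<rho> / r < 1" using r \<rho> by simp
    have "\<bar>t\<bar> * P \<le> \<rho> / r * P" using t P by (intro mult_right_mono) auto
    also have "\<dots> = r\<^sup>2" using r \<rho> by (simp add: P_def power2_eq_square power3_eq_cube)
    finally have tP: "\<bar>t\<bar> * P \<le> r\<^sup>2" .
    show ?thesis
    proof (cases "0 \<le> t")
      case True
      then have "\<lfloor>t\<rfloor> = 0" using t t1 by linarith
      then have "frac t = t" by (simp add: frac_def)
      then show ?thesis unfolding t_def[symmetric] using \<open>\<lfloor>t\<rfloor> = 0\<close> tP True P
        by (auto simp: g_def)
    next
      case False
      then have f: "\<lfloor>t\<rfloor> = -1" using t t1 by linarith
      then have "frac t = t + 1" by (simp add: frac_def)
      then show ?thesis unfolding t_def[symmetric] using f tP False P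
        by (auto simp: g_def)
    qed
  next
    case False
    then show ?thesis by (simp add: g_def)
  qed
  obtain z where z: "z \<in> int_vecs n" "\<And>k. k < n \<Longrightarrow> \<bar>v k - \<delta> * of_int (z k)\<bar> \<le> \<delta>"
    "(\<Sum>i\<in>I. (dotp n (q i) (\<lambda>k. \<delta> * of_int (z k)))\<^sup>2) + (\<Sum>k<n. g k (z k)) \<le>
      \<delta>\<^sup>2 * (real n)\<^sup>2 + (\<Sum>k<n. r\<^sup>2)"
    using exists_rounding_rows[OF I q, where v = v and \<delta> = \<delta> and g = g and e = "\<lambda>_. r\<^sup>2"] g v \<delta>
    unfolding unit_normal_def by blast
  have "\<delta>\<^sup>2 * (real n)\<^sup>2 + (\<Sum>k<n. r\<^sup>2) = 2 * r\<^sup>2 * n"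
    using \<delta>n by (simp add: power2_eq_square[of "real n"] mult.assoc[symmetric])
  with z(3) have tot: "(\<Sum>i\<in>I. (dotp n (q i) (\<lambda>k. \<delta> * of_int (z k)))\<^sup>2) + (\<Sum>k<n. g k (z k)) \<le> 2 * r\<^sup>2 * n"
    by (simp add: mult_ac)
  have nn1: "0 \<le> (\<Sum>i\<in>I. (dotp n (q i) (\<lambda>k. \<delta> * of_int (z k)))\<^sup>2)" by (intro sum_nonneg) simp
  have nn2: "0 \<le> (\<Sum>k<n. g k (z k))" using P by (intro sum_nonneg) (simp add: g_def)
  let ?T = "{k. k < n \<and> \<bar>v k\<bar> < \<rho> / sqrt n \<and> z k \<noteq> 0}"
  have "(\<Sum>k<n. g k (z k)) = P * real (card ?T)"
  proof -
    have "(\<Sum>k<n. g k (z k)) = (\<Sum>k\<in>{k\<in>{..<n}. \<bar>v k\<bar> < \<rho> / sqrt n \<and> z k \<noteq> 0}. P)"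
      unfolding g_def by (rule sum.inter_filter[symmetric]) simp
    also have "{k\<in>{..<n}. \<bar>v k\<bar> < \<rho> / sqrt n \<and> z k \<noteq> 0} = ?T" by auto
    finally show ?thesis by (simp add: mult.commute)
  qed
  then have "P * real (card ?T) \<le> 2 * r\<^sup>2 * n" using tot nn1 by linarith
  then have "real (card ?T) \<le> 2 * r\<^sup>2 * n / P" using P by (simp add: pos_le_divide_eq mult.commute)
  also have "\<dots> = 2 * \<rho> / r * n" using r \<rho> by (simp add: P_def power2_eq_square power3_eq_cube)
  finally have T: "real (card ?T) \<le> 2 * \<rho> / r * n" .
  have "card {k. k < n \<and> z k \<noteq> 0} \<le> card (big_coords n \<rho> v \<union> ?T)"
    by (intro card_mono) (auto simp: big_coords_def)
  also have "\<dots> \<le> card (big_coords n \<rho> v) + card ?T" by (rule card_Un_le)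
  finally have supp: "real (card {k. k < n \<and> z k \<noteq> 0}) \<le> real (card (big_coords n \<rho> v)) + 2 * \<rho> / r * n"
    using T by linarith
  have "r\<^sup>2 \<le> (1 / 2)\<^sup>2" using r by (intro power_mono) auto
  then have "\<delta>\<^sup>2 * real n \<le> 1 / 4" unfolding \<delta>n by (simp add: power_divide)
  from sum_sq_perturb[OF _ z(2) this]
  have "1 / 4 \<le> (\<Sum>k<n. (\<delta> * of_int (z k))\<^sup>2)" "(\<Sum>k<n. (\<delta> * of_int (z k))\<^sup>2) \<le> 4"
    using v by (auto simp: unit_normal_def)
  then show ?thesis using z(1) supp tot nn2 by (intro bexI[of _ z] conjI) auto
qed

text \<open>Without spread, a fixed vector gains only a factor \<open>1 - \<gamma>\<close> per row,
  so the net must have fewer than \<open>exp (\<gamma> * n)\<close> points. Sparse lattice vectors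
  achieve this for a small enough sparsity \<open>\<mu>\<close>.\<close>

lemma compressible_normals_rare:
  "\<exists>\<eta> \<rho> C c :: real. 0 < \<eta> \<and> \<eta> \<le> 1 \<and> 0 < \<rho> \<and> \<rho> \<le> 1 \<and> 0 < C \<and> 0 < c \<and>
    (\<forall>n (I :: 'i set). even n \<longrightarrow> 0 < n \<longrightarrow> finite I \<longrightarrow> card I = n - 1 \<longrightarrow>
      real (card {q \<in> row_families I n. \<exists>v. unit_normal I n q v \<and> real (card (big_coords n \<rho> v)) \<le> \<eta> * n})
        \<le> C * exp (- (c * n)) * real (card (row_families I n)))"
proof -
  \<comment> \<open>The gain \<open>exp (- (\<gamma> * n))\<close> is set against four losses of
    \<open>exp (\<gamma> / 8 * n)\<close> each: three from the count of the net, through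
    \<open>a\<close>, \<open>B\<close> and \<open>\<mu>\<close>, and one from the Markov factor
    \<open>exp \<tau>\<close>. The value of \<open>r\<close> solves
    \<open>2 * r\<^sup>2 * n = 2 * \<tau> * 24\<close>, where 24 is the squared scale
    \<open>s\<^sup>2\<close> behind the 48 of \<open>row_avg_exp_sq_le\<close>.\<close>
  define \<gamma> r :: real where "\<gamma> = 1 / 768" and "r = 1 / 16"
  define a M B where "a = \<gamma> * r\<^sup>2 / 32" and "M = 6 * (1 + 1 / sqrt a)" and "B = 1 + 8 * M / \<gamma>"
  define \<mu> where "\<mu> = \<gamma> / (8 * (1 + ln B))"
  have a: "a > 0" by (simp add: a_def \<gamma>_def r_def)
  have M: "M > 0" using a by (auto simp: M_def intro: add_pos_nonneg)
  have B: "B \<ge> 1" "M / B \<le> \<gamma> / 8" using M by (auto simp: B_def \<gamma>_def field_simps)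
  have lnB: "ln B \<ge> 0" using B by simp
  have \<mu>: "\<mu> > 0" "\<mu> \<le> 1" "\<mu> * ln B \<le> \<gamma> / 8"
  proof -
    show "\<mu> > 0" using lnB by (auto simp: \<mu>_def \<gamma>_def)
    have "\<mu> \<le> \<gamma> / 8" using lnB unfolding \<mu>_def \<gamma>_def by (simp add: field_simps)
    then show "\<mu> \<le> 1" by (simp add: \<gamma>_def)
    show "\<mu> * ln B \<le> \<gamma> / 8" using lnB unfolding \<mu>_def \<gamma>_def by (simp add: field_simps)
  qed
  \<comment> \<open>Then \<open>2 * \<rho> / r = \<mu> / 2\<close>: the big coordinates and the
    small ones not rounded to 0 share the support budget \<open>\<mu> * n\<close> equally.\<close>
  define \<rho> where "\<rho> = \<mu> * r / 4"
  have \<rho>: "0 < \<rho>" "\<rho> < r" "\<rho> \<le> 1" using \<mu> by (auto simp: \<rho>_def r_def)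
  have main: "real (card {q \<in> row_families I n. \<exists>v. unit_normal I n q v \<and> real (card (big_coords n \<rho> v)) \<le> \<mu> / 2 * n})
        \<le> exp \<gamma> * exp (- (\<gamma> / 2 * n)) * real (card (row_families I n))"
    if n: "even n" "0 < n" and I: "finite I" "card I = n - 1" for n and I :: "'i set"
  proof -
    let ?B = "{q \<in> row_families I n. \<exists>v. unit_normal I n q v \<and> real (card (big_coords n \<rho> v)) \<le> \<mu> / 2 * n}"
    define \<delta> where "\<delta> = r / sqrt n"
    define W where "W = 4 * real n / r\<^sup>2"
    define \<tau> where "\<tau> = \<gamma> / 8 * real n"
    let ?S = "{z \<in> int_vecs n. (\<Sum>i<n. (of_int (z i))\<^sup>2) \<le> W \<and> real (card {i. i < n \<and> z i \<noteq> 0}) \<le> \<mu> * n}"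
    define Z where "Z = {z \<in> ?S. 1 / 4 \<le> (\<Sum>k<n. (\<delta> * of_int (z k))\<^sup>2) \<and> (\<Sum>k<n. (\<delta> * of_int (z k))\<^sup>2) \<le> 4}"
    have finS: "finite ?S"
      by (rule finite_subset[OF _ finite_int_vecs_near[of n "\<lambda>_. 0" W]]) auto
    have ex: "\<exists>z\<in>Z. (\<Sum>i\<in>I. (dotp n (q i) (\<lambda>k. \<delta> * of_int (z k)))\<^sup>2) \<le> 2 * \<tau> * (sqrt 24)\<^sup>2"
      if qB: "q \<in> ?B" for q
    proof -
      from qB obtain v where q: "q \<in> row_families I n" and v: "unit_normal I n q v"
        "real (card (big_coords n \<rho> v)) \<le> \<mu> / 2 * n" by auto
      have cI: "card I \<le> n" using I by simp
      obtain z where z: "z \<in> int_vecs n" "1 / 4 \<le> (\<Sum>k<n. (\<delta> * of_int (z k))\<^sup>2)" "(\<Sum>k<n. (\<delta> * of_int (z k))\<^sup>2) \<le> 4"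
        "real (card {k. k < n \<and> z k \<noteq> 0}) \<le> real (card (big_coords n \<rho> v)) + 2 * \<rho> / r * n"
        "(\<Sum>i\<in>I. (dotp n (q i) (\<lambda>k. \<delta> * of_int (z k)))\<^sup>2) \<le> 2 * r\<^sup>2 * n"
        using sparse_rounding[OF n(2) I(1) cI q v(1), of r \<rho>] \<rho> unfolding \<delta>_def
        by (auto simp: r_def)
      have "2 * \<rho> / r * n = \<mu> / 2 * n" by (simp add: \<rho>_def r_def)
      then have "real (card {k. k < n \<and> z k \<noteq> 0}) \<le> \<mu> * n" using z(4) v(2) by linarith
      moreover have "(\<Sum>i<n. (of_int (z i))\<^sup>2) \<le> W"
      proof -
        have "(\<Sum>k<n. (\<delta> * of_int (z k))\<^sup>2) = r\<^sup>2 / n * (\<Sum>i<n. (of_int (z i))\<^sup>2)"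
          unfolding sum_distrib_left by (intro sum.cong) (auto simp: power_mult_distrib \<delta>_def power_divide)
        then have "(\<Sum>i<n. (of_int (z i))\<^sup>2) * r\<^sup>2 = real n * (\<Sum>k<n. (\<delta> * of_int (z k))\<^sup>2)"
          using n by simp
        also have "\<dots> \<le> real n * 4" using z(3) by (rule mult_left_mono) simp
        finally show ?thesis by (simp add: W_def r_def pos_le_divide_eq mult.commute)
      qed
      ultimately have "z \<in> Z" using z by (simp add: Z_def)
      moreover have "2 * r\<^sup>2 * n = 2 * \<tau> * (sqrt 24)\<^sup>2" by (simp add: \<tau>_def r_def \<gamma>_def power_divide)
      ultimately show ?thesis using z(5) by (metis (no_types, lifting))
    qed
    have "real (card ?B) \<le> real (card Z) * (exp \<tau> * (1 - \<gamma>) ^ card I) * real (card (row_families I n))"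
    proof (rule card_union_bound[OF n(1) I(1), where s = "sqrt 24" and X = "\<lambda>z k. \<delta> * of_int (z k)"])
      show "finite Z" by (rule finite_subset[OF _ finS]) (auto simp: Z_def)
      fix z assume "z \<in> Z"
      then show "row_avg n (\<lambda>y. exp (- (y\<^sup>2 / (2 * (sqrt 24)\<^sup>2)))) (\<lambda>k. \<delta> * of_int (z k)) \<le> 1 - \<gamma>"
        using row_avg_exp_sq_le[OF n(1), of "\<lambda>k. \<delta> * of_int (z k)"] by (simp add: Z_def \<gamma>_def)
    qed (use ex in \<open>auto simp: \<gamma>_def\<close>)
    also have "real (card Z) * (exp \<tau> * (1 - \<gamma>) ^ card I) \<le>
       (exp (\<gamma> / 8 * n) * exp (\<gamma> / 8 * n) * exp (\<gamma> / 8 * n)) * (exp (\<gamma> / 8 * n) * exp (\<gamma> - \<gamma> * n))"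
    proof (rule mult_mono)
      have "real (card Z) \<le> real (card ?S)"
        using finS by (intro of_nat_mono card_mono) (auto simp: Z_def)
      also have "\<dots> \<le> exp (a * W) * B powr (\<mu> * n) * (1 + M / B) ^ n"
        unfolding M_def by (rule card_sparse_int_vecs[OF a B(1)])
      also have "\<dots> \<le> exp (\<gamma> / 8 * n) * exp (\<gamma> / 8 * n) * exp (\<gamma> / 8 * n)"
      proof (intro mult_mono)
        show "exp (a * W) \<le> exp (\<gamma> / 8 * n)" by (simp add: a_def W_def r_def)
        have "\<mu> * ln B * n \<le> \<gamma> / 8 * n" using \<mu>(3) by (intro mult_right_mono) auto
        then show "B powr (\<mu> * n) \<le> exp (\<gamma> / 8 * n)" using B by (simp add: powr_def mult_ac)
        have "(1 + M / B) ^ n \<le> exp (\<gamma> / 8) ^ n"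
        proof (rule power_mono)
          have "1 + M / B \<le> 1 + \<gamma> / 8" using B by simp
          also have "\<dots> \<le> exp (\<gamma> / 8)" by (rule exp_ge_add_one_self)
          finally show "1 + M / B \<le> exp (\<gamma> / 8)" .
        qed (use M B in auto)
        then show "(1 + M / B) ^ n \<le> exp (\<gamma> / 8 * n)" by (simp add: exp_of_nat_mult[symmetric] mult.commute)
      qed (use M B in auto)
      finally show "real (card Z) \<le> exp (\<gamma> / 8 * n) * exp (\<gamma> / 8 * n) * exp (\<gamma> / 8 * n)" .
      show "exp \<tau> * (1 - \<gamma>) ^ card I \<le> exp (\<gamma> / 8 * n) * exp (\<gamma> - \<gamma> * n)"
        unfolding I(2) \<tau>_def using one_minus_power_le[of \<gamma> n] n by (intro mult_left_mono) (auto simp: \<gamma>_def)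
    qed (auto simp: \<gamma>_def)
    also have "\<dots> = exp \<gamma> * exp (- (\<gamma> / 2 * n))"
      unfolding exp_add[symmetric] by (rule arg_cong[where f = exp]) (simp add: algebra_simps)
    finally show ?thesis by (simp add: mult_right_mono)
  qed
  show ?thesis
    by (rule exI[of _ "\<mu> / 2"], rule exI[of _ \<rho>], rule exI[of _ "exp \<gamma>"], rule exI[of _ "\<gamma> / 2"])
       (use \<mu> \<rho> main in \<open>auto simp: \<gamma>_def\<close>)
qed

section \<open>Normal vectors with lattice structure at a given scale\<close>

definition spread_coords :: "nat \<Rightarrow> real \<Rightarrow> real \<Rightarrow> (nat \<Rightarrow> real) \<Rightarrow> nat set" where
  "spread_coords n \<rho> K v = {i. i < n \<and> \<rho> / sqrt n \<le> \<bar>v i\<bar> \<and> \<bar>v i\<bar> \<le> K / sqrt n}"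

text \<open>Chebyshev: a unit vector has at most \<open>n / K\<^sup>2\<close> coordinates beyond
  \<open>K / sqrt n\<close>, which is at most half of the big ones guaranteed.\<close>

lemma card_spread_coords:
  assumes v: "(\<Sum>k<n. (v k)\<^sup>2) = 1" and big: "\<eta> * n \<le> real (card (big_coords n \<rho> v))"
    and K: "0 < K" "2 / K\<^sup>2 \<le> \<eta>"
  shows "\<eta> / 2 * n \<le> real (card (spread_coords n \<rho> K v))"
proof (cases "n = 0")
  case True
  then show ?thesis by simp
next
  case False
  let ?H = "{i. i < n \<and> K / sqrt n < \<bar>v i\<bar>}"
  have "real (card ?H) * (K\<^sup>2 / n) = (\<Sum>i\<in>?H. K\<^sup>2 / n)" by simp
  also have "\<dots> \<le> (\<Sum>i\<in>?H. (v i)\<^sup>2)"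
  proof (rule sum_mono)
    fix i assume "i \<in> ?H"
    then have "(K / sqrt n)\<^sup>2 \<le> \<bar>v i\<bar>\<^sup>2" using K by (intro power_mono) auto
    then show "K\<^sup>2 / n \<le> (v i)\<^sup>2" by (simp add: power_divide)
  qed
  also have "\<dots> \<le> (\<Sum>i<n. (v i)\<^sup>2)" by (intro sum_mono2) auto
  finally have "real (card ?H) * K\<^sup>2 \<le> n" using v False by (simp add: field_simps)
  then have "real (card ?H) \<le> n / K\<^sup>2" using K by (simp add: pos_le_divide_eq)
  also have "\<dots> \<le> \<eta> / 2 * n"
    using mult_right_mono[OF K(2), of "real n"] by (simp add: field_simps)
  finally have H: "real (card ?H) \<le> \<eta> / 2 * n" .
  have "card (big_coords n \<rho> v) \<le> card (spread_coords n \<rho> K v \<union> ?H)"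
    by (intro card_mono) (auto simp: big_coords_def spread_coords_def)
  also have "\<dots> \<le> card (spread_coords n \<rho> K v) + card ?H" by (rule card_Un_le)
  finally have "real (card (big_coords n \<rho> v)) \<le> real (card (spread_coords n \<rho> K v)) + real (card ?H)" by linarith
  then show ?thesis using H big by (simp add: field_simps)
qed

lemma spread_coords_perturb:
  assumes "n > 0" "\<And>k. k < n \<Longrightarrow> \<bar>v k - w k\<bar> \<le> \<delta>" "\<delta> \<le> \<rho> / 2 / sqrt n" "\<rho> \<le> 1"
  shows "card (spread_coords n \<rho> K v) \<le> card (spread_coords n (\<rho> / 2) (K + 1) w)"
proof (rule card_mono)
  show "finite (spread_coords n (\<rho> / 2) (K + 1) w)" by (simp add: spread_coords_def)
  show "spread_coords n \<rho> K v \<subseteq> spread_coords n (\<rho> / 2) (K + 1) w"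
  proof
    fix i assume i: "i \<in> spread_coords n \<rho> K v"
    then have "i < n" "\<rho> / sqrt n \<le> \<bar>v i\<bar>" "\<bar>v i\<bar> \<le> K / sqrt n" by (auto simp: spread_coords_def)
    moreover have "\<bar>v i - w i\<bar> \<le> \<rho> / 2 / sqrt n" using assms(2)[OF \<open>i < n\<close>] assms(3) by linarith
    moreover have "\<rho> / sqrt n = \<rho> / 2 / sqrt n + \<rho> / 2 / sqrt n" by (simp add: field_simps)
    moreover have "\<rho> / 2 / sqrt n \<le> 1 / sqrt n" using assms(4) by (intro divide_right_mono) auto
    moreover have "(K + 1) / sqrt n = K / sqrt n + 1 / sqrt n" by (simp add: add_divide_distrib)
    ultimately have "\<rho> / 2 / sqrt n \<le> \<bar>w i\<bar>" "\<bar>w i\<bar> \<le> (K + 1) / sqrt n" "i < n" by linarith+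
    then show "i \<in> spread_coords n (\<rho> / 2) (K + 1) w" by (simp add: spread_coords_def)
  qed
qed

text \<open>Here \<open>x * sqrt n\<close> is the first scale at which \<open>v\<close> comes near
  the lattice, up to a window of width \<open>\<kappa> * sqrt n\<close>. The threshold for
  \<open>v\<close> is \<open>4 * \<kappa>\<^sup>2 * n\<close> so that the rounded \<open>w\<close>
  still keeps distance \<open>\<kappa>\<^sup>2 * n\<close> at smaller scales:
  \<open>pidist_sq_le\<close> loses a factor 2 and an additive error of
  \<open>2 * \<kappa>\<^sup>2 * n\<close>. Thus \<open>avg\<close> applies to \<open>w\<close>,
  while closeness to the lattice at the scale itself keeps the net small.\<close>

lemma level_normals_rare:
  fixes I :: "'i set"
  assumes n: "even n" "0 < n" and I: "finite I" "card I = n - 1"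
    and pos: "0 < \<kappa>" "0 < \<rho>" "\<rho> \<le> 1" "0 < K" "\<kappa> * (K + 1) \<le> \<rho> / 2" "1 / (K + 1) \<le> x"
    and p: "0 \<le> p"
    and avg: "\<And>w. \<eta> * n \<le> real (card (spread_coords n (\<rho> / 2) (K + 1) w)) \<Longrightarrow>
      (\<And>u. sqrt n / (K + 1) \<le> u \<Longrightarrow> u < x * sqrt n \<Longrightarrow> \<kappa>\<^sup>2 * n \<le> (\<Sum>i<n. (pidist (u * w i))\<^sup>2)) \<Longrightarrow>
      row_avg n (\<lambda>y. exp (- (y\<^sup>2 / (2 * (\<kappa> / x)\<^sup>2)))) w \<le> p"
  shows "real (card {q \<in> row_families I n. \<exists>v. unit_normal I n q v \<and>
      \<eta> * n \<le> real (card (spread_coords n \<rho> K v)) \<and>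
      (\<forall>u. sqrt n / (K + 1) \<le> u \<longrightarrow> u < x * sqrt n \<longrightarrow> 4 * \<kappa>\<^sup>2 * n \<le> (\<Sum>i<n. (pidist (u * v i))\<^sup>2)) \<and>
      (\<exists>t. x * sqrt n \<le> t \<and> t \<le> (x + \<kappa>) * sqrt n \<and> (\<Sum>i<n. (pidist (t * v i))\<^sup>2) \<le> 4 * \<kappa>\<^sup>2 * n)})
    \<le> (exp 3 * (6 * (K + 2) * x)) ^ n * (exp 22 * 12) ^ n * (exp (n / 2) * p ^ (n - 1))
        * real (card (row_families I n))"
    (is "real (card ?B) \<le> _")
proof -
  have "0 < 1 / (K + 1)" using pos(4) by simp
  then have x: "x > 0" using pos(6) by linarith
  have xK: "1 \<le> x * (K + 1)" using pos by (simp add: field_simps)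
  define D where "D = x * sqrt n"
  have D: "D > 0" using x n by (simp add: D_def)
  have D2: "D\<^sup>2 = x\<^sup>2 * n" by (simp add: D_def power_mult_distrib)
  \<comment> \<open>With this mesh the rounding error, magnified by \<open>D\<close>, is at most
    \<open>\<kappa>\<close> per coordinate, comparable to the allowed distance from the
    lattice.\<close>
  define \<delta> where "\<delta> = \<kappa> / D"
  have \<delta>: "\<delta> > 0" using pos D by (simp add: \<delta>_def)
  have D\<delta>: "D * \<delta> = \<kappa>" using D by (simp add: \<delta>_def)
  have D\<delta>2: "D\<^sup>2 * \<delta>\<^sup>2 = \<kappa>\<^sup>2" by (simp add: D\<delta>[symmetric] power_mult_distrib)
  have \<kappa>x: "\<kappa> \<le> x"
  proof -
    have "\<kappa> * (K + 1) \<le> x * (K + 1)" using pos(3,5) xK by linarith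
    then show ?thesis using pos by simp
  qed
  have \<delta>\<rho>: "\<delta> \<le> \<rho> / 2 / sqrt n"
  proof -
    have "\<kappa> / x \<le> \<kappa> * (K + 1)"
      using xK x pos mult_left_mono[of 1 "x * (K + 1)" \<kappa>] by (simp add: pos_divide_le_eq mult_ac)
    then have "\<kappa> / x \<le> \<rho> / 2" using pos by linarith
    then have "\<kappa> / x / sqrt n \<le> \<rho> / 2 / sqrt n" by (intro divide_right_mono) auto
    then show ?thesis by (simp add: \<delta>_def D_def)
  qed
  \<comment> \<open>Moving from \<open>t\<close> to \<open>D\<close> leaves squared distance at most
    \<open>(8 + 2) * \<kappa>\<^sup>2 * n\<close> between \<open>D * v\<close> and
    \<open>pi * y\<close>. Hence \<open>pi\<^sup>2\<close> times the squared norm of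
    \<open>y\<close> is at most \<open>2 * D\<^sup>2 + 20 * \<kappa>\<^sup>2 * n \<le> 22 *
    D\<^sup>2\<close>, and \<open>pi\<^sup>2 \<ge> 9\<close> gives the 3. Adding the rounding error
    and dividing by \<open>\<kappa>\<^sup>2\<close> gives \<open>2 * n + 20 * n\<close> for
    \<open>N\<close>.\<close>
  define Y where "Y = {y \<in> int_vecs n. (\<Sum>i<n. (of_int (y i) - 0)\<^sup>2) \<le> 3 * D\<^sup>2}"
  define N where "N y = {z \<in> int_vecs n. (\<Sum>i<n. (of_int (z i) - pi * of_int (y i) / \<kappa>)\<^sup>2) \<le> 22 * real n}"
    for y :: "nat \<Rightarrow> int"
  \<comment> \<open>Lattice points without the small ball bound are discarded from the net;
    roundings of the vectors under consideration survive by \<open>avg\<close>.\<close>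
  define Z where "Z = {z \<in> (\<Union>y\<in>Y. N y). row_avg n (\<lambda>y. exp (- (y\<^sup>2 / (2 * (\<kappa> / x)\<^sup>2)))) (\<lambda>k. \<delta> * of_int (z k)) \<le> p}"
  have finY: "finite Y" unfolding Y_def by (rule finite_int_vecs_near)
  have finN: "finite (N y)" for y unfolding N_def by (rule finite_int_vecs_near)
  have ex: "\<exists>z\<in>Z. (\<Sum>i\<in>I. (dotp n (q i) (\<lambda>k. \<delta> * of_int (z k)))\<^sup>2) \<le> 2 * (n / 2) * (\<kappa> / x)\<^sup>2"
    if qB: "q \<in> ?B" for q
  proof -
    from qB obtain v t where q: "q \<in> row_families I n" and v: "unit_normal I n q v"
      and spr: "\<eta> * n \<le> real (card (spread_coords n \<rho> K v))"
      and good: "\<And>u. sqrt n / (K + 1) \<le> u \<Longrightarrow> u < x * sqrt n \<Longrightarrow> 4 * \<kappa>\<^sup>2 * n \<le> (\<Sum>i<n. (pidist (u * v i))\<^sup>2)"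
      and t: "x * sqrt n \<le> t" "t \<le> (x + \<kappa>) * sqrt n" "(\<Sum>i<n. (pidist (t * v i))\<^sup>2) \<le> 4 * \<kappa>\<^sup>2 * n"
      by auto
    have v1: "(\<Sum>k<n. (v k)\<^sup>2) = 1" using v by (simp add: unit_normal_def)
    have cI: "card I \<le> n" using I by simp
    obtain z where z: "z \<in> int_vecs n" "\<And>k. k < n \<Longrightarrow> \<bar>v k - \<delta> * of_int (z k)\<bar> \<le> \<delta>"
      "(\<Sum>i\<in>I. (dotp n (q i) (\<lambda>k. \<delta> * of_int (z k)))\<^sup>2) \<le> \<delta>\<^sup>2 * (real n)\<^sup>2"
      using exists_rounding_rows[OF I(1) cI q, where v = v and \<delta> = \<delta> and g = "\<lambda>_ _. 0" and e = "\<lambda>_. 0"] v \<delta>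
      unfolding unit_normal_def by auto
    define w where "w = (\<lambda>k. \<delta> * of_int (z k) :: real)"
    have vw: "(\<Sum>k<n. (v k - w k)\<^sup>2) \<le> \<delta>\<^sup>2 * n"
    proof -
      have "(\<Sum>k<n. (v k - w k)\<^sup>2) \<le> (\<Sum>k<n. \<delta>\<^sup>2)"
      proof (rule sum_mono)
        fix k assume "k \<in> {..<n}"
        then show "(v k - w k)\<^sup>2 \<le> \<delta>\<^sup>2" using power_mono[OF z(2)[of k], of 2] by (simp add: w_def)
      qed
      then show ?thesis by (simp add: mult.commute)
    qed
    have Dvw: "D\<^sup>2 * (\<Sum>k<n. (v k - w k)\<^sup>2) \<le> \<kappa>\<^sup>2 * n"
      using mult_left_mono[OF vw, of "D\<^sup>2"] D\<delta>2 by (simp add: mult.assoc[symmetric])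
    have "row_avg n (\<lambda>y. exp (- (y\<^sup>2 / (2 * (\<kappa> / x)\<^sup>2)))) w \<le> p"
    proof (rule avg)
      have "card (spread_coords n \<rho> K v) \<le> card (spread_coords n (\<rho> / 2) (K + 1) w)"
        using z(2) by (intro spread_coords_perturb[OF n(2) _ \<delta>\<rho> pos(3)]) (simp add: w_def)
      then show "\<eta> * n \<le> real (card (spread_coords n (\<rho> / 2) (K + 1) w))" using spr by linarith
    next
      fix u assume u: "sqrt n / (K + 1) \<le> u" "u < x * sqrt n"
      have "0 \<le> sqrt n / (K + 1)" using pos(4) by simp
      then have u0: "0 \<le> u" using u(1) by linarith
      have "u\<^sup>2 \<le> D\<^sup>2" using u u0 by (intro power_mono) (auto simp: D_def)
      then have "u\<^sup>2 * (\<Sum>k<n. (v k - w k)\<^sup>2) \<le> D\<^sup>2 * (\<Sum>k<n. (v k - w k)\<^sup>2)"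
        by (intro mult_right_mono sum_nonneg) auto
      also note Dvw
      finally have uvw: "u\<^sup>2 * (\<Sum>k<n. (v k - w k)\<^sup>2) \<le> \<kappa>\<^sup>2 * n" .
      have "4 * \<kappa>\<^sup>2 * n \<le> (\<Sum>i<n. (pidist (u * v i))\<^sup>2)" by (rule good[OF u])
      also have "\<dots> \<le> (\<Sum>i<n. 2 * (pidist (u * w i))\<^sup>2 + 2 * (u * v i - u * w i)\<^sup>2)"
        by (intro sum_mono pidist_sq_le)
      also have "\<dots> = 2 * (\<Sum>i<n. (pidist (u * w i))\<^sup>2) + 2 * (u\<^sup>2 * (\<Sum>i<n. (v i - w i)\<^sup>2))"
        by (simp add: sum.distrib sum_distrib_left[symmetric] right_diff_distrib[symmetric] power_mult_distrib)
      finally show "\<kappa>\<^sup>2 * n \<le> (\<Sum>i<n. (pidist (u * w i))\<^sup>2)" using uvw by linarith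
    qed
    moreover have "z \<in> (\<Union>y\<in>Y. N y)"
    proof
      define y where "y = restrict (\<lambda>i. round (D * v i / pi)) {..<n}"
      have yp: "(D * v i - pi * of_int (y i))\<^sup>2 = (pidist (D * v i))\<^sup>2" if "i < n" for i
        using that by (simp add: y_def pidist_def)
      have "(\<Sum>i<n. (pidist (D * v i))\<^sup>2) \<le> (\<Sum>i<n. 2 * (pidist (t * v i))\<^sup>2 + 2 * (D * v i - t * v i)\<^sup>2)"
        by (intro sum_mono pidist_sq_le)
      also have "\<dots> = 2 * (\<Sum>i<n. (pidist (t * v i))\<^sup>2) + 2 * (D - t)\<^sup>2 * (\<Sum>i<n. (v i)\<^sup>2)"
        by (simp add: sum.distrib sum_distrib_left[symmetric] left_diff_distrib[symmetric] power_mult_distrib)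
      also have "\<dots> \<le> 2 * (4 * \<kappa>\<^sup>2 * n) + 2 * (\<kappa>\<^sup>2 * n)"
      proof -
        have "\<bar>D - t\<bar> \<le> \<kappa> * sqrt n" using t by (simp add: D_def algebra_simps)
        from power_mono[OF this, of 2] have "(D - t)\<^sup>2 \<le> \<kappa>\<^sup>2 * n" by (simp add: power_mult_distrib)
        then show ?thesis using t(3) unfolding v1 by linarith
      qed
      finally have pd: "(\<Sum>i<n. (pidist (D * v i))\<^sup>2) \<le> 10 * \<kappa>\<^sup>2 * n" by (simp add: mult_ac)
      have sq: "(a + b)\<^sup>2 \<le> 2 * a\<^sup>2 + 2 * b\<^sup>2" for a b :: real
        using zero_le_power2[of "a - b"] by (simp add: power2_sum power2_diff)
      show "y \<in> Y"
      proof -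
        have "pi\<^sup>2 * (\<Sum>i<n. (of_int (y i))\<^sup>2) = (\<Sum>i<n. (D * v i + (pi * of_int (y i) - D * v i))\<^sup>2)"
          by (simp add: sum_distrib_left power_mult_distrib)
        also have "\<dots> \<le> (\<Sum>i<n. 2 * (D * v i)\<^sup>2 + 2 * (pi * of_int (y i) - D * v i)\<^sup>2)"
          by (intro sum_mono sq)
        also have "\<dots> = 2 * D\<^sup>2 * (\<Sum>i<n. (v i)\<^sup>2) + 2 * (\<Sum>i<n. (pidist (D * v i))\<^sup>2)"
          by (simp add: sum.distrib sum_distrib_left[symmetric] power_mult_distrib power2_commute yp)
        also have "\<dots> \<le> 2 * D\<^sup>2 + 20 * (\<kappa>\<^sup>2 * n)" using pd unfolding v1 by linarith
        also have "\<kappa>\<^sup>2 * n \<le> D\<^sup>2" unfolding D2 using \<kappa>x pos by (intro mult_right_mono power_mono) auto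
        finally have "pi\<^sup>2 * (\<Sum>i<n. (of_int (y i))\<^sup>2) \<le> 22 * D\<^sup>2" by simp
        moreover have "9 * (\<Sum>i<n. (of_int (y i))\<^sup>2) \<le> pi\<^sup>2 * (\<Sum>i<n. (of_int (y i) :: real)\<^sup>2)"
          using power_mono[of 3 pi 2] pi_gt3 by (intro mult_right_mono sum_nonneg) auto
        ultimately have "(\<Sum>i<n. (of_int (y i) :: real)\<^sup>2) \<le> 3 * D\<^sup>2"
          using zero_le_power2[of D] by linarith
        then show ?thesis by (auto simp: Y_def y_def int_vecs_def)
      qed
      show "z \<in> N y"
      proof -
        have "(\<Sum>i<n. (of_int (z i) - pi * of_int (y i) / \<kappa>)\<^sup>2) * \<kappa>\<^sup>2 =
          (\<Sum>i<n. (D * (w i - v i) + (D * v i - pi * of_int (y i)))\<^sup>2)"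
          unfolding sum_distrib_right
        proof (rule sum.cong[OF refl])
          fix i assume "i \<in> {..<n}"
          have "D * w i = \<kappa> * of_int (z i)" by (simp add: w_def D\<delta>[symmetric] mult.assoc)
          then have "D * (w i - v i) + (D * v i - pi * of_int (y i)) = (of_int (z i) - pi * of_int (y i) / \<kappa>) * \<kappa>"
            using pos(1) by (simp add: field_simps)
          then show "(of_int (z i) - pi * of_int (y i) / \<kappa>)\<^sup>2 * \<kappa>\<^sup>2 = (D * (w i - v i) + (D * v i - pi * of_int (y i)))\<^sup>2"
            by (simp add: power_mult_distrib)
        qed
        also have "\<dots> \<le> (\<Sum>i<n. 2 * (D * (w i - v i))\<^sup>2 + 2 * (D * v i - pi * of_int (y i))\<^sup>2)"
          by (intro sum_mono sq)
        also have "\<dots> = 2 * (D\<^sup>2 * (\<Sum>i<n. (v i - w i)\<^sup>2)) + 2 * (\<Sum>i<n. (pidist (D * v i))\<^sup>2)"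
          by (simp add: sum.distrib sum_distrib_left[symmetric] power_mult_distrib power2_commute yp)
        also have "\<dots> \<le> 22 * n * \<kappa>\<^sup>2" using Dvw pd by (simp add: mult_ac)
        finally have "(\<Sum>i<n. (of_int (z i) - pi * of_int (y i) / \<kappa>)\<^sup>2) \<le> 22 * real n"
          using pos(1) by simp
        then show ?thesis using z(1) by (simp add: N_def)
      qed
    qed
    \<comment> \<open>At scale \<open>\<kappa> / x\<close> the Hilbert--Schmidt error corresponds to
      \<open>\<tau> = n / 2\<close>, a Markov loss that is a constant per coordinate.\<close>
    moreover have "\<delta>\<^sup>2 * (real n)\<^sup>2 = 2 * (n / 2) * (\<kappa> / x)\<^sup>2"
      using n x by (simp add: \<delta>_def D2 power_divide power2_eq_square[of "real n"])
    ultimately show ?thesis using z(3) unfolding w_def by (intro bexI[of _ z]) (auto simp: Z_def)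
  qed
  have "real (card ?B) \<le> real (card Z) * (exp (n / 2) * p ^ card I) * real (card (row_families I n))"
  proof (rule card_union_bound[OF n(1) I(1), where s = "\<kappa> / x" and X = "\<lambda>z k. \<delta> * of_int (z k)"])
    show "finite Z" using finY finN by (simp add: Z_def)
    show "\<And>q. q \<in> ?B \<Longrightarrow> \<exists>z\<in>Z. (\<Sum>i\<in>I. (dotp n (q i) (\<lambda>k. \<delta> * of_int (z k)))\<^sup>2) \<le> 2 * (n / 2) * (\<kappa> / x)\<^sup>2"
      by (rule ex)
  qed (use p x pos in \<open>auto simp: Z_def\<close>)
  also have "real (card Z) * (exp (n / 2) * p ^ card I) \<le>
      ((exp 3 * (6 * (K + 2) * x)) ^ n * (exp 22 * 12) ^ n) * (exp (n / 2) * p ^ (n - 1))"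
    unfolding I(2)
  proof (rule mult_right_mono)
    have "card Z \<le> card (\<Union>y\<in>Y. N y)"
      using finY finN by (intro card_mono) (auto simp: Z_def)
    also have "\<dots> \<le> (\<Sum>y\<in>Y. card (N y))" by (rule card_UN_le[OF finY])
    finally have "real (card Z) \<le> (\<Sum>y\<in>Y. real (card (N y)))"
      using of_nat_mono[of "card Z"] by fastforce
    also have "\<dots> \<le> (\<Sum>y\<in>Y. (exp 22 * 12) ^ n)"
    proof (rule sum_mono)
      fix y
      have "real (card (N y)) \<le> exp (1 * (22 * real n)) * (6 * (1 + 1 / sqrt 1)) ^ n"
        unfolding N_def by (rule card_int_vecs_near) simp
      also have "\<dots> = (exp 22 * 12) ^ n" by (simp add: power_mult_distrib exp_of_nat_mult[symmetric] mult.commute)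
      finally show "real (card (N y)) \<le> (exp 22 * 12) ^ n" .
    qed
    also have "\<dots> = real (card Y) * (exp 22 * 12) ^ n" by simp
    also have "\<dots> \<le> (exp 3 * (6 * (K + 2) * x)) ^ n * (exp 22 * 12) ^ n"
    proof (rule mult_right_mono)
      have "real (card Y) \<le> exp (1 / x\<^sup>2 * (3 * D\<^sup>2)) * (6 * (1 + 1 / sqrt (1 / x\<^sup>2))) ^ n"
        unfolding Y_def using x by (intro card_int_vecs_near) simp
      also have "1 / x\<^sup>2 * (3 * D\<^sup>2) = real n * 3" using x by (simp add: D2)
      also have "1 / sqrt (1 / x\<^sup>2) = x" using x by (simp add: real_sqrt_divide)
      \<comment> \<open>Since \<open>x \<ge> 1 / (K + 1)\<close>, the sum \<open>1 + x\<close> is at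
        most \<open>(K + 2) * x\<close>; the count becomes proportional to \<open>x ^ n\<close> at
        every level.\<close>
      also have "exp (real n * 3) * (6 * (1 + x)) ^ n \<le> exp (real n * 3) * (6 * (K + 2) * x) ^ n"
        using xK x by (intro mult_left_mono power_mono) (auto simp: algebra_simps)
      also have "\<dots> = (exp 3 * (6 * (K + 2) * x)) ^ n"
        by (simp only: exp_of_nat_mult power_mult_distrib)
      finally show "real (card Y) \<le> (exp 3 * (6 * (K + 2) * x)) ^ n" .
    qed simp
    finally show "real (card Z) \<le> (exp 3 * (6 * (K + 2) * x)) ^ n * (exp 22 * 12) ^ n" .
  qed (use p in simp)
  finally show ?thesis by (simp add: mult_right_mono)
qed

section \<open>Choice of constants and union over the scales\<close>

lemma linear_times_exp_le:
  fixes h y :: real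
  assumes "h > 0" "y \<ge> 0"
  shows "y * exp (- (h * y)) \<le> 2 / h * exp (- (h / 2 * y))"
proof -
  have "h / 2 * y \<le> exp (h / 2 * y)" using exp_ge_add_one_self[of "h / 2 * y"] by linarith
  then have "y \<le> 2 / h * exp (h / 2 * y)" using assms by (simp add: field_simps)
  then have "y * exp (- (h * y)) \<le> 2 / h * exp (h / 2 * y) * exp (- (h * y))"
    by (intro mult_right_mono) auto
  also have "\<dots> = 2 / h * exp (- (h / 2 * y))"
    by (simp add: exp_add[symmetric] mult.assoc)
  finally show ?thesis .
qed

text \<open>Collects the errors of \<open>row_avg_gauss_le\<close>, with \<open>D * s\<close>
  replaced by its lower bound \<open>\<kappa> * sqrt n\<close>. The cap
  \<open>\<gamma>1 \<le> 1 / 2\<close> leaves room for two exponentially growing factors in the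
  union over scales.\<close>

lemma gauss_error_exp_small:
  fixes \<eta> \<kappa> :: real
  assumes "\<eta> > 0" "\<kappa> > 0"
  shows "\<exists>K1 \<gamma>1 :: real. 0 < K1 \<and> 0 < \<gamma>1 \<and> \<gamma>1 \<le> 1 / 2 \<and>
    (\<forall>n::nat. real n * (2 / 3) powr (\<eta> * n / 4) + real n * exp (- (\<kappa>\<^sup>2 * n / 16)) + 2 * exp (- (\<kappa>\<^sup>2 * n / 4))
       \<le> K1 * exp (- (\<gamma>1 * n)))"
proof -
  define h where "h = min (min (\<eta> / 4 * ln (3 / 2)) (\<kappa>\<^sup>2 / 16)) 1"
  have h: "h > 0" "h \<le> 1" "h \<le> \<eta> / 4 * ln (3 / 2)" "h \<le> \<kappa>\<^sup>2 / 16"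
    using assms by (auto simp: h_def)
  have "real n * (2 / 3) powr (\<eta> * n / 4) + real n * exp (- (\<kappa>\<^sup>2 * n / 16)) + 2 * exp (- (\<kappa>\<^sup>2 * n / 4))
       \<le> (4 / h + 2) * exp (- (h / 2 * n))" for n :: nat
  proof -
    have "ln (2 / 3 :: real) = - ln (3 / 2)" by (simp add: ln_div)
    then have "(2 / 3) powr (\<eta> * n / 4) = exp (- (\<eta> / 4 * ln (3 / 2) * n))"
      by (simp add: powr_def)
    also have "\<dots> \<le> exp (- (h * n))" using mult_right_mono[OF h(3), of "real n"] by simp
    finally have "real n * (2 / 3) powr (\<eta> * n / 4) \<le> real n * exp (- (h * n))" by (rule mult_left_mono) simp
    moreover have "exp (- (\<kappa>\<^sup>2 * n / 16)) \<le> exp (- (h * n))"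
      using mult_right_mono[OF h(4), of "real n"] by simp
    then have "real n * exp (- (\<kappa>\<^sup>2 * n / 16)) \<le> real n * exp (- (h * n))" by (rule mult_left_mono) simp
    moreover have "exp (- (\<kappa>\<^sup>2 * n / 4)) \<le> exp (- (h / 2 * n))"
    proof -
      have "h / 2 \<le> \<kappa>\<^sup>2 / 4" using h by (simp; linarith)
      from mult_right_mono[OF this, of "real n"] show ?thesis by simp
    qed
    moreover have "real n * exp (- (h * n)) \<le> 2 / h * exp (- (h / 2 * n))"
      by (rule linear_times_exp_le[OF h(1)]) simp
    ultimately have "real n * (2 / 3) powr (\<eta> * n / 4) + real n * exp (- (\<kappa>\<^sup>2 * n / 16)) + 2 * exp (- (\<kappa>\<^sup>2 * n / 4))
      \<le> 2 / h * exp (- (h / 2 * n)) + 2 / h * exp (- (h / 2 * n)) + 2 * exp (- (h / 2 * n))" by linarith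
    also have "\<dots> = (4 / h + 2) * exp (- (h / 2 * n))" by (simp add: algebra_simps)
    finally show ?thesis .
  qed
  moreover have "4 / h + 2 > 0" using h(1) by (intro add_pos_pos) auto
  ultimately show ?thesis using h by (intro exI[of _ "4 / h + 2"] exI[of _ "h / 2"]) auto
qed

text \<open>Once \<open>s\<close> dominates the errors the bound is linear in \<open>s\<close>, with
  a constant that does not involve \<open>\<kappa>\<close>. This is what allows
  \<open>\<kappa>\<close> to be chosen after it.\<close>

lemma row_avg_gauss_le_linear:
  assumes n: "even n" "n > 0" and spr: "\<eta> * n \<le> real (card (spread_coords n \<rho> K w))"
    and pos: "\<eta> > 0" "\<rho> > 0" "K > 0" "s > 0" "D > 0" "\<kappa> > 0"
    and good: "\<And>u. sqrt n / K \<le> u \<Longrightarrow> u < D \<Longrightarrow> \<kappa>\<^sup>2 * n \<le> (\<Sum>i<n. (pidist (u * w i))\<^sup>2)"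
    and err: "real n * (2 / 3) powr (\<eta> * n / 4) + real n * exp (- (\<kappa>\<^sup>2 * n / 16)) + 2 * exp (- (\<kappa>\<^sup>2 * n / 4)) \<le> s"
    and D: "\<kappa> * sqrt n \<le> D * s"
  shows "row_avg n (\<lambda>y. exp (- ((y - b)\<^sup>2 / (2 * s\<^sup>2)))) w \<le> (1 / sqrt (\<rho>\<^sup>2 * \<eta> / 16) + 1) * s"
proof -
  have "row_avg n (\<lambda>y. exp (- ((y - b)\<^sup>2 / (2 * s\<^sup>2)))) w
     \<le> s / sqrt (\<rho>\<^sup>2 * \<eta> / 16) + real n * (2 / 3) powr (\<eta> * n / 4)
         + real n * exp (- (\<kappa>\<^sup>2 * n / 16)) + 2 * exp (- ((D * s)\<^sup>2 / 4))"
    by (rule row_avg_gauss_le[OF n _ spr _ pos(1-5) good]) (auto simp: spread_coords_def)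
  also have "exp (- ((D * s)\<^sup>2 / 4)) \<le> exp (- (\<kappa>\<^sup>2 * n / 4))"
    using power_mono[OF D, of 2] pos by (simp add: power_mult_distrib)
  finally show ?thesis using err by (simp add: algebra_simps)
qed

text \<open>Net size against small ball probability: the powers of \<open>x\<close> cancel except
  for one, from the missing row.\<close>

lemma level_bound_collapse:
  fixes x Q p :: real
  assumes "n > 0" "x > 0" "0 \<le> Q" "0 \<le> p" "Q * p \<le> exp (- 1)"
  shows "(Q * x) ^ n * (p / x) ^ (n - 1) \<le> Q * x * exp (1 - real n)"
proof -
  obtain m where m: "n = Suc m" using assms(1) gr0_implies_Suc by blast
  have "(Q * x) ^ n * (p / x) ^ (n - 1) = Q * x * ((Q * x) * (p / x)) ^ m"
    by (simp add: m power_mult_distrib power_divide)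
  also have "(Q * x) * (p / x) = Q * p" using assms(2) by simp
  also have "(Q * p) ^ m \<le> exp (- 1) ^ m" using assms by (intro power_mono) auto
  also have "exp (- 1) ^ m = exp (1 - real n)" by (simp add: m exp_of_nat_mult[symmetric])
  finally show ?thesis using assms by (simp add: mult_left_mono)
qed

text \<open>Outside this rare set every unit normal has a linear small ball bound at all scales
  above \<open>exp (- (\<gamma> * n))\<close> and all centres; the scale at which it is applied can
  therefore be chosen later.\<close>

lemma structured_normals_rare:
  "\<exists>(C2 :: real) (\<gamma> :: real) (C :: real) (c :: real) n0. 0 < C2 \<and> 0 < \<gamma> \<and> 0 < C \<and> 0 < c \<and>
    (\<forall>n (I :: 'i set). even n \<longrightarrow> 0 < n \<longrightarrow> n0 \<le> n \<longrightarrow> finite I \<longrightarrow> card I = n - 1 \<longrightarrow>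
      real (card {q \<in> row_families I n. \<exists>v. unit_normal I n q v \<and>
          \<not> (\<forall>s b. exp (- (\<gamma> * n)) \<le> s \<longrightarrow> row_avg n (\<lambda>y. exp (- ((y - b)\<^sup>2 / (2 * s\<^sup>2)))) v \<le> C2 * s)})
        \<le> C * exp (- (c * n)) * real (card (row_families I n)))"
proof -
  obtain \<eta> \<rho> C1 c1 :: real where \<eta>: "0 < \<eta>" "\<eta> \<le> 1" and \<rho>: "0 < \<rho>" "\<rho> \<le> 1" and C1: "0 < C1" "0 < c1" and
    compr: "\<And>n (I :: 'i set). even n \<Longrightarrow> 0 < n \<Longrightarrow> finite I \<Longrightarrow> card I = n - 1 \<Longrightarrow>
      real (card {q \<in> row_families I n. \<exists>v. unit_normal I n q v \<and> real (card (big_coords n \<rho> v)) \<le> \<eta> * n})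
        \<le> C1 * exp (- (c1 * n)) * real (card (row_families I n))"
    using compressible_normals_rare[where 'i = 'i] by blast
  define K where "K = sqrt (2 / \<eta>)"
  have K: "0 < K" "2 / K\<^sup>2 \<le> \<eta>" using \<eta> by (auto simp: K_def)
  define C2 where "C2 = 1 / sqrt ((\<rho> / 2)\<^sup>2 * (\<eta> / 2) / 16) + 1"
  have C2: "C2 > 0" using \<rho> \<eta> by (auto simp: C2_def intro!: add_nonneg_pos)
  \<comment> \<open>Cost per coordinate of the net in \<open>level_normals_rare\<close> together
    with the Markov loss, apart from \<open>x\<close>. It is free of \<open>\<kappa>\<close>, so
    \<open>\<kappa>\<close> can be taken small enough for
    \<open>Q * (C2 * \<kappa>) \<le> exp (- 1)\<close>.\<close>
  define Q where "Q = exp 3 * (6 * (K + 2)) * (exp 22 * 12) * exp (1 / 2 :: real)"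
  have Q: "Q > 0" using K by (simp add: Q_def)
  define \<kappa> where "\<kappa> = min (\<rho> / 2 / (K + 1)) (exp (- 1) / (Q * C2))"
  have \<kappa>: "\<kappa> > 0" using \<rho> K Q C2 by (simp add: \<kappa>_def)
  have \<kappa>K: "\<kappa> * (K + 1) \<le> \<rho> / 2"
  proof -
    have "\<kappa> \<le> \<rho> / 2 / (K + 1)" by (simp add: \<kappa>_def)
    then show ?thesis by (rule iffD1[OF pos_le_divide_eq, rotated]) (use K in simp)
  qed
  have \<kappa>Q: "Q * (C2 * \<kappa>) \<le> exp (- 1)"
  proof -
    have "\<kappa> \<le> exp (- 1) / (Q * C2)" by (simp add: \<kappa>_def)
    then have "\<kappa> * (Q * C2) \<le> exp (- 1)" using Q C2 by (simp add: pos_le_divide_eq)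
    then show ?thesis by (simp add: mult_ac)
  qed
  have \<eta>2: "\<eta> / 2 > 0" using \<eta> by simp
  from gauss_error_exp_small[OF \<eta>2 \<kappa>] obtain K1 \<gamma>1 :: real
    where K1: "0 < K1" "0 < \<gamma>1" "\<gamma>1 \<le> 1 / 2" and
    err': "\<forall>n::nat. real n * (2 / 3) powr (\<eta> / 2 * n / 4) + real n * exp (- (\<kappa>\<^sup>2 * n / 16)) + 2 * exp (- (\<kappa>\<^sup>2 * n / 4))
       \<le> K1 * exp (- (\<gamma>1 * n))"
    by (elim exE conjE)
  note err = err'[rule_format]
  \<comment> \<open>Levels \<open>x\<close> run up to order \<open>exp (\<gamma> * n)\<close>, so
    the scales \<open>\<kappa> / x\<close> stay above order \<open>exp (- (\<gamma> * n))\<close>.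
    The errors are \<open>K1 * exp (- (2 * \<gamma> * n))\<close>; the spare factor absorbs the
    constants gathered in \<open>m\<close> once \<open>n \<ge> n0\<close>.\<close>
  define \<gamma> where "\<gamma> = \<gamma>1 / 2"
  have \<gamma>: "\<gamma> > 0" "\<gamma>1 = 2 * \<gamma>" using K1 by (auto simp: \<gamma>_def)
  \<comment> \<open>Below \<open>x0 * sqrt n\<close> the spread coordinates already control the
    characteristic function, so the scan of scales starts there.\<close>
  define x0 where "x0 = 1 / (K + 1)"
  have x0: "x0 > 0" using K by (simp add: x0_def)
  define m where "m = max K1 (K1 * (x0 + \<kappa>) / \<kappa>)"
  define n0 where "n0 = nat \<lceil>m / \<gamma>\<rceil>"
  have n0: "m \<le> exp (\<gamma> * n)" if "n0 \<le> n" for n :: nat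
  proof -
    have "m / \<gamma> \<le> real n" using that by (simp add: n0_def nat_le_iff ceiling_le_iff)
    then have "m \<le> \<gamma> * n" using \<gamma> by (simp add: pos_divide_le_eq mult.commute)
    also have "\<dots> \<le> exp (\<gamma> * n)" using exp_ge_add_one_self[of "\<gamma> * n"] by linarith
    finally show ?thesis .
  qed
  define C3 where "C3 = 2 * Q * (x0 + \<kappa>) * exp 1"
  have C3: "C3 > 0" using Q x0 \<kappa> by (simp add: C3_def)
  define c where "c = min c1 (1 / 2)"
  have main: "real (card {q \<in> row_families I n. \<exists>v. unit_normal I n q v \<and>
          \<not> (\<forall>s b. exp (- (\<gamma> * n)) \<le> s \<longrightarrow> row_avg n (\<lambda>y. exp (- ((y - b)\<^sup>2 / (2 * s\<^sup>2)))) v \<le> C2 * s)})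
        \<le> (C1 + C3) * exp (- (c * n)) * real (card (row_families I n))" (is "real (card ?B) \<le> _")
    if n: "even n" "0 < n" "n0 \<le> n" and I: "finite I" "card I = n - 1" for n and I :: "'i set"
  proof -
    \<comment> \<open>With \<open>L\<close> windows of width \<open>\<kappa>\<close> the scan
      reaches \<open>x L \<ge> \<kappa> * exp (\<gamma> * n)\<close>, so that
      \<open>D = x L * sqrt n\<close> satisfies \<open>\<kappa> * sqrt n \<le> D * s\<close> for
      every admissible \<open>s\<close>.\<close>
    define L where "L = nat \<lceil>exp (\<gamma> * n)\<rceil>"
    define x where "x l = x0 + \<kappa> * real l" for l :: nat
    have x: "x l > 0" "1 / (K + 1) \<le> x l" "x (Suc l) = x l + \<kappa>" for l
    proof -
      have "0 \<le> \<kappa> * real l" using \<kappa> by simp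
      then show "x l > 0" "1 / (K + 1) \<le> x l" "x (Suc l) = x l + \<kappa>"
        using x0 unfolding x_def x0_def[symmetric] by (linarith, linarith, simp add: algebra_simps)
    qed
    have m1: "K1 \<le> exp (\<gamma> * n)" "K1 * (x0 + \<kappa>) / \<kappa> \<le> exp (\<gamma> * n)"
      using n0[OF n(3)] by (auto simp: m_def)
    have ee: "exp (- (\<gamma>1 * n)) * exp (\<gamma> * n) = exp (- (\<gamma> * n))" "exp (- (\<gamma> * n)) * exp (\<gamma> * n) = 1"
      unfolding \<gamma>(2) by (simp_all add: exp_add[symmetric])
    have e1: "1 \<le> exp (\<gamma> * n)" using \<gamma> by simp
    have Ll: "exp (\<gamma> * n) \<le> real L" unfolding L_def by (rule real_nat_ceiling_ge)
    have Lu: "real L \<le> 2 * exp (\<gamma> * n)"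
      using e1 unfolding L_def by (simp; linarith)
    have xl: "x l \<le> (x0 + \<kappa>) * exp (\<gamma> * n)" if "l < L" for l
    proof -
      have "int l < \<lceil>exp (\<gamma> * n)\<rceil>" using that by (simp add: L_def zless_nat_conj)
      then have "real l \<le> exp (\<gamma> * n)" by linarith
      then have "\<kappa> * real l \<le> \<kappa> * exp (\<gamma> * n)" using \<kappa> by simp
      moreover have "x0 \<le> x0 * exp (\<gamma> * n)" using x0 e1 by simp
      ultimately show ?thesis by (simp add: x_def algebra_simps)
    qed
    have sl: "K1 * exp (- (\<gamma>1 * n)) \<le> \<kappa> / x l" if "l < L" for l
    proof -
      have "K1 * exp (- (\<gamma>1 * n)) * x l \<le> K1 * exp (- (\<gamma>1 * n)) * ((x0 + \<kappa>) * exp (\<gamma> * n))"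
        using xl[OF that] K1 by (intro mult_left_mono) auto
      also have "\<dots> = K1 * (x0 + \<kappa>) * (exp (- (\<gamma>1 * n)) * exp (\<gamma> * n))" by (simp add: mult_ac)
      also have "\<dots> = K1 * (x0 + \<kappa>) * exp (- (\<gamma> * n))" unfolding ee(1) ..
      also have "\<dots> \<le> \<kappa> * exp (\<gamma> * n) * exp (- (\<gamma> * n))"
        using m1(2) \<kappa> by (intro mult_right_mono) (auto simp: pos_divide_le_eq mult_ac)
      also have "\<dots> = \<kappa>" by (simp add: exp_minus)
      finally show ?thesis using x(1)[of l] by (simp add: pos_le_divide_eq)
    qed
    let ?good = "\<lambda>l v. \<forall>u. sqrt n / (K + 1) \<le> u \<longrightarrow> u < x l * sqrt n \<longrightarrow> 4 * \<kappa>\<^sup>2 * n \<le> (\<Sum>i<n. (pidist (u * v i))\<^sup>2)"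
    define A where "A = {q \<in> row_families I n. \<exists>v. unit_normal I n q v \<and> real (card (big_coords n \<rho> v)) \<le> \<eta> * n}"
    define E where "E l = {q \<in> row_families I n. \<exists>v. unit_normal I n q v \<and>
      \<eta> / 2 * n \<le> real (card (spread_coords n \<rho> K v)) \<and> ?good l v \<and>
      (\<exists>t. x l * sqrt n \<le> t \<and> t \<le> (x l + \<kappa>) * sqrt n \<and> (\<Sum>i<n. (pidist (t * v i))\<^sup>2) \<le> 4 * \<kappa>\<^sup>2 * n)}" for l
    have E: "real (card (E l)) \<le> Q * x l * exp (1 - real n) * real (card (row_families I n))" if l: "l < L" for l
    proof -
      have "real (card (E l)) \<le> (exp 3 * (6 * (K + 2) * x l)) ^ n * (exp 22 * 12) ^ n *
          (exp (n / 2) * (C2 * (\<kappa> / x l)) ^ (n - 1)) * real (card (row_families I n))"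
        unfolding E_def
      proof (rule level_normals_rare[OF n(1,2) I \<kappa> \<rho> K(1) \<kappa>K x(2)])
        show "0 \<le> C2 * (\<kappa> / x l)" using C2 \<kappa> x(1)[of l] by simp
        fix w assume w: "\<eta> / 2 * n \<le> real (card (spread_coords n (\<rho> / 2) (K + 1) w))"
          "\<And>u. sqrt n / (K + 1) \<le> u \<Longrightarrow> u < x l * sqrt n \<Longrightarrow> \<kappa>\<^sup>2 * n \<le> (\<Sum>i<n. (pidist (u * w i))\<^sup>2)"
        have "row_avg n (\<lambda>y. exp (- ((y - 0)\<^sup>2 / (2 * (\<kappa> / x l)\<^sup>2)))) w \<le> C2 * (\<kappa> / x l)"
          unfolding C2_def
        proof (rule row_avg_gauss_le_linear[OF n(1,2) w(1) _ _ _ _ _ \<kappa> w(2)])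
          show "real n * (2 / 3) powr (\<eta> / 2 * real n / 4) + real n * exp (- (\<kappa>\<^sup>2 * real n / 16)) +
            2 * exp (- (\<kappa>\<^sup>2 * real n / 4)) \<le> \<kappa> / x l"
            using err[of n] sl[OF l] by linarith
          show "\<kappa> * sqrt n \<le> x l * sqrt n * (\<kappa> / x l)" using x(1)[of l] by simp
        qed (use \<eta> \<rho> K x(1)[of l] \<kappa> n in auto)
        then show "row_avg n (\<lambda>y. exp (- (y\<^sup>2 / (2 * (\<kappa> / x l)\<^sup>2)))) w \<le> C2 * (\<kappa> / x l)" by simp
      qed
      also have "(exp 3 * (6 * (K + 2) * x l)) ^ n * (exp 22 * 12) ^ n *
          (exp (n / 2) * (C2 * (\<kappa> / x l)) ^ (n - 1)) = (Q * x l) ^ n * (C2 * \<kappa> / x l) ^ (n - 1)"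
      proof -
        have "exp (real n / 2) = exp (1 / 2) ^ n" by (simp add: exp_of_nat_mult[symmetric])
        then show ?thesis by (simp add: Q_def power_mult_distrib mult_ac)
      qed
      also have "\<dots> \<le> Q * x l * exp (1 - real n)"
        using \<kappa>Q n x(1)[of l] Q C2 \<kappa> by (intro level_bound_collapse) auto
      finally show ?thesis by (simp add: mult_right_mono)
    qed
    have sub: "?B \<subseteq> A \<union> (\<Union>l<L. E l)"
    proof
      fix q assume "q \<in> ?B"
      then obtain v s b where q: "q \<in> row_families I n" and v: "unit_normal I n q v" and
        s: "exp (- (\<gamma> * n)) \<le> s" "\<not> row_avg n (\<lambda>y. exp (- ((y - b)\<^sup>2 / (2 * s\<^sup>2)))) v \<le> C2 * s" by blast
      show "q \<in> A \<union> (\<Union>l<L. E l)"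
      proof (rule ccontr)
        assume neg: "q \<notin> A \<union> (\<Union>l<L. E l)"
        then have "\<eta> * n \<le> real (card (big_coords n \<rho> v))" using q v by (auto simp: A_def)
        then have spr: "\<eta> / 2 * n \<le> real (card (spread_coords n \<rho> K v))"
          using v K by (intro card_spread_coords) (auto simp: unit_normal_def)
        \<comment> \<open>At level 0 the range of frequencies is empty. A failure in the window
          after level \<open>l\<close> would be the first one and put \<open>q\<close> into
          \<open>E l\<close>.\<close>
        have good: "l \<le> L \<Longrightarrow> ?good l v" for l
        proof (induction l)
          case 0
          then show ?case by (auto simp: x_def x0_def)
        next
          case (Suc l)
          then have IH: "?good l v" and l: "l < L" by auto
          have nE: "q \<notin> E l" using neg l by auto
          show ?case
          proof (intro allI impI)
            fix u assume u: "sqrt n / (K + 1) \<le> u" "u < x (Suc l) * sqrt n"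
            show "4 * \<kappa>\<^sup>2 * n \<le> (\<Sum>i<n. (pidist (u * v i))\<^sup>2)"
            proof (cases "u < x l * sqrt n")
              case True
              then show ?thesis using IH u by blast
            next
              case False
              show ?thesis
              proof (rule ccontr)
                assume "\<not> ?thesis"
                then have "x l * sqrt n \<le> u \<and> u \<le> (x l + \<kappa>) * sqrt n \<and> (\<Sum>i<n. (pidist (u * v i))\<^sup>2) \<le> 4 * \<kappa>\<^sup>2 * n"
                  using False u x(3)[of l] by auto
                then have "q \<in> E l" unfolding E_def using q v spr IH by blast
                then show False using nE by simp
              qed
            qed
          qed
        qed
        have s0: "s > 0" using s(1) by (rule less_le_trans[OF exp_gt_zero])
        have "row_avg n (\<lambda>y. exp (- ((y - b)\<^sup>2 / (2 * s\<^sup>2)))) v \<le> C2 * s"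
          unfolding C2_def
        proof (rule row_avg_gauss_le_linear[OF n(1,2), where D = "x L * sqrt n" and \<kappa> = \<kappa> and K = "K + 1"])
          have "card (spread_coords n \<rho> K v) \<le> card (spread_coords n (\<rho> / 2) (K + 1) v)"
            using n \<rho> by (intro spread_coords_perturb[where \<delta> = 0]) auto
          then show "\<eta> / 2 * n \<le> real (card (spread_coords n (\<rho> / 2) (K + 1) v))" using spr by linarith
          fix u assume u: "sqrt n / (K + 1) \<le> u" "u < x L * sqrt n"
          have "4 * \<kappa>\<^sup>2 * n \<le> (\<Sum>i<n. (pidist (u * v i))\<^sup>2)" using good[OF order_refl] u by blast
          moreover have "0 \<le> \<kappa>\<^sup>2 * n" by simp
          ultimately show "\<kappa>\<^sup>2 * n \<le> (\<Sum>i<n. (pidist (u * v i))\<^sup>2)" by linarith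
        next
          have "K1 * exp (- (\<gamma>1 * n)) \<le> exp (\<gamma> * n) * exp (- (\<gamma>1 * n))" using m1 by (intro mult_right_mono) auto
          also have "\<dots> = exp (- (\<gamma> * n))" using ee(1) by (simp add: mult.commute)
          finally show "real n * (2 / 3) powr (\<eta> / 2 * real n / 4) + real n * exp (- (\<kappa>\<^sup>2 * real n / 16)) +
            2 * exp (- (\<kappa>\<^sup>2 * real n / 4)) \<le> s" using err[of n] s(1) by linarith
          have "1 \<le> real L * s"
          proof -
            have "exp (\<gamma> * n) * exp (- (\<gamma> * n)) \<le> real L * s" using Ll s by (intro mult_mono) auto
            then show ?thesis using ee(2) by (simp add: mult.commute)
          qed
          then have "\<kappa> * 1 \<le> \<kappa> * (real L * s)" using \<kappa> by (intro mult_left_mono) auto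
          also have "\<dots> \<le> x L * s" using x0 s0 by (simp add: x_def algebra_simps)
          finally have "\<kappa> * sqrt n \<le> x L * s * sqrt n" by (intro mult_right_mono) auto
          then show "\<kappa> * sqrt n \<le> x L * sqrt n * s" by (simp add: mult_ac)
        qed (use \<eta> \<rho> K x(1)[of L] \<kappa> n s0 in auto)
        then show False using s by simp
      qed
    qed
    have fin: "finite (row_families I n)" by (rule finite_row_families[OF I(1)])
    have "card ?B \<le> card (A \<union> (\<Union>l<L. E l))"
      using fin by (intro card_mono[OF _ sub]) (auto simp: A_def E_def)
    also have "\<dots> \<le> card A + card (\<Union>l<L. E l)" by (rule card_Un_le)
    also have "\<dots> \<le> card A + (\<Sum>l<L. card (E l))" by (intro add_left_mono card_UN_le) simp
    finally have "real (card ?B) \<le> real (card A + (\<Sum>l<L. card (E l)))" by (rule of_nat_mono)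
    then have "real (card ?B) \<le> real (card A) + (\<Sum>l<L. real (card (E l)))" by simp
    also have "real (card A) \<le> C1 * exp (- (c * n)) * real (card (row_families I n))"
    proof -
      have "real (card A) \<le> C1 * exp (- (c1 * n)) * real (card (row_families I n))"
        unfolding A_def by (rule compr[OF n(1,2) I])
      also have "\<dots> \<le> C1 * exp (- (c * n)) * real (card (row_families I n))"
        using C1 by (intro mult_right_mono mult_left_mono) (auto simp: c_def mult_right_mono)
      finally show ?thesis .
    qed
    also have "(\<Sum>l<L. real (card (E l))) \<le> C3 * exp (- (c * n)) * real (card (row_families I n))"
    proof -
      have "(\<Sum>l<L. real (card (E l))) \<le>
        (\<Sum>l<L. Q * ((x0 + \<kappa>) * exp (\<gamma> * n)) * exp (1 - real n) * real (card (row_families I n)))"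
      proof (rule sum_mono)
        fix l assume l: "l \<in> {..<L}"
        have "real (card (E l)) \<le> Q * x l * exp (1 - real n) * real (card (row_families I n))" using E l by simp
        also have "\<dots> \<le> Q * ((x0 + \<kappa>) * exp (\<gamma> * n)) * exp (1 - real n) * real (card (row_families I n))"
          using xl l Q by (intro mult_right_mono mult_left_mono) auto
        finally show "real (card (E l)) \<le> Q * ((x0 + \<kappa>) * exp (\<gamma> * n)) * exp (1 - real n) * real (card (row_families I n))" .
      qed
      also have "\<dots> = real L * (Q * ((x0 + \<kappa>) * exp (\<gamma> * n)) * exp (1 - real n)) * real (card (row_families I n))" by simp
      also have "\<dots> \<le> (2 * exp (\<gamma> * n)) * (Q * ((x0 + \<kappa>) * exp (\<gamma> * n)) * exp (1 - real n)) * real (card (row_families I n))"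
        using Lu Q x0 \<kappa> by (intro mult_right_mono) auto
      \<comment> \<open>One \<open>exp (\<gamma> * n)\<close> counts the levels, the other bounds
        the surviving factor \<open>x l\<close>; together they are
        \<open>exp (\<gamma>1 * n)\<close>, at most \<open>exp (n / 2)\<close>.\<close>
      also have "(2 * exp (\<gamma> * n)) * (Q * ((x0 + \<kappa>) * exp (\<gamma> * n)) * exp (1 - real n)) =
          C3 * exp (\<gamma>1 * n - n)"
      proof -
        have "exp (\<gamma> * n) * exp (\<gamma> * n) * exp (1 - real n) = exp 1 * exp (\<gamma>1 * n - n)"
          unfolding \<gamma>(2) exp_add[symmetric] by (rule arg_cong[where f = exp]) (simp add: algebra_simps)
        then show ?thesis unfolding C3_def by (metis (no_types, lifting) mult.assoc mult.left_commute)
      qed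
      also have "\<dots> \<le> C3 * exp (- (c * n))"
      proof -
        have "c * n \<le> 1 / 2 * n" by (intro mult_right_mono) (auto simp: c_def)
        moreover have "\<gamma>1 * n \<le> 1 / 2 * n" using K1(3) by (intro mult_right_mono) auto
        ultimately have "\<gamma>1 * n - n \<le> - (c * n)" by linarith
        then show ?thesis using C3 by (intro mult_left_mono) auto
      qed
      finally show ?thesis by (simp add: mult_right_mono)
    qed
    finally show ?thesis by (simp add: algebra_simps)
  qed
  have "0 < c" using C1 by (simp add: c_def)
  then show ?thesis
    using C2 \<gamma>(1) C1 C3 main add_pos_pos[OF C1(1) C3]
    by (intro exI[of _ C2] exI[of _ \<gamma>] exI[of _ "C1 + C3"] exI[of _ c] exI[of _ n0] conjI allI impI) auto
qed

section \<open>Transfer to matrices\<close>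

lemma scalar_prod_sum: "w \<in> carrier_vec n \<Longrightarrow> v \<bullet> w = (\<Sum>k<n. v $ k * w $ k)"
  by (simp add: scalar_prod_def atLeast0LessThan)

lemma eucl_norm_sq: "w \<in> carrier_vec n \<Longrightarrow> (eucl_norm w)\<^sup>2 = (\<Sum>k<n. (w $ k :: real)\<^sup>2)"
  by (simp add: eucl_norm_def scalar_prod_sum power2_eq_square[symmetric] sum_nonneg)

lemma eucl_norm_nonneg: "0 \<le> eucl_norm w"
  by (simp add: eucl_norm_def scalar_prod_def sum_nonneg)

lemma abs_scalar_prod_le:
  assumes "v \<in> carrier_vec n" "w \<in> carrier_vec n"
  shows "\<bar>v \<bullet> w\<bar> \<le> eucl_norm v * eucl_norm (w :: real vec)"
proof (rule power2_le_imp_le)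
  show "\<bar>v \<bullet> w\<bar>\<^sup>2 \<le> (eucl_norm v * eucl_norm w)\<^sup>2"
    using Cauchy_Schwarz_ineq_sum[of "\<lambda>k. v $ k" "\<lambda>k. w $ k" "{..<n}"] assms
    by (simp add: power_mult_distrib eucl_norm_sq[of _ n] scalar_prod_sum[of _ n])
  show "0 \<le> eucl_norm v * eucl_norm w"
    by (intro mult_nonneg_nonneg eucl_norm_nonneg)
qed

lemma orthogonal_span:
  assumes "w \<in> carrier_vec n" "S \<subseteq> carrier_vec n" "\<And>y. y \<in> S \<Longrightarrow> w \<bullet> y = (0 :: real)"
    and "y \<in> LinearCombinations.module.span class_ring (module_vec TYPE(real) n) S"
  shows "w \<bullet> y = 0" "y \<in> carrier_vec n"
proof -
  interpret V: vec_space "TYPE(real)" n .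
  have "V.span S \<subseteq> {y \<in> carrier_vec n. w \<bullet> y = 0}"
  proof (rule V.span_is_subset)
    show "S \<subseteq> {y \<in> carrier_vec n. w \<bullet> y = 0}" using assms(2,3) by auto
    show "LinearCombinations.submodule class_ring {y \<in> carrier_vec n. w \<bullet> y = 0} (module_vec TYPE(real) n)"
      by unfold_locales (use assms(1) in \<open>auto simp: module_vec_def scalar_prod_add_distrib\<close>)
  qed
  then show "w \<bullet> y = 0" "y \<in> carrier_vec n" using assms(4) by auto
qed

lemma other_rows_span_nonempty: "other_rows_span n j Q \<noteq> {}"
proof -
  interpret V: vec_space "TYPE(real)" n .
  show ?thesis using V.span_zero unfolding other_rows_span_def by blast
qed

lemma other_rows_spanD:
  assumes "Q \<in> carrier_mat n n" "w \<in> carrier_vec n" "\<And>i. i < n \<Longrightarrow> i \<noteq> j \<Longrightarrow> w \<bullet> row Q i = 0"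
    and "y \<in> other_rows_span n j Q"
  shows "w \<bullet> y = 0" "y \<in> carrier_vec n"
proof -
  have S: "{row Q i | i. i < n \<and> i \<noteq> j} \<subseteq> carrier_vec n" using assms(1) by auto
  have 0: "w \<bullet> z = 0" if "z \<in> {row Q i | i. i < n \<and> i \<noteq> j}" for z using that assms(3) by auto
  note * = orthogonal_span[OF assms(2) S 0 assms(4)[unfolded other_rows_span_def]]
  show "w \<bullet> y = 0" "y \<in> carrier_vec n" by (rule *; assumption)+
qed

lemma row_in_other_rows_span:
  assumes "Q \<in> carrier_mat n n" "i < n" "i \<noteq> j"
  shows "row Q i \<in> other_rows_span n j Q"
proof -
  interpret V: vec_space "TYPE(real)" n .
  have "{row Q i | i. i < n \<and> i \<noteq> j} \<subseteq> V.span {row Q i | i. i < n \<and> i \<noteq> j}"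
    using assms(1) by (intro V.in_own_span) auto
  then show ?thesis unfolding other_rows_span_def using assms(2,3) by blast
qed

text \<open>Replacing row \<open>j\<close> by zero makes the matrix singular; a normalised kernel
  vector is orthogonal to the remaining rows.\<close>

lemma exists_unit_orthogonal:
  assumes Q: "Q \<in> carrier_mat n n" and j: "j < n"
  shows "\<exists>w\<in>carrier_vec n. eucl_norm w = 1 \<and> (\<forall>y\<in>other_rows_span n j Q. w \<bullet> y = 0)"
proof -
  define A where "A = mat n n (\<lambda>(i, k). if i = j then 0 else Q $$ (i, k))"
  have A: "A \<in> carrier_mat n n" by (simp add: A_def)
  have "A = mat\<^sub>r n n (\<lambda>i. if i = j then 0\<^sub>v n else row Q i)"
    using Q by (intro eq_matI) (auto simp: A_def)
  then have "det A = 0"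
    using Q det_row_0[OF j, of "\<lambda>i. row Q i"] by auto
  then obtain u where u: "u \<in> carrier_vec n" "u \<noteq> 0\<^sub>v n" "A *\<^sub>v u = 0\<^sub>v n"
    using det_0_iff_vec_prod_zero[OF A] by auto
  have "u \<bullet> row Q i = 0" if i: "i < n" "i \<noteq> j" for i
  proof -
    have "row A i = row Q i" using i Q by (intro eq_vecI) (auto simp: A_def)
    moreover have "(A *\<^sub>v u) $ i = 0" using u i by simp
    ultimately have "row Q i \<bullet> u = 0" using i A by simp
    then show ?thesis using u(1) Q by (subst comm_scalar_prod[of _ n]) auto
  qed
  note orth = other_rows_spanD[OF Q u(1) this]
  have pos: "eucl_norm u > 0"
  proof -
    obtain k where k: "k < n" "u $ k \<noteq> 0" using u(1,2) by (metis carrier_vecD eq_vecI index_zero_vec)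
    then have "0 < (\<Sum>k<n. (u $ k)\<^sup>2)" by (intro sum_pos2[of _ k]) auto
    then show ?thesis using u(1) by (simp add: eucl_norm_def scalar_prod_sum power2_eq_square)
  qed
  define w where "w = (1 / eucl_norm u) \<cdot>\<^sub>v u"
  have w: "w \<in> carrier_vec n" using u by (simp add: w_def)
  have "(eucl_norm w)\<^sup>2 = (\<Sum>k<n. (1 / eucl_norm u * u $ k)\<^sup>2)"
    unfolding eucl_norm_sq[OF w] using u(1) by (intro sum.cong) (auto simp: w_def)
  also have "\<dots> = (1 / eucl_norm u)\<^sup>2 * (eucl_norm u)\<^sup>2"
    unfolding power_mult_distrib sum_distrib_left[symmetric] eucl_norm_sq[OF u(1), symmetric] ..
  finally have "(eucl_norm w)\<^sup>2 = 1" using pos by (simp add: power_divide)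
  then have "eucl_norm w = 1" using eucl_norm_nonneg[of w] by (simp add: power2_eq_1_iff)
  moreover have "w \<bullet> y = 0" if "y \<in> other_rows_span n j Q" for y
    using orth[OF _ _ that] u(1) by (simp add: w_def)
  ultimately show ?thesis using w by blast
qed

section \<open>Unit normals as functions of the spanned subspace\<close>

lemma space_sparse_sign_measure: "space (sparse_sign_measure n) = sparse_sign_mats n"
  by (simp add: sparse_sign_measure_def space_uniform_count_measure)

lemma sparse_sign_mats_carrier: "Q \<in> sparse_sign_mats n \<Longrightarrow> Q \<in> carrier_mat n n"
  by (simp add: sparse_sign_mats_def)

text \<open>The normal is selected from the subspace and not from the matrix, which makes it
  measurable. The distance statement mentions no normal and is derived from this one.\<close>

lemma exists_random_unit_normal:
  assumes j: "j < n"
  shows "\<exists>v. random_unit_normal n j v"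
proof -
  define f where "f H = (SOME w. w \<in> carrier_vec n \<and> eucl_norm w = 1 \<and> (\<forall>y\<in>H. w \<bullet> y = 0))" for H
  have f: "f (other_rows_span n j Q) \<in> carrier_vec n \<and> eucl_norm (f (other_rows_span n j Q)) = 1 \<and>
     (\<forall>y\<in>other_rows_span n j Q. f (other_rows_span n j Q) \<bullet> y = 0)"
    if "Q \<in> sparse_sign_mats n" for Q
    unfolding f_def using exists_unit_orthogonal[OF sparse_sign_mats_carrier[OF that] j]
    by (intro someI_ex[of "\<lambda>w. w \<in> carrier_vec n \<and> eucl_norm w = 1 \<and> (\<forall>y\<in>other_rows_span n j Q. w \<bullet> y = 0)"]) blast
  have meas: "(\<lambda>Q. f (other_rows_span n j Q) $ k) \<in> borel_measurable (sigma_other_rows n j)" for k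
    unfolding sigma_other_rows_def
    by (rule measurable_compose[OF measurable_vimage_algebra1[where M = "count_space UNIV"]]) auto
  have "random_unit_normal n j (\<lambda>Q. f (other_rows_span n j Q))"
    unfolding random_unit_normal_def space_sparse_sign_measure using f meas by auto
  then show ?thesis by blast
qed

text \<open>A measurable function for the generated sigma-algebra factors through the span: the
  fibre of the value \<open>v Q $ k\<close> is the preimage of a set of subspaces.\<close>

lemma random_unit_normal_cong:
  assumes v: "random_unit_normal n j v" and Q: "Q \<in> sparse_sign_mats n" "Q' \<in> sparse_sign_mats n"
    and eq: "other_rows_span n j Q = other_rows_span n j Q'" and k: "k < n"
  shows "v Q $ k = v Q' $ k"
proof -
  let ?X = "sparse_sign_mats n"
  have m: "(\<lambda>Q. v Q $ k) \<in> borel_measurable (sigma_other_rows n j)"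
    using v k by (simp add: random_unit_normal_def)
  have sp: "space (sigma_other_rows n j) = ?X"
    by (simp add: sigma_other_rows_def space_sparse_sign_measure)
  have "(\<lambda>Q. v Q $ k) -` {v Q $ k} \<inter> ?X \<in> sets (sigma_other_rows n j)"
    using measurable_sets[OF m, of "{v Q $ k}"] sp by simp
  then obtain B where "(\<lambda>Q. v Q $ k) -` {v Q $ k} \<inter> ?X = other_rows_span n j -` B \<inter> ?X"
    by (auto simp: sigma_other_rows_def space_sparse_sign_measure sets_vimage_algebra2)
  then have "Q \<in> other_rows_span n j -` B" "other_rows_span n j -` B \<inter> ?X \<subseteq> (\<lambda>Q. v Q $ k) -` {v Q $ k}"
    using Q by auto
  then show ?thesis using eq Q by auto
qed

section \<open>Separating one row from the others\<close>

definition mat_of_rows_at :: "nat \<Rightarrow> nat \<Rightarrow> (nat \<Rightarrow> real) \<Rightarrow> (nat \<Rightarrow> nat \<Rightarrow> real) \<Rightarrow> real mat" where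
  "mat_of_rows_at n j r q = mat n n (\<lambda>(i, k). if i = j then r k else q i k)"

text \<open>In counting form, this is the independence of row \<open>j\<close> from the other rows
  and the uniformity of both.\<close>

lemma bij_betw_mat_of_rows_at:
  assumes j: "j < n"
  shows "bij_betw (\<lambda>(r, q). mat_of_rows_at n j r q) (sign_rows n \<times> row_families ({..<n} - {j}) n) (sparse_sign_mats n)"
proof -
  define rf :: "real mat \<Rightarrow> nat \<Rightarrow> nat \<Rightarrow> real" where "rf Q i = (\<lambda>k\<in>{..<n}. Q $$ (i, k))" for Q i
  have rf: "rf Q i \<in> sign_rows n" if "Q \<in> sparse_sign_mats n" "i < n" for Q i
    using that by (auto simp: rf_def sign_rows_def sparse_sign_mats_def)
  have ext: "r k = undefined" if "r \<in> sign_rows n" "\<not> k < n" for r k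
    using that by (auto simp: sign_rows_def PiE_def extensional_def)
  show ?thesis
  proof (rule bij_betw_byWitness[where f' = "\<lambda>Q. (rf Q j, \<lambda>i\<in>{..<n} - {j}. rf Q i)"])
    show "\<forall>p\<in>sign_rows n \<times> row_families ({..<n} - {j}) n.
      (\<lambda>Q. (rf Q j, \<lambda>i\<in>{..<n} - {j}. rf Q i)) ((\<lambda>(r, q). mat_of_rows_at n j r q) p) = p"
    proof (rule ballI)
      fix p assume "p \<in> sign_rows n \<times> row_families ({..<n} - {j}) n"
      then obtain r q where p: "p = (r, q)" and r: "r \<in> sign_rows n" and q: "q \<in> row_families ({..<n} - {j}) n"
        by auto
      have "rf (mat_of_rows_at n j r q) j = r"
        using j ext[OF r] by (auto simp: rf_def mat_of_rows_at_def fun_eq_iff)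
      moreover have "(\<lambda>i\<in>{..<n} - {j}. rf (mat_of_rows_at n j r q) i) = q"
      proof
        fix i
        show "(\<lambda>i\<in>{..<n} - {j}. rf (mat_of_rows_at n j r q) i) i = q i"
        proof (cases "i \<in> {..<n} - {j}")
          case True
          then have "q i \<in> sign_rows n" using q by (auto simp: row_families_def)
          from ext[OF this] show ?thesis using True by (auto simp: rf_def mat_of_rows_at_def fun_eq_iff)
        next
          case False
          then show ?thesis using q by (auto simp: row_families_def PiE_def extensional_def)
        qed
      qed
      ultimately show "(\<lambda>Q. (rf Q j, \<lambda>i\<in>{..<n} - {j}. rf Q i)) ((\<lambda>(r, q). mat_of_rows_at n j r q) p) = p"
        by (simp add: p)
    qed
    show "\<forall>Q\<in>sparse_sign_mats n. (\<lambda>(r, q). mat_of_rows_at n j r q) (rf Q j, \<lambda>i\<in>{..<n} - {j}. rf Q i) = Q"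
      by (auto simp: mat_of_rows_at_def rf_def sparse_sign_mats_def intro!: eq_matI)
    show "(\<lambda>(r, q). mat_of_rows_at n j r q) ` (sign_rows n \<times> row_families ({..<n} - {j}) n) \<subseteq> sparse_sign_mats n"
    proof (rule image_subsetI)
      fix p assume "p \<in> sign_rows n \<times> row_families ({..<n} - {j}) n"
      then obtain r q where p: "p = (r, q)" and r: "r \<in> sign_rows n" and q: "q \<in> row_families ({..<n} - {j}) n"
        by auto
      let ?g = "\<lambda>i. if i = j then r else q i"
      have g: "?g i \<in> sign_rows n" if "i < n" for i using r q that by (auto simp: row_families_def)
      have "mat_of_rows_at n j r q $$ (i, k) = ?g i k" if "i < n" "k < n" for i k
        using that by (simp add: mat_of_rows_at_def)
      moreover have "?g i k \<in> {-1, 0, 1}" if "i < n" "k < n" for i k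
        using g[OF that(1)] that(2) unfolding sign_rows_def by blast
      moreover have "(\<Sum>k<n. \<bar>?g i k\<bar>) = real n / 2" if "i < n" for i
        using g[OF that] unfolding sign_rows_def by blast
      moreover have "mat_of_rows_at n j r q \<in> carrier_mat n n" by (simp add: mat_of_rows_at_def)
      ultimately have "mat_of_rows_at n j r q \<in> sparse_sign_mats n"
        unfolding sparse_sign_mats_def by simp
      then show "(\<lambda>(r, q). mat_of_rows_at n j r q) p \<in> sparse_sign_mats n" by (simp add: p)
    qed
    show "(\<lambda>Q. (rf Q j, \<lambda>i\<in>{..<n} - {j}. rf Q i)) ` sparse_sign_mats n \<subseteq> sign_rows n \<times> row_families ({..<n} - {j}) n"
    proof (rule image_subsetI)
      fix Q assume Q: "Q \<in> sparse_sign_mats n"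
      have "(\<lambda>i\<in>{..<n} - {j}. rf Q i) \<in> row_families ({..<n} - {j}) n"
        unfolding row_families_def using rf[OF Q] by (intro restrict_PiE_iff[THEN iffD2]) auto
      then show "(rf Q j, \<lambda>i\<in>{..<n} - {j}. rf Q i) \<in> sign_rows n \<times> row_families ({..<n} - {j}) n"
        using rf[OF Q j] by simp
    qed
  qed
qed

lemma mat_of_rows_at_row:
  "j < n \<Longrightarrow> row (mat_of_rows_at n j r q) j \<bullet> w = dotp n r (\<lambda>k. w $ k)" if "w \<in> carrier_vec n"
  using that by (simp add: scalar_prod_sum dotp_def mat_of_rows_at_def)

lemma mat_of_rows_at_other_row:
  "i < n \<Longrightarrow> i \<noteq> j \<Longrightarrow> w \<bullet> row (mat_of_rows_at n j r q) i = dotp n (q i) (\<lambda>k. w $ k)"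
  if "w \<in> carrier_vec n"
proof -
  assume i: "i < n" "i \<noteq> j"
  have "row (mat_of_rows_at n j r q) i \<in> carrier_vec n"
    unfolding mat_of_rows_at_def by (intro carrier_vecI) simp
  then show ?thesis
    using i by (simp add: scalar_prod_sum dotp_def mat_of_rows_at_def mult.commute)
qed

lemma other_rows_span_mat_of_rows_at:
  "other_rows_span n j (mat_of_rows_at n j r q) = other_rows_span n j (mat_of_rows_at n j r' q)"
proof -
  have "row (mat_of_rows_at n j r q) i = row (mat_of_rows_at n j r' q) i" if "i < n" "i \<noteq> j" for i
    using that by (intro eq_vecI) (auto simp: mat_of_rows_at_def)
  then have "{row (mat_of_rows_at n j r q) i | i. i < n \<and> i \<noteq> j} = {row (mat_of_rows_at n j r' q) i | i. i < n \<and> i \<noteq> j}"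
    by (auto; metis)
  then show ?thesis unfolding other_rows_span_def by simp
qed

text \<open>The indicator of the interval is at most twice the Gaussian weight, because
  \<open>exp (- 1 / 2) \<ge> 1 / 2\<close>.\<close>

lemma card_dotp_near_le:
  assumes n: "even n" and s: "0 < s" "\<epsilon> \<le> s"
  shows "real (card {r \<in> sign_rows n. \<bar>dotp n r x - t\<bar> \<le> \<epsilon>}) \<le>
    2 * row_avg n (\<lambda>y. exp (- ((y - t)\<^sup>2 / (2 * s\<^sup>2)))) x * real (card (sign_rows n))"
proof -
  let ?R = "{r \<in> sign_rows n. \<bar>dotp n r x - t\<bar> \<le> \<epsilon>}"
  let ?e = "\<lambda>r. exp (- ((dotp n r x - t)\<^sup>2 / (2 * s\<^sup>2)))"
  have "real (card ?R) = (\<Sum>r\<in>?R. 1)" by simp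
  also have "\<dots> \<le> (\<Sum>r\<in>?R. 2 * ?e r)"
  proof (rule sum_mono)
    fix r assume "r \<in> ?R"
    then have "\<bar>dotp n r x - t\<bar> \<le> s" using s by auto
    from power_mono[OF this, of 2] have "(dotp n r x - t)\<^sup>2 \<le> s\<^sup>2" by simp
    then have "- (1 / 2) \<le> - ((dotp n r x - t)\<^sup>2 / (2 * s\<^sup>2))" using s by (simp add: field_simps)
    with exp_ge_add_one_self[of "- ((dotp n r x - t)\<^sup>2 / (2 * s\<^sup>2))"] show "1 \<le> 2 * ?e r" by linarith
  qed
  also have "\<dots> \<le> (\<Sum>r\<in>sign_rows n. 2 * ?e r)" by (intro sum_mono2 finite_sign_rows) auto
  also have "\<dots> = 2 * row_avg n (\<lambda>y. exp (- ((y - t)\<^sup>2 / (2 * s\<^sup>2)))) x * real (card (sign_rows n))"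
    using card_sign_rows_pos[OF n] by (simp add: row_avg_def sum_distrib_left)
  finally show ?thesis .
qed

lemma normal_concentration:
  "\<exists>(C :: real) (C' :: real) (c :: real) n0. 0 < C \<and> 0 < C' \<and> 0 < c \<and>
    (\<forall>n j v t \<epsilon>. even n \<longrightarrow> j < n \<longrightarrow> n0 \<le> n \<longrightarrow> random_unit_normal n j v \<longrightarrow> 0 \<le> \<epsilon> \<longrightarrow>
      measure (sparse_sign_measure n) {Q \<in> space (sparse_sign_measure n). \<bar>row Q j \<bullet> v Q - t\<bar> \<le> \<epsilon>}
        \<le> C * \<epsilon> + C' * exp (- (c * n)))"
proof -
  obtain C2 \<gamma> C c :: real and n0 where C: "0 < C2" "0 < \<gamma>" "0 < C" "0 < c" and
    rare: "\<And>n (I :: nat set). even n \<Longrightarrow> 0 < n \<Longrightarrow> n0 \<le> n \<Longrightarrow> finite I \<Longrightarrow> card I = n - 1 \<Longrightarrow>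
      real (card {q \<in> row_families I n. \<exists>v. unit_normal I n q v \<and>
          \<not> (\<forall>s b. exp (- (\<gamma> * n)) \<le> s \<longrightarrow> row_avg n (\<lambda>y. exp (- ((y - b)\<^sup>2 / (2 * s\<^sup>2)))) v \<le> C2 * s)})
        \<le> C * exp (- (c * n)) * real (card (row_families I n))"
    using structured_normals_rare[where 'i = nat] by blast
  define c' where "c' = min c \<gamma>"
  have "measure (sparse_sign_measure n) {Q \<in> space (sparse_sign_measure n). \<bar>row Q j \<bullet> v Q - t\<bar> \<le> \<epsilon>}
        \<le> 2 * C2 * \<epsilon> + (C + 2 * C2) * exp (- (c' * n))"
    if n: "even n" "j < n" "n0 \<le> n" and v: "random_unit_normal n j v" and \<epsilon>: "0 \<le> \<epsilon>" for n j v t \<epsilon>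
  proof -
    define I where "I = {..<n} - {j}"
    have I: "finite I" "card I = n - 1" using n by (auto simp: I_def)
    let ?R = "real (card (sign_rows n))" and ?F = "real (card (row_families I n))"
    have R0: "?R > 0" by (rule card_sign_rows_pos[OF n(1)])
    have finF: "finite (row_families I n)" by (rule finite_row_families[OF I(1)])
    \<comment> \<open>The smallest scale that covers \<open>\<epsilon>\<close> and is admissible in
      \<open>structured_normals_rare\<close>; its floor produces the additive exponential
      term.\<close>
    define s where "s = max \<epsilon> (exp (- (\<gamma> * n)))"
    have s: "0 < s" "\<epsilon> \<le> s" "exp (- (\<gamma> * n)) \<le> s" "s \<le> \<epsilon> + exp (- (\<gamma> * n))"
    proof -
      show "exp (- (\<gamma> * n)) \<le> s" "\<epsilon> \<le> s" by (simp_all add: s_def)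
      then show "0 < s" using exp_gt_zero less_le_trans by blast
      show "s \<le> \<epsilon> + exp (- (\<gamma> * n))" using \<epsilon> by (simp add: s_def)
    qed
    obtain r0 where r0: "r0 \<in> sign_rows n"
      using R0 by (metis all_not_in_conv card.empty less_irrefl of_nat_0)
    \<comment> \<open>The normal as a function of the other rows alone: position \<open>j\<close> is
      filled with a fixed row \<open>r0\<close>, which by \<open>random_unit_normal_cong\<close>
      does not affect the value.\<close>
    define x where "x q = (\<lambda>k. v (mat_of_rows_at n j r0 q) $ k)" for q
    have bij: "bij_betw (\<lambda>(r, q). mat_of_rows_at n j r q) (sign_rows n \<times> row_families I n) (sparse_sign_mats n)"
      unfolding I_def by (rule bij_betw_mat_of_rows_at[OF n(2)])
    have mem: "mat_of_rows_at n j r q \<in> sparse_sign_mats n" if "r \<in> sign_rows n" "q \<in> row_families I n" for r q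
      using bij_betwE[OF bij] that by auto
    have vc: "v Q \<in> carrier_vec n" "eucl_norm (v Q) = 1" "\<And>y. y \<in> other_rows_span n j Q \<Longrightarrow> v Q \<bullet> y = 0"
      if "Q \<in> sparse_sign_mats n" for Q
      using v that by (auto simp: random_unit_normal_def space_sparse_sign_measure)
    have dot: "row (mat_of_rows_at n j r q) j \<bullet> v (mat_of_rows_at n j r q) = dotp n r (x q)"
      if rq: "r \<in> sign_rows n" "q \<in> row_families I n" for r q
    proof -
      have "v (mat_of_rows_at n j r q) $ k = x q k" if "k < n" for k
        unfolding x_def
        by (rule random_unit_normal_cong[OF v mem[OF rq] mem[OF r0 rq(2)] other_rows_span_mat_of_rows_at that])
      then show ?thesis
        using mat_of_rows_at_row[OF vc(1)[OF mem[OF rq]] n(2)] by (simp add: dotp_def)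
    qed
    have normal: "unit_normal I n q (x q)" if q: "q \<in> row_families I n" for q
    proof -
      let ?Q = "mat_of_rows_at n j r0 q"
      note m = mem[OF r0 q]
      have "(\<Sum>k<n. (x q k)\<^sup>2) = 1"
        using eucl_norm_sq[OF vc(1)[OF m]] vc(2)[OF m] by (simp add: x_def)
      moreover have "dotp n (q i) (x q) = 0" if "i \<in> I" for i
      proof -
        have i: "i < n" "i \<noteq> j" using that by (auto simp: I_def)
        have "v ?Q \<bullet> row ?Q i = 0"
          by (rule vc(3)[OF m row_in_other_rows_span[OF sparse_sign_mats_carrier[OF m] i]])
        then show ?thesis using mat_of_rows_at_other_row[OF vc(1)[OF m] i] by (simp add: x_def)
      qed
      ultimately show ?thesis by (simp add: unit_normal_def)
    qed
    define B where "B = {q \<in> row_families I n. \<exists>v. unit_normal I n q v \<and>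
          \<not> (\<forall>s b. exp (- (\<gamma> * n)) \<le> s \<longrightarrow> row_avg n (\<lambda>y. exp (- ((y - b)\<^sup>2 / (2 * s\<^sup>2)))) v \<le> C2 * s)}"
    have cB: "real (card B) \<le> C * exp (- (c * n)) * ?F"
      unfolding B_def using n I by (intro rare) auto
    let ?E = "{Q \<in> sparse_sign_mats n. \<bar>row Q j \<bullet> v Q - t\<bar> \<le> \<epsilon>}"
    let ?g = "\<lambda>q. {r \<in> sign_rows n. \<bar>dotp n r (x q) - t\<bar> \<le> \<epsilon>}"
    have "real (card ?E) = (\<Sum>Q\<in>sparse_sign_mats n. if \<bar>row Q j \<bullet> v Q - t\<bar> \<le> \<epsilon> then 1 else 0)"
      using finite_sparse_sign_mats[of n] by (simp add: sum.inter_filter[symmetric])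
    also have "\<dots> = (\<Sum>(r, q)\<in>sign_rows n \<times> row_families I n. if \<bar>dotp n r (x q) - t\<bar> \<le> \<epsilon> then 1 else 0)"
      by (subst sum.reindex_bij_betw[OF bij, symmetric]) (auto simp: dot intro!: sum.cong)
    also have "\<dots> = (\<Sum>q\<in>row_families I n. \<Sum>r\<in>sign_rows n. if \<bar>dotp n r (x q) - t\<bar> \<le> \<epsilon> then 1 else 0)"
      by (subst sum.swap) (simp add: sum.cartesian_product)
    also have "\<dots> = (\<Sum>q\<in>row_families I n. real (card (?g q)))"
      using finite_sign_rows[of n] by (simp add: sum.inter_filter[symmetric])
    \<comment> \<open>Conditioning on the other rows: a family in \<open>B\<close> may lose its
      whole fibre, and any other family loses only the small ball proportion.\<close>
    also have "\<dots> \<le> (\<Sum>q\<in>row_families I n. (if q \<in> B then ?R else 0) + 2 * (C2 * s) * ?R)"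
    proof (rule sum_mono)
      fix q assume q: "q \<in> row_families I n"
      show "real (card (?g q)) \<le> (if q \<in> B then ?R else 0) + 2 * (C2 * s) * ?R"
      proof (cases "q \<in> B")
        case True
        have "real (card (?g q)) \<le> ?R" by (intro of_nat_mono card_mono finite_sign_rows) auto
        moreover have "0 \<le> 2 * (C2 * s) * ?R" using C s R0 by simp
        ultimately show ?thesis using True by simp
      next
        case False
        then have "row_avg n (\<lambda>y. exp (- ((y - t)\<^sup>2 / (2 * s\<^sup>2)))) (x q) \<le> C2 * s"
          using normal[OF q] q s(3) unfolding B_def by blast
        then have "2 * row_avg n (\<lambda>y. exp (- ((y - t)\<^sup>2 / (2 * s\<^sup>2)))) (x q) * ?R \<le> 2 * (C2 * s) * ?R"
          by (intro mult_right_mono mult_left_mono) auto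
        then show ?thesis using False card_dotp_near_le[OF n(1) s(1,2), of "x q" t] by simp
      qed
    qed
    also have "\<dots> = real (card B) * ?R + ?F * (2 * (C2 * s) * ?R)"
    proof -
      have "(\<Sum>q\<in>row_families I n. if q \<in> B then ?R else 0) = (\<Sum>q\<in>row_families I n \<inter> B. ?R)"
        by (rule sum.inter_restrict[OF finF, symmetric])
      also have "row_families I n \<inter> B = B" by (auto simp: B_def)
      finally show ?thesis by (simp add: sum.distrib)
    qed
    also have "\<dots> \<le> (C * exp (- (c * n)) * ?F) * ?R + ?F * (2 * (C2 * s) * ?R)"
      using cB by (intro add_right_mono mult_right_mono) auto
    also have "\<dots> = (C * exp (- (c * n)) + 2 * C2 * s) * (?R * ?F)" by (simp add: algebra_simps)
    finally have cE: "real (card ?E) \<le> (C * exp (- (c * n)) + 2 * C2 * s) * (?R * ?F)" .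
    have cM: "real (card (sparse_sign_mats n)) = ?R * ?F"
      unfolding bij_betw_same_card[OF bij, symmetric] by (simp add: card_cartesian_product)
    have cM0: "0 < ?R * ?F"
      using sparse_sign_mats_nonempty[OF n(1)] finite_sparse_sign_mats[of n] unfolding cM[symmetric]
      by (simp add: card_gt_0_iff)
    have "measure (sparse_sign_measure n) {Q \<in> space (sparse_sign_measure n). \<bar>row Q j \<bullet> v Q - t\<bar> \<le> \<epsilon>}
        = real (card ?E) / (?R * ?F)"
      unfolding space_sparse_sign_measure cM[symmetric] unfolding sparse_sign_measure_def
      by (intro measure_uniform_count_measure finite_sparse_sign_mats) auto
    also have "\<dots> \<le> C * exp (- (c * n)) + 2 * C2 * s" using cE cM0 by (simp add: pos_divide_le_eq)
    also have "\<dots> \<le> C * exp (- (c' * n)) + 2 * C2 * (\<epsilon> + exp (- (c' * n)))"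
    proof (intro add_mono mult_left_mono)
      show "exp (- (c * n)) \<le> exp (- (c' * n))" by (simp add: c'_def mult_right_mono)
      have "exp (- (\<gamma> * n)) \<le> exp (- (c' * n))" by (simp add: c'_def mult_right_mono)
      then show "s \<le> \<epsilon> + exp (- (c' * n))" using s(4) by linarith
    qed (use C in auto)
    finally show ?thesis by (simp add: algebra_simps)
  qed
  moreover have "0 < 2 * C2" "0 < C + 2 * C2" "0 < c'" using C by (auto simp: c'_def)
  ultimately show ?thesis
    by (intro exI[of _ "2 * C2"] exI[of _ "C + 2 * C2"] exI[of _ c'] exI[of _ n0]) auto
qed

text \<open>Trades the constant \<open>C\<close> for the prefactor 2 at a smaller rate. For large
  \<open>n\<close> half of the rate pays for \<open>C\<close>; for \<open>n\<close> below
  \<open>N\<close> the rate \<open>ln 2 / N\<close> makes \<open>2 * exp (- d * n)\<close> at least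
  1, and the bound is trivial for a probability.\<close>

lemma absorb_exponential_constant:
  fixes C c :: real and n0 :: nat
  assumes "0 < C" "0 < c"
  shows "\<exists>d>0. \<forall>n P a. 0 \<le> a \<longrightarrow> P \<le> 1 \<longrightarrow> (n0 \<le> n \<longrightarrow> P \<le> a + C * exp (- (c * real n))) \<longrightarrow>
    P \<le> a + 2 * exp (- d * real n)"
proof -
  define N where "N = max (real n0) (C / c) + 1"
  have N: "real n0 \<le> N" "C / c \<le> N" "N \<ge> 1" using assms by (auto simp: N_def)
  define d where "d = min (c / 2) (ln 2 / N)"
  have d: "d > 0" using assms N by (simp add: d_def)
  have "P \<le> a + 2 * exp (- d * real n)"
    if a: "0 \<le> a" and P: "P \<le> 1" "n0 \<le> n \<longrightarrow> P \<le> a + C * exp (- (c * real n))" for n P a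
  proof (cases "N \<le> real n")
    case True
    have "C \<le> c * real n"
    proof -
      have "C \<le> N * c" using N(2) assms by (simp add: pos_divide_le_eq)
      also have "\<dots> \<le> real n * c" using True assms by (intro mult_right_mono) auto
      finally show ?thesis by (simp add: mult.commute)
    qed
    moreover have "1 + c * real n / 2 \<le> exp (c * real n / 2)" by (rule exp_ge_add_one_self)
    ultimately have "C \<le> 2 * exp (c * real n / 2)" by linarith
    then have "C * exp (- (c * real n)) \<le> 2 * exp (c * real n / 2) * exp (- (c * real n))"
      by (intro mult_right_mono) auto
    also have "\<dots> = 2 * exp (- (c / 2 * real n))" by (simp add: exp_add[symmetric] mult.assoc)
    also have "\<dots> \<le> 2 * exp (- d * real n)"
    proof -
      have "d \<le> c / 2" unfolding d_def by (rule min.cobounded1)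
      from mult_right_mono[OF this, of "real n"] show ?thesis by simp
    qed
    finally have "C * exp (- (c * real n)) \<le> 2 * exp (- d * real n)" .
    moreover have "n0 \<le> n" using True N by linarith
    ultimately show ?thesis using P by linarith
  next
    case False
    have "d * real n \<le> ln 2 / N * N" using False N d by (intro mult_mono) (auto simp: d_def)
    also have "\<dots> = ln 2" using N by simp
    finally have "exp (- ln 2) \<le> exp (- d * real n)" by simp
    then have "1 \<le> 2 * exp (- d * real n)" by (simp add: exp_minus)
    then show ?thesis using a P by linarith
  qed
  then show ?thesis using d by blast
qed

text \<open>Subtracting a vector of the span does not change the product with a normal, and
  Cauchy--Schwarz with norm 1 bounds it. Only an inequality is asserted: for dependent rows the span
  may have codimension above 1 and the distance may be larger.\<close>

lemma abs_normal_le_dist: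
  assumes v: "random_unit_normal n j v" and Q: "Q \<in> sparse_sign_mats n" and j: "j < n"
  shows "\<bar>row Q j \<bullet> v Q\<bar> \<le> eucl_dist_set (row Q j) (other_rows_span n j Q)"
  unfolding eucl_dist_set_def
proof (rule cINF_greatest[OF other_rows_span_nonempty])
  note Qc = sparse_sign_mats_carrier[OF Q]
  have vc: "v Q \<in> carrier_vec n" "eucl_norm (v Q) = 1" "\<And>y. y \<in> other_rows_span n j Q \<Longrightarrow> v Q \<bullet> y = 0"
    using v Q by (auto simp: random_unit_normal_def space_sparse_sign_measure)
  fix y assume y: "y \<in> other_rows_span n j Q"
  have yc: "y \<in> carrier_vec n"
    by (rule other_rows_spanD(2)[OF Qc vc(1) _ y]) (rule vc(3)[OF row_in_other_rows_span[OF Qc]])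
  have rc: "row Q j \<in> carrier_vec n" by (rule row_carrier_vec[OF j Qc])
  have "(row Q j - y) \<bullet> v Q = row Q j \<bullet> v Q - y \<bullet> v Q"
    by (rule minus_scalar_prod_distrib[OF rc yc vc(1)])
  also have "y \<bullet> v Q = v Q \<bullet> y" by (rule comm_scalar_prod[OF yc vc(1)])
  also have "\<dots> = 0" by (rule vc(3)[OF y])
  finally have "\<bar>row Q j \<bullet> v Q\<bar> = \<bar>(row Q j - y) \<bullet> v Q\<bar>" by simp
  also have "\<dots> \<le> eucl_norm (row Q j - y) * eucl_norm (v Q)"
    using rc yc vc(1) by (intro abs_scalar_prod_le[of _ n]) auto
  finally show "\<bar>row Q j \<bullet> v Q\<bar> \<le> eucl_norm (row Q j - y)" using vc(2) by simp
qed

theorem theorem1p2: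
  shows "\<exists>C c :: real. C > 0 \<and> c > 0 \<and>
    (\<forall>n::nat. even n \<longrightarrow>
      (\<forall>v :: nat \<Rightarrow> real mat \<Rightarrow> real vec.
         (\<forall>j<n. random_unit_normal n j (v j)) \<longrightarrow>
         (\<forall>j<n. \<forall>\<epsilon>\<ge>0.
            levy_concentration (sparse_sign_measure n) (\<lambda>Q. row Q j \<bullet> v j Q) \<epsilon>
              \<le> C * \<epsilon> + 2 * exp (- c * real n))) \<and>
      (\<forall>j<n. \<forall>\<epsilon>\<ge>0.
         measure (sparse_sign_measure n)
             {Q \<in> space (sparse_sign_measure n).
                eucl_dist_set (row Q j) (other_rows_span n j Q) \<le> \<epsilon>}
           \<le> C * \<epsilon> + 2 * exp (- c * real n)))"
proof -
  obtain C C' c :: real and n0 where C: "0 < C" "0 < C'" "0 < c" and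
    conc: "\<And>n j v t \<epsilon>. even n \<Longrightarrow> j < n \<Longrightarrow> n0 \<le> n \<Longrightarrow> random_unit_normal n j v \<Longrightarrow> 0 \<le> \<epsilon> \<Longrightarrow>
      measure (sparse_sign_measure n) {Q \<in> space (sparse_sign_measure n). \<bar>row Q j \<bullet> v Q - t\<bar> \<le> \<epsilon>}
        \<le> C * \<epsilon> + C' * exp (- (c * n))"
    using normal_concentration by blast
  obtain d where d: "d > 0" and absorb: "\<And>n P a. 0 \<le> a \<Longrightarrow> P \<le> 1 \<Longrightarrow>
      (n0 \<le> n \<Longrightarrow> P \<le> a + C' * exp (- (c * real n))) \<Longrightarrow> P \<le> a + 2 * exp (- d * real n)"
    using absorb_exponential_constant[OF C(2,3), of n0] by blast
  have small_ball: "measure (sparse_sign_measure n) {Q \<in> space (sparse_sign_measure n). \<bar>row Q j \<bullet> v Q - t\<bar> \<le> \<epsilon>}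
        \<le> C * \<epsilon> + 2 * exp (- d * real n)"
    if "even n" "j < n" "random_unit_normal n j v" "0 \<le> \<epsilon>" for n j v t \<epsilon>
  proof (rule absorb)
    interpret prob_space "sparse_sign_measure n" by (rule prob_space_sparse_sign_measure[OF that(1)])
    show "measure (sparse_sign_measure n) {Q \<in> space (sparse_sign_measure n). \<bar>row Q j \<bullet> v Q - t\<bar> \<le> \<epsilon>} \<le> 1"
      by (rule prob_le_1)
  qed (use C that conc in auto)
  have levy: "levy_concentration (sparse_sign_measure n) (\<lambda>Q. row Q j \<bullet> v Q) \<epsilon> \<le> C * \<epsilon> + 2 * exp (- d * real n)"
    if "even n" "j < n" "random_unit_normal n j v" "0 \<le> \<epsilon>" for n j v \<epsilon>
    unfolding levy_concentration_def by (rule cSUP_least) (use small_ball[OF that] in auto)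
  have dist: "measure (sparse_sign_measure n) {Q \<in> space (sparse_sign_measure n).
        eucl_dist_set (row Q j) (other_rows_span n j Q) \<le> \<epsilon>} \<le> C * \<epsilon> + 2 * exp (- d * real n)"
    if n: "even n" "j < n" "0 \<le> \<epsilon>" for n j \<epsilon>
  proof -
    interpret prob_space "sparse_sign_measure n" by (rule prob_space_sparse_sign_measure[OF n(1)])
    \<comment> \<open>Any measurable normal will do; the distance event lies in its small ball event
      with centre 0.\<close>
    obtain v where v: "random_unit_normal n j v" using exists_random_unit_normal[OF n(2)] by blast
    have "measure (sparse_sign_measure n) {Q \<in> space (sparse_sign_measure n).
        eucl_dist_set (row Q j) (other_rows_span n j Q) \<le> \<epsilon>} \<le>
      measure (sparse_sign_measure n) {Q \<in> space (sparse_sign_measure n). \<bar>row Q j \<bullet> v Q - 0\<bar> \<le> \<epsilon>}"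
    proof (rule finite_measure_mono)
      show "{Q \<in> space (sparse_sign_measure n). eucl_dist_set (row Q j) (other_rows_span n j Q) \<le> \<epsilon>} \<subseteq>
        {Q \<in> space (sparse_sign_measure n). \<bar>row Q j \<bullet> v Q - 0\<bar> \<le> \<epsilon>}"
        using abs_normal_le_dist[OF v _ n(2)] by (force simp: space_sparse_sign_measure)
      show "{Q \<in> space (sparse_sign_measure n). \<bar>row Q j \<bullet> v Q - 0\<bar> \<le> \<epsilon>} \<in> sets (sparse_sign_measure n)"
        by (auto simp: sparse_sign_measure_def sets_uniform_count_measure space_uniform_count_measure)
    qed
    also have "\<dots> \<le> C * \<epsilon> + 2 * exp (- d * real n)" by (rule small_ball[OF n(1,2) v n(3)])
    finally show ?thesis .
  qed
  show ?thesis
    by (rule exI[of _ C], rule exI[of _ d]) (use C(1) d levy dist in auto)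
qed

end
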